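(* Let $(Z,d)$ be a complete separable metric space, $\mu\in\mathcal P(Z)$, $n\in\mathbb N$ and $t\in[0,1]$. For $\xi\in\mathcal M_n(Z)$ and $\Pi\in\mathcal P(\mathcal M_n(Z))$ set $$c_t(\xi,\Pi)=\int\alpha_t\left(\int\left[1-\frac{\chi(x)}{\xi(x)}\right]_+\Pi(d\chi)\right)\xi(dx),$$ with $\alpha_t$ the function defined in the context. Then for all $\Pi_1,\Pi_2\in\mathcal P(\mathcal M_n(Z))$, $$\mathcal T_{c_t}(\Pi_2|\Pi_1)\le\frac1t\,\mathcal H(\Pi_1|B_{\mu,n})+\frac1{1-t}\,\mathcal H(\Pi_2|B_{\mu,n}).$$
   Context: $\mathcal P(E)$ is the set of Borel probability measures on a Polish space $E$. $\mathcal M_n(Z)=\{\sum_{i=1}^n\delta_{a_i}:a_1,\dots,a_n\in Z\}$ with the weak topology (Polish). $\xi(x)$ means $\xi(\{x\})$; $[u]_+=\max(u,0)$. For $t\in(0,1)$ and $u\in[0,1]$, $$\alpha_t(u)=\frac{t(1-u)\log(1-u)-(1-tu)\log(1-tu)}{t(1-t)}$$ (with $0\log0=0$), and by taking limits $\alpha_0(u)=(1-u)\log(1-u)+u$, $\alpha_1(u)=-u-\log(1-u)$ (so $\alpha_1(1)=+\infty$). When $t=0$ or $t=1$, $1/t$ or $1/(1-t)$ equals $+\infty$ and the convention $0\cdot\infty=0$ is used (e.g. for $t=1$ the inequality is non-trivial only if $\Pi_2=B_{\mu,n}$). Relative entropy: $\mathcal H(\Pi|\Pi')=\int\log\frac{d\Pi}{d\Pi'}d\Pi$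 if $\Pi\ll\Pi'$, $+\infty$ otherwise. Generalized transport cost: for $c:E\times\mathcal P(E)\to[0,\infty]$ and $\Pi_1,\Pi_2\in\mathcal P(E)$, $\mathcal T_c(\Pi_2|\Pi_1)=\inf\int c(\xi,p_\xi)\,\Pi_1(d\xi)$, the infimum being over all couplings $p_\xi(d\chi)\Pi_1(d\xi)$ with first marginal $\Pi_1$ and second marginal $\Pi_2$, $\xi\mapsto p_\xi\in\mathcal P(E)$ being a kernel. $B_{\mu,n}$ is the law of $\sum_{i=1}^n\delta_{X_i}$ with $X_1,\dots,X_n$ i.i.d. of law $\mu$. *)

theory Defs
  imports "HOL-Probability.Probability"
begin

definition borel_of :: "'a topology \<Rightarrow> 'a measure" where
  "borel_of T = sigma (topspace T) {U. openin T U}"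

lemma space_borel_of [simp]: "space (borel_of T) = topspace T"
  unfolding borel_of_def by (rule space_measure_of) (auto dest: openin_subset)

lemma sets_borel_of: "sets (borel_of T) = sigma_sets (topspace T) {U. openin T U}"
  unfolding borel_of_def by (rule sets_measure_of) (auto dest: openin_subset)

text \<open>Throughout, the set of Borel probability measures on a space \<open>E\<close> with Borel
  sigma-algebra \<open>M\<close> is \<^term>\<open>space (prob_algebra M)\<close>, and a probability kernel from \<open>E\<close> to
  itself is an element of \<^term>\<open>measurable M (prob_algebra M)\<close>.\<close>


section \<open>Counting measures with \<open>n\<close> atoms\<close>

definition sum_dirac :: "nat \<Rightarrow> (nat \<Rightarrow> 'a::topological_space) \<Rightarrow> 'a measure" where
  "sum_dirac n a = measure_of UNIV (sets borel) (\<lambda>A. \<Sum>i<n. emeasure (return borel (a i)) A)"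

lemma space_sum_dirac [simp]: "space (sum_dirac n a) = UNIV"
  unfolding sum_dirac_def by (subst space_measure_of) auto

lemma sets_sum_dirac [simp, measurable_cong]: "sets (sum_dirac n a) = sets borel"
proof -
  have "sets (sum_dirac n a) = sigma_sets UNIV (sets borel)"
    unfolding sum_dirac_def by (rule sets_measure_of) auto
  also have "\<dots> = sets borel"
    using sets.sigma_sets_eq[of "borel :: 'a measure"] by simp
  finally show ?thesis .
qed

lemma emeasure_sum_dirac:
  assumes "A \<in> sets borel"
  shows "emeasure (sum_dirac n a) A = (\<Sum>i<n. indicator A (a i))"
proof -
  let ?m = "\<lambda>A. \<Sum>i<n. emeasure (return borel (a i)) A"
  have "countably_additive (sets borel) ?m"
  proof (rule countably_additiveI)
    fix F :: "nat \<Rightarrow> 'a set"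
    assume F: "range F \<subseteq> sets borel" "disjoint_family F"
    have "(\<Sum>k. ?m (F k)) = (\<Sum>i<n. \<Sum>k. emeasure (return borel (a i)) (F k))"
      by (rule suminf_sum) (rule summableI)
    also have "\<dots> = ?m (\<Union>k. F k)"
      using F by (intro sum.cong refl suminf_emeasure) auto
    finally show "(\<Sum>k. ?m (F k)) = ?m (\<Union>k. F k)" .
  qed
  then have "emeasure (sum_dirac n a) A = ?m A"
    using assms
    by (subst emeasure_measure_of[OF sum_dirac_def])
      (simp_all add: positive_def del: emeasure_return)
  then show ?thesis
    using assms by simp
qed

definition counting_measures :: "nat \<Rightarrow> 'a::topological_space measure set" where
  "counting_measures n = range (sum_dirac n)"

text \<open>The weak topology: the coarsest one for which \<open>\<xi> \<mapsto> \<integral>f d\<xi>\<close> is continuous for every bounded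
  continuous \<open>f\<close>.\<close>

definition weak_topology :: "nat \<Rightarrow> 'a::topological_space measure topology" where
  "weak_topology n = topology_generated_by
     {{\<xi> \<in> counting_measures n. (\<integral>x. f x \<partial>\<xi>) \<in> U} | (f :: 'a \<Rightarrow> real) U.
        continuous_on UNIV f \<and> bounded (range f) \<and> open U}"

lemma topspace_weak_topology [simp]: "topspace (weak_topology n) = counting_measures n"
proof -
  have "continuous_on UNIV (\<lambda>_::'a. 0::real) \<and> bounded (range (\<lambda>_::'a. 0::real))
      \<and> open (UNIV :: real set)"
    by simp
  then have "counting_measures n \<subseteq> topspace (weak_topology n)"
    unfolding weak_topology_def topology_generated_by_topspace by blast
  moreover have "topspace (weak_topology n) \<subseteq> counting_measures n"
    unfolding weak_topology_def topology_generated_by_topspace by blast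
  ultimately show ?thesis by blast
qed

definition counting_space :: "nat \<Rightarrow> 'a::topological_space measure measure" where
  "counting_space n = borel_of (weak_topology n)"

definition binomial_process ::
    "'a::topological_space measure \<Rightarrow> nat \<Rightarrow> 'a measure measure" where
  "binomial_process \<mu> n = distr (\<Pi>\<^sub>M i\<in>{..<n}. \<mu>) (counting_space n) (sum_dirac n)"


section \<open>Relative entropy and transport costs\<close>

text \<open>The integral of \<open>log (dP/dQ)\<close> is the difference of the integrals of its positive and negative
  parts (\<^const>\<open>ennreal\<close> maps negative reals to 0). The second one is at most \<open>1/e\<close>, because
  \<open>- y * log y \<le> 1/e\<close>, so that \<open>\<infinity> - \<infinity>\<close> does not occur.\<close>

definition rel_entropy :: "'a measure \<Rightarrow> 'a measure \<Rightarrow> ereal" where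
  "rel_entropy P Q =
     (if absolutely_continuous Q P
      then enn2ereal (\<integral>\<^sup>+ x. ennreal (ln (enn2real (RN_deriv Q P x))) \<partial>P)
         - enn2ereal (\<integral>\<^sup>+ x. ennreal (- ln (enn2real (RN_deriv Q P x))) \<partial>P)
      else \<infinity>)"

text \<open>The joint law \<open>p\<^sub>\<xi>(d\<eta>) P(d\<xi>)\<close>.\<close>

definition kernel_joint ::
    "'a measure \<Rightarrow> 'a measure \<Rightarrow> ('a \<Rightarrow> 'a measure) \<Rightarrow> ('a \<times> 'a) measure" where
  "kernel_joint M P p = P \<bind> (\<lambda>\<xi>. distr (p \<xi>) (M \<Otimes>\<^sub>M M) (Pair \<xi>))"

definition coupling_kernels ::
    "'a measure \<Rightarrow> 'a measure \<Rightarrow> 'a measure \<Rightarrow> ('a \<Rightarrow> 'a measure) set" where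
  "coupling_kernels M P\<^sub>1 P\<^sub>2 = {p \<in> measurable M (prob_algebra M).
     distr (kernel_joint M P\<^sub>1 p) M fst = P\<^sub>1 \<and> distr (kernel_joint M P\<^sub>1 p) M snd = P\<^sub>2}"

text \<open>\<open>transport_cost M c P\<^sub>2 P\<^sub>1\<close> is \<open>\<T>\<^sub>c(P\<^sub>2|P\<^sub>1)\<close>, with kernels going from \<open>P\<^sub>1\<close> to \<open>P\<^sub>2\<close>.\<close>

definition transport_cost ::
    "'a measure \<Rightarrow> ('a \<Rightarrow> 'a measure \<Rightarrow> ennreal) \<Rightarrow> 'a measure \<Rightarrow> 'a measure \<Rightarrow> ennreal" where
  "transport_cost M c P\<^sub>2 P\<^sub>1 = (INF p \<in> coupling_kernels M P\<^sub>1 P\<^sub>2. \<integral>\<^sup>+ \<xi>. c \<xi> (p \<xi>) \<partial>P\<^sub>1)"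


section \<open>The cost\<close>

text \<open>Since \<open>ln 0 = 0\<close> here, \<open>0 * log 0 = 0\<close> is automatic, but the value \<open>\<alpha>\<^sub>1(1) = \<infinity>\<close> has to be set
  explicitly. Only \<open>t, u \<in> [0,1]\<close> matter.\<close>

definition alpha :: "real \<Rightarrow> real \<Rightarrow> ereal" where
  "alpha t u =
     (if t = 0 then ereal ((1 - u) * ln (1 - u) + u)
      else if t = 1 then (if u = 1 then \<infinity> else ereal (- u - ln (1 - u)))
      else ereal ((t * (1 - u) * ln (1 - u) - (1 - t * u) * ln (1 - t * u)) / (t * (1 - t))))"

lemma entropy_tangent:
  fixes s y :: real
  assumes "0 \<le> s" "0 < y"
  shows "s * ln y + s - y \<le> s * ln s"
proof (cases "s = 0")
  case False
  with assms have s: "s > 0" by simp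
  have "ln (y / s) \<le> y / s - 1"
    using s assms by (intro ln_le_minus_one) simp
  then have "s * ln (y / s) \<le> s * (y / s - 1)"
    using s by (intro mult_left_mono) auto
  then show ?thesis
    using s assms by (simp add: ln_div algebra_simps)
qed (use assms in simp)

text \<open>Hence \<^const>\<open>e2ennreal\<close> truncates nothing in the cost below.\<close>

lemma alpha_nonneg:
  assumes t: "0 \<le> t" "t \<le> 1" and u: "0 \<le> u" "u \<le> 1"
  shows "0 \<le> alpha t u"
proof -
  consider "t = 0" | "t = 1" | "0 < t" "t < 1"
    using t by linarith
  then show ?thesis
  proof cases
    case 1
    then show ?thesis
      using entropy_tangent[of "1 - u" 1] u by (simp add: alpha_def)
  next
    case 2
    then show ?thesis
      using ln_le_minus_one[of "1 - u"] u by (auto simp: alpha_def)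
  next
    case 3
    define y where "y = 1 - t * u"
    have "t * u \<le> t * 1"
      using u 3 by (intro mult_left_mono) auto
    then have "t * u < 1"
      using 3 by linarith
    then have y: "y > 0"
      by (simp add: y_def)
    have "t * ((1 - u) * ln y + (1 - u) - y) \<le> t * ((1 - u) * ln (1 - u))"
      using entropy_tangent[of "1 - u" y] u y 3 by (intro mult_left_mono) auto
    moreover have "(1 - t) * (ln y + 1 - y) \<le> 0"
      using entropy_tangent[of 1 y] y 3 by (intro mult_nonneg_nonpos) auto
    moreover have "t * ((1 - u) * ln y + (1 - u) - y) + (1 - t) * (ln y + 1 - y) = y * ln y"
      by (simp add: y_def algebra_simps)
    ultimately have "0 \<le> t * (1 - u) * ln (1 - u) - y * ln y"
      by (simp add: mult.assoc)
    then show ?thesis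
      using 3 by (simp add: alpha_def y_def)
  qed
qed

text \<open>Points \<open>x\<close> with \<open>\<xi>(x) = 0\<close>, where the quotient is meaningless, form a \<open>\<xi>\<close>-null set.\<close>

definition cost :: "real \<Rightarrow> 'a measure \<Rightarrow> 'a measure measure \<Rightarrow> ennreal" where
  "cost t \<xi> P =
     (\<integral>\<^sup>+ x. e2ennreal (alpha t (\<integral>\<eta>. max (1 - measure \<eta> {x} / measure \<xi> {x}) 0 \<partial>P)) \<partial>\<xi>)"

end

(*
  Write f1, f2 for the densities of the two laws with respect to a reference probability. On one space
  the maximal coupling moves the point x with conditional probability u = [1 - f2/f1]_+, and
  t (1 - t) f1 alpha_t(u) is exactly the Jensen gap of x ln x between f1 and f2 at weights 1 - t, t (where
  f2 < f1), so f1 alpha_t(u) is bounded pointwise by (1/t) phi(f1) + (1/(1-t)) phi(f2), where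
  phi(x) = x ln x - x + 1; the integral of phi(f) is the relative entropy. This tensorises to mu^n: coordinates are coupled one after
  the other, the entropies add up by the chain rule, and Jensen's inequality for the convex alpha_t
  handles the averaging over the partner of the earlier coordinates. Finally laws of point measures
  are lifted to exchangeable laws on n-tuples with the same entropy; the coupling there is pushed
  forward, after averaging over all enumerations of the atoms of xi, and Jensen's inequality over the
  indices i with x_i = z compares the two costs.
*)
theory Submission
  imports Defs
begin

section \<open>Entropy and cost functions\<close>

text \<open>The entropy is carried by \<open>entropy_fun\<close> because it is nonnegative: every
  integral lives in \<open>ennreal\<close>, and an infinite one needs no separate treatment. The
  price is that identities with signed terms are proved after moving the negative parts across. For
  a similar reason convexity of the cost appears as supporting lines: alpha_1 takes the value
  infinity at 1. The cost sees a coupling only through the conditional laws, by way of the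
  probabilities that points move. Hence the objects constructed are kernels, not joint laws, and a
  kernel may be averaged over auxiliary randomness without raising the cost. The obstacle for point
  measures is measurability. Their atoms are listed by an arbitrary choice, and nothing is known
  about how the list depends on \<xi>. The law of a uniformly random enumeration forgets the choice,
  and its value on a box depends only on how many atoms lie in finitely many sets.\<close>

definition entropy_fun :: "real \<Rightarrow> real" where
  "entropy_fun x = x * ln x - x + 1"

lemma entropy_fun_nonneg: "0 \<le> x \<Longrightarrow> 0 \<le> entropy_fun x"
  using entropy_tangent[of x 1] by (simp add: entropy_fun_def)

lemma entropy_fun_measurable [measurable]: "entropy_fun \<in> borel_measurable borel"
  unfolding entropy_fun_def by measurable

text \<open>Equality case of ln y \<le> y - 1 at y = 1/x. It settles t = 0 and t = 1: an infinite
  coefficient leaves something to prove only at a density value where \<open>entropy_fun\<close>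
  vanishes, that is at 1.\<close>

lemma entropy_fun_eq_0: 
  assumes "0 \<le> x" "entropy_fun x = 0" shows "x = 1"
proof (cases "x = 0")
  case False
  with assms have x: "x > 0" by simp
  have "ln (1/x) = 1/x - 1" using assms x by (simp add: entropy_fun_def ln_div field_simps)
  then have "1/x = 1" using ln_eq_minus_one[of "1/x"] x by simp
  then show ?thesis by simp
qed (use assms in \<open>auto simp: entropy_fun_def\<close>)

definition acost :: "real \<Rightarrow> real \<Rightarrow> ennreal" where
  "acost t u = e2ennreal (alpha t u)"

lemma acost_measurable [measurable]: "acost t \<in> borel_measurable borel"
  unfolding acost_def alpha_def by measurable

lemma acost_0 [simp]: "acost t 0 = 0"
  by (simp add: acost_def alpha_def)

text \<open>In \<^typ>\<open>ennreal\<close> we have \<open>1 / 0 = \<infinity>\<close> and \<open>\<infinity> * 0 = 0\<close>, so that \<open>t = 0\<close> and \<open>t = 1\<close> are covered: then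
  the bound is trivial unless \<open>a = 1\<close>, respectively \<open>b = 1\<close>.\<close>

lemma acost_ratio_le:
  fixes a b t :: real
  assumes t: "0 \<le> t" "t \<le> 1" and ab: "0 \<le> a" "0 \<le> b"
  shows "ennreal a * acost t (max (1 - b / a) 0)
    \<le> 1 / ennreal t * ennreal (entropy_fun a) + 1 / ennreal (1 - t) * ennreal (entropy_fun b)"
proof (cases "0 < a \<and> b < a")
  case False
  then have "a = 0 \<or> max (1 - b / a) 0 = 0" using ab by (auto simp: field_simps max_def)
  then show ?thesis by auto
next
  case True
  then have a: "0 < a" and ba: "b < a" by auto
  have u: "max (1 - b / a) 0 = 1 - b / a" using a ba by (auto simp: field_simps max_def)
  consider (t0) "t = 0" | (t1) "t = 1" | (ti) "0 < t" "t < 1" using t by linarith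
  then show ?thesis
  proof cases
    case t0
    show ?thesis
    proof (cases "entropy_fun a = 0")
      case False
      with entropy_fun_nonneg[of a] a have "0 < entropy_fun a" by simp
      then show ?thesis using t0 by (simp add: divide_ennreal_def ennreal_top_mult)
    next
      case True
      \<comment> \<open>Here 1 - u = b, so alpha_0(u) is exactly \<open>entropy_fun b\<close> and
        the bound is an equality.\<close>
      then have "a = 1" using entropy_fun_eq_0 ab by auto
      then show ?thesis using t0 u ab
        by (simp add: acost_def alpha_def entropy_fun_def e2ennreal_ereal algebra_simps)
    qed
  next
    case t1
    show ?thesis
    proof (cases "entropy_fun b = 0")
      case False
      with entropy_fun_nonneg[of b] ab have "0 < entropy_fun b" by simp
      then show ?thesis using t1 by (simp add: divide_ennreal_def ennreal_top_mult)
    next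
      case True
      then have b1: "b = 1" using entropy_fun_eq_0 ab by auto
      \<comment> \<open>For b = 1 the argument u = 1 - 1/a is below 1, so the finite branch of
        alpha_1 applies and again gives an equality.\<close>
      have "a * (- (1 - 1/a) - ln (1/a)) = entropy_fun a"
        using a by (simp add: entropy_fun_def ln_div field_simps)
      then show ?thesis using t1 u a b1
        by (simp add: acost_def alpha_def  e2ennreal_ereal divide_ennreal_def flip: ennreal_mult')
    qed
  next
    case ti
    note t = ti
    \<comment> \<open>The mixture of the two density values. The identity 1 - t u = m/a turns the
      second logarithm of alpha_t into ln m - ln a, and the linear terms of
      \<open>entropy_fun\<close> cancel because m is the same mixture of a and b.\<close>
    define m where "m = (1 - t) * a + t * b"
    have m: "m > 0" using t a ab by (simp add: m_def add_pos_nonneg)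
    have m1: "1 - t * (1 - b / a) = m / a" using a by (simp add: m_def field_simps)
    have ent: "0 \<le> entropy_fun m" using entropy_fun_nonneg m by simp
    have eq: "a * (t * (1 - (1 - b/a)) * ln (1 - (1 - b/a)) - (1 - t * (1 - b/a)) * ln (1 - t * (1 - b/a)))
      = t * entropy_fun b + (1 - t) * entropy_fun a - entropy_fun m"
    proof (cases "b = 0")
      case True
      have "a * (t * (1 - (1 - b/a)) * ln (1 - (1 - b/a)) - (1 - t * (1 - b/a)) * ln (1 - t * (1 - b/a)))
        = - m * ln (m / a)" unfolding m1 using True a by simp
      also have "\<dots> = - m * ln m + m * ln a" using m a by (simp add: ln_div algebra_simps)
      finally show ?thesis using True by (simp add: entropy_fun_def m_def algebra_simps)
    next
      case False
      then have b: "b > 0" using ab by simp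
      have "a * (t * (1 - (1 - b/a)) * ln (1 - (1 - b/a)) - (1 - t * (1 - b/a)) * ln (1 - t * (1 - b/a)))
        = t * b * ln (b/a) - m * ln (m / a)" unfolding m1 using a by (simp add: algebra_simps)
      also have "\<dots> = t * b * ln b + (1 - t) * a * ln a - m * ln m"
        using m a b by (simp add: ln_div m_def algebra_simps)
      finally show ?thesis by (simp add: entropy_fun_def m_def algebra_simps)
    qed
    have "a * ((t * (1 - (1 - b/a)) * ln (1 - (1 - b/a)) - (1 - t * (1 - b/a)) * ln (1 - t * (1 - b/a))) / (t * (1 - t)))
      = (t * entropy_fun b + (1 - t) * entropy_fun a - entropy_fun m) / (t * (1 - t))"
      unfolding eq[symmetric] by simp
    \<comment> \<open>Only the term with \<open>entropy_fun m\<close> is lost here, and it is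
      nonnegative.\<close>
    also have "\<dots> \<le> (t * entropy_fun b + (1 - t) * entropy_fun a) / (t * (1 - t))"
      using ent t by (intro divide_right_mono) auto
    also have "\<dots> = 1 / t * entropy_fun a + 1 / (1 - t) * entropy_fun b"
      using t by (simp add: field_simps)
    finally have le: "a * ((t * (1 - (1 - b/a)) * ln (1 - (1 - b/a)) - (1 - t * (1 - b/a)) * ln (1 - t * (1 - b/a))) / (t * (1 - t)))
      \<le> 1 / t * entropy_fun a + 1 / (1 - t) * entropy_fun b" .
    have "ennreal a * acost t (max (1 - b / a) 0) = 
      ennreal (a * ((t * (1 - (1 - b/a)) * ln (1 - (1 - b/a)) - (1 - t * (1 - b/a)) * ln (1 - t * (1 - b/a))) / (t * (1 - t))))"
      unfolding u acost_def alpha_def using t a by (simp add: e2ennreal_ereal flip: ennreal_mult')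
    also have "\<dots> \<le> ennreal (1 / t * entropy_fun a + 1 / (1 - t) * entropy_fun b)"
      using le by (rule ennreal_leI)
    also have "\<dots> = ennreal (1/t) * ennreal (entropy_fun a) + ennreal (1/(1-t)) * ennreal (entropy_fun b)"
      using t entropy_fun_nonneg[of a] entropy_fun_nonneg[of b] ab
      by (subst ennreal_plus) (auto intro!: mult_nonneg_nonneg simp del: times_divide_eq_left
        intro!: arg_cong2[where f="(+)"] ennreal_mult)
    also have "ennreal (1/t) = 1 / ennreal t" using t divide_ennreal[of 1 t] by simp
    also have "ennreal (1/(1-t)) = 1 / ennreal (1-t)" using t divide_ennreal[of 1 "1-t"] by simp
    finally show ?thesis .
  qed
qed

section \<open>Convexity and monotonicity of the cost function\<close>

lemma e2ennreal_plus:
  assumes "0 \<le> a" "0 \<le> b"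
  shows "e2ennreal (a + b) = e2ennreal a + e2ennreal b"
proof -
  have "a + b = enn2ereal (e2ennreal a + e2ennreal b)"
    using assms by (simp add: plus_ennreal.rep_eq enn2ereal_e2ennreal)
  then show ?thesis by simp
qed

text \<open>The slope c is the derivative of alpha_t at v, which is why v = 1 is excluded: there it
  is infinite. The inequality alpha(v) + c (u - v) \<le> alpha(u) is written with the two products
  on separate sides since \<open>ennreal\<close> has no negative numbers. The sign c \<ge> 0 is
  recorded because it also yields monotonicity.\<close>

lemma acost_tangent:
  assumes t: "0 \<le> t" "t \<le> 1" and v: "0 \<le> v" "v < 1"
  shows "acost t v < \<infinity> \<and> (\<exists>c\<ge>0. \<forall>u. 0 \<le> u \<longrightarrow> u \<le> 1 \<longrightarrow> 
    acost t v + ennreal (c * u) \<le> acost t u + ennreal (c * v))"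
proof -
  consider (t0) "t = 0" | (t1) "t = 1" | (ti) "0 < t" "t < 1" using t by linarith
  then have "\<exists>c. 0 \<le> c \<and> (\<forall>u. 0 \<le> u \<longrightarrow> u \<le> 1 \<longrightarrow>
     alpha t v + ereal (c * u) \<le> alpha t u + ereal (c * v))"
  proof cases
    case t0
    show ?thesis
    proof (intro exI[of _ "- ln (1 - v)"] conjI allI impI)
      show "0 \<le> - ln (1 - v)" using v by simp
      fix u :: real assume u: "0 \<le> u" "u \<le> 1"
      then show "alpha t v + ereal (- ln (1 - v) * u) \<le> alpha t u + ereal (- ln (1 - v) * v)"
        using entropy_tangent[of "1 - u" "1 - v"] v t0
        by (simp add: alpha_def algebra_simps)
    qed
  next
    case t1
    show ?thesis
    proof (intro exI[of _ "v / (1 - v)"] conjI allI impI)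
      show "0 \<le> v / (1 - v)" using v by simp
      fix u :: real assume u: "0 \<le> u" "u \<le> 1"
      show "alpha t v + ereal (v / (1 - v) * u) \<le> alpha t u + ereal (v / (1 - v) * v)"
      proof (cases "u = 1")
        case False
        then have u1: "u < 1" using u by simp
        have "ln ((1 - u) / (1 - v)) \<le> (1 - u) / (1 - v) - 1"
          using u1 v by (intro ln_le_minus_one) simp
        then have "ln (1 - u) - ln (1 - v) \<le> (1 - u) / (1 - v) - 1"
          using u1 v by (simp add: ln_div)
        moreover have "(1 - u) / (1 - v) - 1 = (v / (1 - v) * v - u) - (v / (1 - v) * u - v)"
        proof -
          define k where "k = 1 / (1 - v)"
          have k: "k = k * v + 1" "v / (1 - v) = k - 1" "(1 - u) / (1 - v) = (1 - u) * k"
            using v by (auto simp: k_def field_simps)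
          show ?thesis unfolding k(2,3) using k(1) by (simp add: algebra_simps)
        qed
        ultimately show ?thesis using t1 u1 v by (simp add: alpha_def)
      qed (use t1 v in \<open>simp add: alpha_def\<close>)
    qed
  next
    case ti
    note t = ti
    define L where "L = ln (1 - v)"
    define M where "M = ln (1 - t * v)"
    have tv: "0 < 1 - t * v" using t v mult_strict_mono'[of t 1 v 1] by simp
    show ?thesis
    proof (intro exI[of _ "(M - L) / (1 - t)"] conjI allI impI)
      have "t * v \<le> v" using t v by (simp add: mult_left_le_one_le)
      then have "L \<le> M" unfolding L_def M_def using v tv by (subst ln_le_cancel_iff) auto
      then show "0 \<le> (M - L) / (1 - t)" using t by simp
      fix u :: real assume u: "0 \<le> u" "u \<le> 1"
      have "t * u \<le> t * 1" using u t by (intro mult_left_mono) auto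
      then have tu: "0 < 1 - t * u" using t by linarith
      \<comment> \<open>What follows is the log-sum inequality for the pairs (1 - u, 1 - v) and (1,
        1) with weights t and 1 - t. The ratio r of the weighted totals 1 - t u and 1 - t v is the
        scaling for which the linear terms of the two tangent inequalities cancel.\<close>
      define r where "r = (1 - t * u) / (1 - t * v)"
      have r: "r > 0" using tu tv by (simp add: r_def)
      have lr: "ln r = ln (1 - t * u) - M" unfolding r_def M_def using tu tv by (simp add: ln_div)
      have "(1 - u) * ln ((1 - v) * r) + (1 - u) - (1 - v) * r \<le> (1 - u) * ln (1 - u)"
        using u v r by (intro entropy_tangent) auto
      then have "t * ((1 - u) * (L + ln r) + (1 - u) - (1 - v) * r) \<le> t * ((1 - u) * ln (1 - u))"
        using t v r by (intro mult_left_mono) (auto simp: ln_mult L_def)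
      moreover have "(1 - t) * (ln r + 1 - r) \<le> 0"
        using t r ln_le_minus_one[of r] by (intro mult_nonneg_nonpos) auto
      moreover have "r * (1 - t * v) = 1 - t * u" using tv by (simp add: r_def)
      ultimately have "t * (1 - v) * L - (1 - t * v) * M + t * (M - L) * (u - v)
         \<le> t * (1 - u) * ln (1 - u) - (1 - t * u) * ln (1 - t * u)"
        unfolding lr by (simp add: algebra_simps)
      then have "(t * (1 - v) * L - (1 - t * v) * M + t * (M - L) * (u - v)) / (t * (1 - t))
         \<le> (t * (1 - u) * ln (1 - u) - (1 - t * u) * ln (1 - t * u)) / (t * (1 - t))"
        using t by (intro divide_right_mono) auto
      moreover have "(t * (1 - v) * L - (1 - t * v) * M + t * (M - L) * (u - v)) / (t * (1 - t))
        = (t * (1 - v) * L - (1 - t * v) * M) / (t * (1 - t)) + (M - L) / (1 - t) * (u - v)"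
        using t by (simp add: add_divide_distrib)
      moreover define k where "k = (M - L) / (1 - t)"
      moreover define X where "X = (t * (1 - v) * L - (1 - t * v) * M) / (t * (1 - t))"
      moreover define Y where "Y = (t * (1 - u) * ln (1 - u) - (1 - t * u) * ln (1 - t * u)) / (t * (1 - t))"
      ultimately have "X + k * (u - v) \<le> Y" by simp
      moreover have "alpha t v = ereal X" "alpha t u = ereal Y"
        using t by (auto simp: alpha_def L_def M_def X_def Y_def)
      ultimately show "alpha t v + ereal ((M - L) / (1 - t) * u) \<le> alpha t u + ereal ((M - L) / (1 - t) * v)"
        unfolding k_def[symmetric] by (simp add: right_diff_distrib)
    qed
  qed
  then obtain c where c: "0 \<le> c" "\<And>u. 0 \<le> u \<Longrightarrow> u \<le> 1 \<Longrightarrow>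
     alpha t v + ereal (c * u) \<le> alpha t u + ereal (c * v)" by blast
  have "acost t v + ennreal (c * u) \<le> acost t u + ennreal (c * v)" if "0 \<le> u" "u \<le> 1" for u
  proof -
    have "e2ennreal (alpha t v + ereal (c * u)) \<le> e2ennreal (alpha t u + ereal (c * v))"
      using c(2)[OF that] by (rule e2ennreal_mono)
    moreover have "0 \<le> alpha t v" "0 \<le> alpha t u" using v that t by (auto intro!: alpha_nonneg)
    ultimately show ?thesis using c(1) v that by (simp add: acost_def e2ennreal_plus e2ennreal_ereal)
  qed
  moreover have "acost t v < \<infinity>"
    using v by (auto simp: acost_def alpha_def)
  ultimately show ?thesis using c(1) by blast
qed

text \<open>The supporting line at v, evaluated at u, lies above its value at v because its slope is
  nonnegative.\<close>

lemma acost_mono: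
  assumes t: "0 \<le> t" "t \<le> 1" and "0 \<le> v" "v \<le> u" "u \<le> 1"
  shows "acost t v \<le> acost t u"
proof (cases "v = 1")
  case False
  then obtain c where c: "c \<ge> 0" and le: "acost t v + ennreal (c * u) \<le> acost t u + ennreal (c * v)"
    using acost_tangent[OF t, of v] assms by fastforce
  note le
  also have "\<dots> \<le> acost t u + ennreal (c * u)"
    using c assms by (intro add_left_mono ennreal_leI mult_left_mono) auto
  finally show ?thesis by (simp add: ennreal_add_left_cancel_le add.commute)
qed (use assms in auto)

text \<open>Integrate the supporting line at the mean v. For v = 1, where there is none, u equals 1
  almost everywhere and both sides are alpha_t(1), possibly infinite.\<close>

lemma acost_jensen:
  assumes t: "0 \<le> t" "t \<le> 1" and M: "prob_space M"
    and u: "u \<in> borel_measurable M" "\<And>x. x \<in> space M \<Longrightarrow> 0 \<le> u x \<and> u x \<le> 1"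
  shows "acost t (\<integral>x. u x \<partial>M) \<le> (\<integral>\<^sup>+x. acost t (u x) \<partial>M)"
proof -
  interpret prob_space M by fact
  note [measurable] = u(1)
  have int: "integrable M u"
    using u by (intro integrable_const_bound[where B=1]) auto
  define v where "v = (\<integral>x. u x \<partial>M)"
  have v: "0 \<le> v" "v \<le> 1" unfolding v_def
    using u int by (auto intro!: integral_nonneg_AE integral_le_const)
  show ?thesis
  proof (cases "v = 1")
    case True
    have "(\<integral>x. 1 - u x \<partial>M) = 0" using True int by (simp add: v_def prob_space)
    then have "AE x in M. 1 - u x = 0"
      using u int by (subst (asm) integral_nonneg_eq_0_iff_AE) auto
    then have "(\<integral>\<^sup>+x. acost t (u x) \<partial>M) = (\<integral>\<^sup>+x. acost t 1 \<partial>M)"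
      by (intro nn_integral_cong_AE) auto
    then show ?thesis using True by (simp add: emeasure_space_1 flip: v_def)
  next
    case False
    then obtain c where c: "c \<ge> 0" "\<And>u. 0 \<le> u \<Longrightarrow> u \<le> 1 \<Longrightarrow> acost t v + ennreal (c * u) \<le> acost t u + ennreal (c * v)"
      using acost_tangent[OF t, of v] v by fastforce
    have "acost t v + ennreal (c * v) = (\<integral>\<^sup>+x. acost t v + ennreal (c * u x) \<partial>M)"
      using u c int nn_integral_eq_integral[of M "\<lambda>x. c * u x"]
      by (subst nn_integral_add) (auto simp: emeasure_space_1 v_def)
    also have "\<dots> \<le> (\<integral>\<^sup>+x. acost t (u x) + ennreal (c * v) \<partial>M)"
      using u c by (intro nn_integral_mono) auto
    also have "\<dots> = (\<integral>\<^sup>+x. acost t (u x) \<partial>M) + ennreal (c * v)"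
      by (subst nn_integral_add) (auto simp: emeasure_space_1)
    finally show ?thesis by (simp add: ennreal_add_left_cancel_le add.commute flip: v_def)
  qed
qed

section \<open>Maximal couplings as kernels\<close>

text \<open>The convex combination of two laws, written as a Bernoulli mixture so that facts about
  \<open>bind\<close> show it to be a probability measure.\<close>

definition mix :: "real \<Rightarrow> 'a measure \<Rightarrow> 'a measure \<Rightarrow> 'a measure" where
  "mix m A B = measure_pmf (bernoulli_pmf m) \<bind> (\<lambda>b. if b then A else B)"

lemma mix_in_prob_algebra:
  assumes "A \<in> space (prob_algebra N)" "B \<in> space (prob_algebra N)"
  shows "mix m A B \<in> space (prob_algebra N)"
proof -
  have "(\<lambda>b. if b then A else B) \<in> measure_pmf (bernoulli_pmf m) \<rightarrow>\<^sub>M prob_algebra N"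
    using assms by (auto simp: measurable_def)
  moreover have "measure_pmf (bernoulli_pmf m) \<in> space (prob_algebra (measure_pmf (bernoulli_pmf m)))"
    by (simp add: space_prob_algebra measure_pmf.prob_space_axioms)
  ultimately show ?thesis unfolding mix_def space_prob_algebra[of N]
    using prob_space_bind' sets_bind' by blast
qed

lemma nn_integral_mix:
  assumes A: "A \<in> space (prob_algebra N)" and B: "B \<in> space (prob_algebra N)"
    and m: "0 \<le> m" "m \<le> 1" and f: "f \<in> borel_measurable N"
  shows "(\<integral>\<^sup>+x. f x \<partial>mix m A B) = ennreal m * (\<integral>\<^sup>+x. f x \<partial>A) + ennreal (1 - m) * (\<integral>\<^sup>+x. f x \<partial>B)"
proof -
  have "(\<lambda>b. if b then A else B) \<in> measure_pmf (bernoulli_pmf m) \<rightarrow>\<^sub>M prob_algebra N"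
    using A B by (auto simp: measurable_def)
  then have "(\<lambda>b. if b then A else B) \<in> measure_pmf (bernoulli_pmf m) \<rightarrow>\<^sub>M subprob_algebra N"
    by (rule measurable_prob_algebraD)
  from nn_integral_bind[OF f this] show ?thesis
    using m by (simp add: mix_def mult.commute)
qed

lemma emeasure_mix:
  assumes A: "A \<in> space (prob_algebra N)" and B: "B \<in> space (prob_algebra N)"
    and m: "0 \<le> m" "m \<le> 1" and X: "X \<in> sets N"
  shows "emeasure (mix m A B) X = ennreal m * emeasure A X + ennreal (1 - m) * emeasure B X"
proof -
  have "sets (mix m A B) = sets N" using mix_in_prob_algebra[OF A B] by (simp add: space_prob_algebra)
  then show ?thesis
    using nn_integral_mix[OF A B m, of "indicator X"] X A B by (simp add: space_prob_algebra)
qed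

lemma mix_measurable:
  assumes [measurable]: "m \<in> borel_measurable M" "A \<in> M \<rightarrow>\<^sub>M prob_algebra N" "B \<in> M \<rightarrow>\<^sub>M prob_algebra N"
    and m: "\<And>x. x \<in> space M \<Longrightarrow> 0 \<le> m x \<and> m x \<le> 1"
  shows "(\<lambda>x. mix (m x) (A x) (B x)) \<in> M \<rightarrow>\<^sub>M prob_algebra N"
proof (rule measurable_prob_algebraI)
  have AB: "x \<in> space M \<Longrightarrow> A x \<in> space (prob_algebra N) \<and> B x \<in> space (prob_algebra N)" for x
    by (auto intro: measurable_space[OF assms(2)] measurable_space[OF assms(3)])
  show "prob_space (mix (m x) (A x) (B x))" if "x \<in> space M" for x
    using mix_in_prob_algebra[of "A x" N "B x"] AB that by (simp add: space_prob_algebra)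
  show "(\<lambda>x. mix (m x) (A x) (B x)) \<in> M \<rightarrow>\<^sub>M subprob_algebra N"
  proof (rule measurable_subprob_algebra)
    fix x assume "x \<in> space M"
    then have *: "mix (m x) (A x) (B x) \<in> space (prob_algebra N)"
      using mix_in_prob_algebra AB by blast
    then show "subprob_space (mix (m x) (A x) (B x))" "sets (mix (m x) (A x) (B x)) = sets N"
      by (auto simp: space_prob_algebra prob_space_imp_subprob_space)
  next
    fix X assume [measurable]: "X \<in> sets N"
    note [measurable] = measurable_prob_algebraD[OF assms(2)] measurable_prob_algebraD[OF assms(3)]
    have "(\<lambda>x. ennreal (m x) * emeasure (A x) X + ennreal (1 - m x) * emeasure (B x) X) \<in> borel_measurable M"
      by measurable
    then show "(\<lambda>x. emeasure (mix (m x) (A x) (B x)) X) \<in> borel_measurable M"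
      using AB m by (subst measurable_cong[OF emeasure_mix]) auto
  qed
qed

lemma density_measurable_prob:
  assumes mu: "sigma_finite_measure \<mu>"
    and [measurable]: "(\<lambda>(w, z). k w z) \<in> borel_measurable (M \<Otimes>\<^sub>M \<mu>)"
    and one: "\<And>w. w \<in> space M \<Longrightarrow> (\<integral>\<^sup>+z. k w z \<partial>\<mu>) = 1"
  shows "(\<lambda>w. density \<mu> (k w)) \<in> M \<rightarrow>\<^sub>M prob_algebra \<mu>"
proof (rule measurable_prob_algebraI)
  interpret sigma_finite_measure \<mu> by fact
  have km: "k w \<in> borel_measurable \<mu>" if "w \<in> space M" for w
    using that by measurable
  show pr: "prob_space (density \<mu> (k w))" if "w \<in> space M" for w
    using that km one by (intro prob_spaceI) (simp add: emeasure_density cong: nn_integral_cong)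
  show "(\<lambda>w. density \<mu> (k w)) \<in> M \<rightarrow>\<^sub>M subprob_algebra \<mu>"
  proof (rule measurable_subprob_algebra)
    fix X assume [measurable]: "X \<in> sets \<mu>"
    have "(\<lambda>w. \<integral>\<^sup>+z. k w z * indicator X z \<partial>\<mu>) \<in> borel_measurable M" by measurable
    then show "(\<lambda>w. emeasure (density \<mu> (k w)) X) \<in> borel_measurable M"
      using km by (subst measurable_cong[OF emeasure_density]) auto
  qed (use pr in \<open>auto intro: prob_space_imp_subprob_space\<close>)
qed

text \<open>The maximal coupling: stay put with probability \<open>min(1, h2/h1)\<close>, otherwise jump according to the
  normalised excess \<open>(h2 - h1)\<^sub>+\<close>.\<close>

lemma maximal_coupling_kernel:
  fixes h1 h2 :: "'w \<Rightarrow> 'z \<Rightarrow> real"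
  assumes mu: "prob_space \<mu>"
    and h1[measurable]: "(\<lambda>(w, z). h1 w z) \<in> borel_measurable (W \<Otimes>\<^sub>M \<mu>)"
    and h2[measurable]: "(\<lambda>(w, z). h2 w z) \<in> borel_measurable (W \<Otimes>\<^sub>M \<mu>)"
    and nn: "\<And>w z. 0 \<le> h1 w z" "\<And>w z. 0 \<le> h2 w z"
    and one1: "\<And>w. w \<in> space W \<Longrightarrow> (\<integral>\<^sup>+z. h1 w z \<partial>\<mu>) = 1"
    and one2: "\<And>w. w \<in> space W \<Longrightarrow> (\<integral>\<^sup>+z. h2 w z \<partial>\<mu>) = 1"
  obtains q where "(\<lambda>(w, z). q w z) \<in> W \<Otimes>\<^sub>M \<mu> \<rightarrow>\<^sub>M prob_algebra \<mu>"
    "\<And>w (G :: 'z \<Rightarrow> ennreal). w \<in> space W \<Longrightarrow> G \<in> borel_measurable \<mu> \<Longrightarrow>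
      (\<integral>\<^sup>+z. ennreal (h1 w z) * (\<integral>\<^sup>+z'. G z' \<partial>q w z) \<partial>\<mu>) = (\<integral>\<^sup>+z. ennreal (h2 w z) * G z \<partial>\<mu>)"
    "\<And>w z A. w \<in> space W \<Longrightarrow> z \<in> space \<mu> \<Longrightarrow> h1 w z > 0 \<Longrightarrow> A \<in> sets \<mu> \<Longrightarrow> z \<notin> A \<Longrightarrow>
      emeasure (q w z) A \<le> ennreal (max (1 - h2 w z / h1 w z) 0)"
proof -
  interpret prob_space \<mu> by fact
  define e where "e w z = ennreal (max (h2 w z - h1 w z) 0)" for w z
  define D where "D w = (\<integral>\<^sup>+z. e w z \<partial>\<mu>)" for w
  \<comment> \<open>Where h1 vanishes the point stays put; this default keeps h1 m equal to min(h1,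
    h2) at every point.\<close>
  define m where "m w z = (if h1 w z = 0 then 1 else min 1 (h2 w z / h1 w z))" for w z
  \<comment> \<open>Without excess mass the default 1 keeps \<open>k w\<close> a probability
    density, so that the jump law is a probability for every w.\<close>
  define k where "k w z = (if D w = 0 then 1 else e w z / D w)" for w z
  define \<nu> where "\<nu> w = density \<mu> (k w)" for w
  define q where "q w z = mix (m w z) (return \<mu> z) (\<nu> w)" for w z
  have [measurable]: "(\<lambda>(w, z). e w z) \<in> borel_measurable (W \<Otimes>\<^sub>M \<mu>)"
    unfolding e_def by measurable
  have [measurable]: "D \<in> borel_measurable W" unfolding D_def by measurable
  have [measurable]: "(\<lambda>(w, z). k w z) \<in> borel_measurable (W \<Otimes>\<^sub>M \<mu>)"
    unfolding k_def by measurable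
  have [measurable]: "(\<lambda>(w, z). m w z) \<in> borel_measurable (W \<Otimes>\<^sub>M \<mu>)"
    unfolding m_def by measurable
  have m01: "0 \<le> m w z" "m w z \<le> 1" for w z using nn by (auto simp: m_def)
  have sec: "h1 w \<in> borel_measurable \<mu>" "h2 w \<in> borel_measurable \<mu>" "e w \<in> borel_measurable \<mu>"
     "k w \<in> borel_measurable \<mu>" "m w \<in> borel_measurable \<mu>" if "w \<in> space W" for w
    using that by measurable
  have Dfin: "D w < \<infinity>" if "w \<in> space W" for w
  proof -
    have "D w \<le> (\<integral>\<^sup>+z. h2 w z \<partial>\<mu>)"
      unfolding D_def e_def using nn by (intro nn_integral_mono) (auto simp: max_def intro!: ennreal_leI)
    also have "\<dots> < \<infinity>" using one2 that by simp
    finally show ?thesis .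
  qed
  \<comment> \<open>Both densities have mass 1, so removing their common part min(h1, h2) leaves
    equal masses: what jumps away is exactly what the jump law has to bring in. The cancellation
    uses that the common part has finite mass.\<close>
  have D_eq: "D w = (\<integral>\<^sup>+z. ennreal (max (h1 w z - h2 w z) 0) \<partial>\<mu>)" if w: "w \<in> space W" for w
  proof -
    note [measurable] = sec[OF w]
    have "(\<integral>\<^sup>+z. ennreal (min (h1 w z) (h2 w z)) \<partial>\<mu>) + D w = (\<integral>\<^sup>+z. h2 w z \<partial>\<mu>)"
      unfolding D_def e_def using nn
      by (subst nn_integral_add[symmetric]) (auto intro!: nn_integral_cong simp: max_def min_def simp flip: ennreal_plus)
    moreover have "(\<integral>\<^sup>+z. ennreal (min (h1 w z) (h2 w z)) \<partial>\<mu>) + (\<integral>\<^sup>+z. ennreal (max (h1 w z - h2 w z) 0) \<partial>\<mu>)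
       = (\<integral>\<^sup>+z. h1 w z \<partial>\<mu>)"
      using nn
      by (subst nn_integral_add[symmetric]) (auto intro!: nn_integral_cong simp: max_def min_def simp flip: ennreal_plus)
    moreover have "(\<integral>\<^sup>+z. ennreal (min (h1 w z) (h2 w z)) \<partial>\<mu>) \<le> (\<integral>\<^sup>+z. h1 w z \<partial>\<mu>)"
      by (intro nn_integral_mono ennreal_leI) auto
    then have "(\<integral>\<^sup>+z. ennreal (min (h1 w z) (h2 w z)) \<partial>\<mu>) \<noteq> \<infinity>"
      using one1[OF w] by (auto simp: top_unique)
    ultimately show ?thesis using one1[OF w] one2[OF w] 
      by (metis ennreal_add_left_cancel infinity_ennreal_def)
  qed
  have kint: "D w * (\<integral>\<^sup>+z. k w z * G z \<partial>\<mu>) = (\<integral>\<^sup>+z. e w z * G z \<partial>\<mu>)"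
    if w: "w \<in> space W" and [measurable]: "G \<in> borel_measurable \<mu>" for w G
  proof (cases "D w = 0")
    case True
    then have "AE z in \<mu>. e w z = 0"
      unfolding D_def using sec[OF w] by (subst (asm) nn_integral_0_iff_AE) auto
    then have "(\<integral>\<^sup>+z. e w z * G z \<partial>\<mu>) = (\<integral>\<^sup>+z. 0 \<partial>\<mu>)"
      by (intro nn_integral_cong_AE) auto
    then show ?thesis using True by simp
  next
    case False
    note [measurable] = sec[OF w]
    have "D w * (\<integral>\<^sup>+z. k w z * G z \<partial>\<mu>) = (\<integral>\<^sup>+z. D w * (e w z / D w * G z) \<partial>\<mu>)"
      using False by (simp add: k_def nn_integral_cmult)
    also have "\<dots> = (\<integral>\<^sup>+z. e w z * G z \<partial>\<mu>)"
    proof (intro nn_integral_cong)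
      fix z
      have "D w * (e w z / D w) = e w z"
        using False Dfin[OF w] unfolding ennreal_times_divide
        by (subst mult.commute) (simp add: ennreal_mult_divide_eq)
      then show "D w * (e w z / D w * G z) = e w z * G z" by (simp flip: mult.assoc)
    qed
    finally show ?thesis .
  qed
  have k1: "(\<integral>\<^sup>+z. k w z \<partial>\<mu>) = 1" if w: "w \<in> space W" for w
  proof (cases "D w = 0")
    case False
    have "D w * (\<integral>\<^sup>+z. k w z \<partial>\<mu>) = D w * 1"
      using kint[OF w, of "\<lambda>_. 1"] by (simp add: D_def)
    then show ?thesis using False Dfin[OF w] by (subst (asm) ennreal_mult_cancel_left) auto
  qed (simp add: k_def emeasure_space_1)
  have \<nu>[measurable]: "\<nu> \<in> W \<rightarrow>\<^sub>M prob_algebra \<mu>"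
    unfolding \<nu>_def using k1 by (intro density_measurable_prob sigma_finite_measure_axioms) auto
  have q: "(\<lambda>(w, z). q w z) \<in> W \<Otimes>\<^sub>M \<mu> \<rightarrow>\<^sub>M prob_algebra \<mu>"
    unfolding q_def split_beta' using m01
    by (intro mix_measurable) auto
  have spc: "\<nu> w \<in> space (prob_algebra \<mu>)" "z \<in> space \<mu> \<Longrightarrow> return \<mu> z \<in> space (prob_algebra \<mu>)" 
    if "w \<in> space W" for w z
    using that measurable_space[OF \<nu>] by (auto simp: space_prob_algebra prob_space_return)
  show thesis
  proof (rule that[of q])
    fix w and G :: "'z \<Rightarrow> ennreal" assume w: "w \<in> space W" and [measurable]: "G \<in> borel_measurable \<mu>"
    note [measurable] = sec[OF w]
    define c where "c = (\<integral>\<^sup>+z'. G z' \<partial>\<nu> w)"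
    have c: "c = (\<integral>\<^sup>+z. k w z * G z \<partial>\<mu>)" unfolding c_def \<nu>_def by (subst nn_integral_density) auto
    \<comment> \<open>Per unit of \<mu>, these are the mass that stays at z and the mass that
      jumps.\<close>
    have hm: "h1 w z * m w z = min (h1 w z) (h2 w z)" "h1 w z * (1 - m w z) = max (h1 w z - h2 w z) 0" for z
      using nn(1)[of w z] nn(2)[of w z] by (auto simp: m_def min_def max_def field_simps)
    have "ennreal (h1 w z) * (\<integral>\<^sup>+z'. G z' \<partial>q w z)
       = ennreal (min (h1 w z) (h2 w z)) * G z + ennreal (max (h1 w z - h2 w z) 0) * c" if z: "z \<in> space \<mu>" for z
    proof -
      have "(\<integral>\<^sup>+z'. G z' \<partial>q w z) = ennreal (m w z) * G z + ennreal (1 - m w z) * c"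
        unfolding q_def c_def using spc[OF w] z m01
        by (subst nn_integral_mix[where N=\<mu>]) (auto simp: nn_integral_return)
      then show ?thesis unfolding hm[symmetric] using nn m01 
        by (simp add: distrib_left ennreal_mult mult.assoc)
    qed
    then have "(\<integral>\<^sup>+z. ennreal (h1 w z) * (\<integral>\<^sup>+z'. G z' \<partial>q w z) \<partial>\<mu>)
      = (\<integral>\<^sup>+z. ennreal (min (h1 w z) (h2 w z)) * G z + ennreal (max (h1 w z - h2 w z) 0) * c \<partial>\<mu>)"
      by (intro nn_integral_cong) auto
    also have "\<dots> = (\<integral>\<^sup>+z. ennreal (min (h1 w z) (h2 w z)) * G z \<partial>\<mu>) + D w * c"
      by (subst nn_integral_add) (auto simp: nn_integral_multc D_eq[OF w])
    also have "D w * c = (\<integral>\<^sup>+z. e w z * G z \<partial>\<mu>)" unfolding c by (rule kint) (use w in auto)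
    also have "(\<integral>\<^sup>+z. ennreal (min (h1 w z) (h2 w z)) * G z \<partial>\<mu>) + (\<integral>\<^sup>+z. e w z * G z \<partial>\<mu>)
      = (\<integral>\<^sup>+z. ennreal (h2 w z) * G z \<partial>\<mu>)"
      unfolding e_def using nn
      by (subst nn_integral_add[symmetric]) 
         (auto intro!: nn_integral_cong simp: max_def min_def simp flip: ennreal_plus distrib_right)
    finally show "(\<integral>\<^sup>+z. ennreal (h1 w z) * (\<integral>\<^sup>+z'. G z' \<partial>q w z) \<partial>\<mu>) = (\<integral>\<^sup>+z. ennreal (h2 w z) * G z \<partial>\<mu>)" .
  next
    fix w z A assume *: "w \<in> space W" "z \<in> space \<mu>" "h1 w z > 0" "A \<in> sets \<mu>" "z \<notin> A"
    interpret \<nu>: prob_space "\<nu> w" using spc[of w] * by (auto simp: space_prob_algebra)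
    \<comment> \<open>The part that stays sits at z, outside A, so only the jump
      contributes.\<close>
    have "emeasure (q w z) A = ennreal (1 - m w z) * emeasure (\<nu> w) A"
      unfolding q_def using spc[OF *(1)] m01 * by (subst emeasure_mix) auto
    also have "\<dots> \<le> ennreal (1 - m w z) * 1"
      by (intro mult_left_mono \<nu>.emeasure_le_1) auto
    also have "\<dots> = ennreal (max (1 - h2 w z / h1 w z) 0)"
      using *(3) by (auto simp: m_def min_def max_def)
    finally show "emeasure (q w z) A \<le> ennreal (max (1 - h2 w z / h1 w z) 0)" .
  qed (fact q)
qed

section \<open>Probability densities and the chain rule for entropy\<close>

definition prob_density :: "'a measure \<Rightarrow> ('a \<Rightarrow> real) \<Rightarrow> bool" where
  "prob_density N f \<longleftrightarrow> f \<in> borel_measurable N \<and> (\<forall>x. 0 \<le> f x) \<and> (\<integral>\<^sup>+x. f x \<partial>N) = 1"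

text \<open>The identity (g h) ln (g h) = (g ln g) h + g (h ln h), integrated with total mass 1 of
  h. As the integrals of \<open>entropy_fun\<close> may be infinite, nothing may be subtracted
  before the end: r carries the negative part of g ln g together with g, s carries its positive
  part, and only the finite r + g is cancelled.\<close>

lemma entropy_fun_scale:
  assumes mu: "prob_space \<mu>" and [measurable]: "h \<in> borel_measurable \<mu>"
    and h: "\<And>z. 0 \<le> h z" "(\<integral>\<^sup>+z. h z \<partial>\<mu>) = 1" and g: "0 < g"
  shows "(\<integral>\<^sup>+z. entropy_fun (g * h z) \<partial>\<mu>) = entropy_fun g + ennreal g * (\<integral>\<^sup>+z. entropy_fun (h z) \<partial>\<mu>)"
proof -
  interpret prob_space \<mu> by fact
  define r where "r = max (- (g * ln g)) 0 + g"
  define s where "s = max (g * ln g) 0"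
  have rs: "0 \<le> r" "0 \<le> s" using g by (auto simp: r_def s_def)
  have g_eq: "entropy_fun g + r = s + 1" by (auto simp: entropy_fun_def r_def s_def max_def)
  have pt: "ennreal (entropy_fun (g * h z)) + ennreal r * ennreal (h z) + g
     = ennreal g * ennreal (entropy_fun (h z)) + ennreal s * h z + 1 + ennreal g * h z" for z
  proof -
    have "entropy_fun (g * h z) + r * h z + g = g * entropy_fun (h z) + s * h z + 1 + g * h z"
      using h(1)[of z] g by (cases "h z = 0")
        (auto simp: entropy_fun_def r_def s_def max_def ln_mult algebra_simps)
    then show ?thesis
      using h(1)[of z] g rs entropy_fun_nonneg[of "g * h z"] entropy_fun_nonneg[of "h z"]
      by (simp flip: ennreal_plus ennreal_mult ennreal_1)
  qed
  have "(\<integral>\<^sup>+z. entropy_fun (g * h z) \<partial>\<mu>) + ennreal r + g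
    = (\<integral>\<^sup>+z. ennreal (entropy_fun (g * h z)) + ennreal r * ennreal (h z) + g \<partial>\<mu>)"
    using h by (simp add: nn_integral_add nn_integral_cmult emeasure_space_1)
  also have "\<dots> = ennreal g * (\<integral>\<^sup>+z. entropy_fun (h z) \<partial>\<mu>) + ennreal s + 1 + ennreal g"
    unfolding pt using h by (simp add: nn_integral_add nn_integral_cmult emeasure_space_1)
  also have "\<dots> = ennreal g * (\<integral>\<^sup>+z. entropy_fun (h z) \<partial>\<mu>) + ennreal (s + 1) + ennreal g"
    using rs by (simp add: add.assoc)
  also have "ennreal (s + 1) = ennreal (entropy_fun g) + ennreal r"
    unfolding g_eq[symmetric] using rs entropy_fun_nonneg g by (intro ennreal_plus) auto
  finally have "(ennreal r + ennreal g) + (\<integral>\<^sup>+z. entropy_fun (g * h z) \<partial>\<mu>) =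
     (ennreal r + ennreal g) + (entropy_fun g + ennreal g * (\<integral>\<^sup>+z. entropy_fun (h z) \<partial>\<mu>))"
    by (simp add: ac_simps)
  then show ?thesis by (simp add: ennreal_add_left_cancel)
qed

text \<open>Here g is the marginal density and h the conditional one; the last conclusion is the
  chain rule, obtained from \<open>entropy_fun_scale\<close> on each fibre.\<close>

lemma density_disintegration:
  fixes f :: "'x \<times> 'z \<Rightarrow> real"
  assumes N: "prob_space N" and mu: "prob_space \<mu>" and f: "prob_density (N \<Otimes>\<^sub>M \<mu>) f"
  obtains g h where "prob_density N g" "(\<lambda>(x, z). h x z) \<in> borel_measurable (N \<Otimes>\<^sub>M \<mu>)"
    "\<And>x z. 0 \<le> (h x z :: real)" "\<And>x. x \<in> space N \<Longrightarrow> (\<integral>\<^sup>+z. h x z \<partial>\<mu>) = 1"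
    "AE w in N \<Otimes>\<^sub>M \<mu>. f w = g (fst w) * h (fst w) (snd w)"
    "(\<integral>\<^sup>+x. entropy_fun (g x) \<partial>N) + (\<integral>\<^sup>+x. ennreal (g x) * (\<integral>\<^sup>+z. entropy_fun (h x z) \<partial>\<mu>) \<partial>N)
      = (\<integral>\<^sup>+w. entropy_fun (f w) \<partial>(N \<Otimes>\<^sub>M \<mu>))"
proof -
  interpret N: prob_space N by fact
  interpret \<mu>: prob_space \<mu> by fact
  interpret pair_sigma_finite N \<mu> ..
  have [measurable]: "f \<in> borel_measurable (N \<Otimes>\<^sub>M \<mu>)" and f0: "\<And>w. 0 \<le> f w"
    and f1: "(\<integral>\<^sup>+w. f w \<partial>(N \<Otimes>\<^sub>M \<mu>)) = 1"
    using f by (auto simp: prob_density_def)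
  define G where "G x = (\<integral>\<^sup>+z. f (x, z) \<partial>\<mu>)" for x
  define g where "g x = enn2real (G x)" for x
  \<comment> \<open>\<open>enn2real\<close> sends an infinite marginal to 0, so the default 1 covers
    the fibres without mass as well as the null set of fibres with infinite mass. Thus
    \<open>h x\<close> is a probability density for every x, as the maximal coupling
    requires.\<close>
  define h where "h x z = (if g x = 0 then 1 else f (x, z) / g x)" for x z
  have [measurable]: "G \<in> borel_measurable N" unfolding G_def by measurable
  have [measurable]: "g \<in> borel_measurable N" unfolding g_def by measurable
  have hm[measurable]: "(\<lambda>(x, z). h x z) \<in> borel_measurable (N \<Otimes>\<^sub>M \<mu>)" unfolding h_def by measurable
  have g0: "0 \<le> g x" for x by (simp add: g_def)
  have h0: "0 \<le> h x z" for x z using f0 g0 by (simp add: h_def)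
  have intG: "(\<integral>\<^sup>+x. G x \<partial>N) = 1"
    unfolding G_def using f1 by (subst \<mu>.nn_integral_fst) auto
  then have "AE x in N. G x \<noteq> \<infinity>"
    by (intro nn_integral_PInf_AE) auto
  then have fin: "AE x in N. G x < \<infinity>" by (simp add: less_top)
  then have Gg: "AE x in N. G x = ennreal (g x)"
    by eventually_elim (simp add: g_def)
  have g1: "(\<integral>\<^sup>+x. g x \<partial>N) = 1"
    using Gg unfolding intG[symmetric] by (intro nn_integral_cong_AE) auto
  have h1: "(\<integral>\<^sup>+z. h x z \<partial>\<mu>) = 1" if [measurable]: "x \<in> space N" for x
  proof (cases "g x = 0")
    case False
    then have "G x \<noteq> \<top>" by (auto simp: g_def)
    then have Gx: "G x = ennreal (g x)" "0 < g x"
      using False order.not_eq_order_implies_strict[OF _ g0[of x]] by (auto simp: g_def less_top)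
    have "(\<integral>\<^sup>+z. h x z \<partial>\<mu>) = (\<integral>\<^sup>+z. ennreal (f (x, z)) / ennreal (g x) \<partial>\<mu>)"
      using False f0 Gx by (intro nn_integral_cong) (simp add: h_def divide_ennreal)
    also have "\<dots> = G x / ennreal (g x)"
      unfolding G_def by (rule nn_integral_divide) measurable
    finally show ?thesis using Gx by (simp add: divide_ennreal)
  qed (simp add: h_def \<mu>.emeasure_space_1)
  have sec: "(\<lambda>z. f (x, z)) \<in> borel_measurable \<mu>" "(\<lambda>z. h x z) \<in> borel_measurable \<mu>" if "x \<in> space N" for x
    using that by measurable
  have fgh: "AE z in \<mu>. f (x, z) = g x * h x z" if "G x = ennreal (g x)" "x \<in> space N" for x
  proof (cases "g x = 0")
    case True
    then have "(\<integral>\<^sup>+z. f (x, z) \<partial>\<mu>) = 0" using that(1) by (simp add: G_def)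
    then have "AE z in \<mu>. ennreal (f (x, z)) = 0"
      using sec[OF that(2)] by (subst (asm) nn_integral_0_iff_AE) auto
    then show ?thesis using True f0 by (auto simp: ennreal_eq_0_iff intro: antisym)
  qed (simp add: h_def)
  have ae: "AE w in N \<Otimes>\<^sub>M \<mu>. f w = g (fst w) * h (fst w) (snd w)"
  proof (rule AE_pair_measure)
    show "{w \<in> space (N \<Otimes>\<^sub>M \<mu>). f w = g (fst w) * h (fst w) (snd w)} \<in> sets (N \<Otimes>\<^sub>M \<mu>)"
      by measurable
    show "AE x in N. AE z in \<mu>. f (x, z) = g (fst (x, z)) * h (fst (x, z)) (snd (x, z))"
      using Gg AE_space by eventually_elim (use fgh in simp)
  qed
  have "AE x in N. entropy_fun (g x) + ennreal (g x) * (\<integral>\<^sup>+z. entropy_fun (h x z) \<partial>\<mu>)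
     = (\<integral>\<^sup>+z. entropy_fun (f (x, z)) \<partial>\<mu>)"
    using Gg AE_space
  proof eventually_elim
    case (elim x)
    have "(\<integral>\<^sup>+z. entropy_fun (f (x, z)) \<partial>\<mu>) = (\<integral>\<^sup>+z. entropy_fun (g x * h x z) \<partial>\<mu>)"
      using fgh[OF elim] by (intro nn_integral_cong_AE) auto
    also have "\<dots> = entropy_fun (g x) + ennreal (g x) * (\<integral>\<^sup>+z. entropy_fun (h x z) \<partial>\<mu>)"
    proof (cases "g x = 0")
      case False
      then show ?thesis using g0[of x] h0 h1 sec elim by (intro entropy_fun_scale mu) auto
    qed (simp add: entropy_fun_def \<mu>.emeasure_space_1)
    finally show ?case by simp
  qed
  then have "(\<integral>\<^sup>+x. entropy_fun (g x) + ennreal (g x) * (\<integral>\<^sup>+z. entropy_fun (h x z) \<partial>\<mu>) \<partial>N)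
     = (\<integral>\<^sup>+x. \<integral>\<^sup>+z. entropy_fun (f (x, z)) \<partial>\<mu> \<partial>N)"
    by (rule nn_integral_cong_AE)
  also have "\<dots> = (\<integral>\<^sup>+w. entropy_fun (f w) \<partial>(N \<Otimes>\<^sub>M \<mu>))"
    by (rule \<mu>.nn_integral_fst[where f="\<lambda>w. ennreal (entropy_fun (f w))"]) measurable
  finally have ent: "(\<integral>\<^sup>+x. entropy_fun (g x) \<partial>N) + (\<integral>\<^sup>+x. ennreal (g x) * (\<integral>\<^sup>+z. entropy_fun (h x z) \<partial>\<mu>) \<partial>N)
      = (\<integral>\<^sup>+w. entropy_fun (f w) \<partial>(N \<Otimes>\<^sub>M \<mu>))"
    by (subst (asm) nn_integral_add) auto
  show thesis
    by (rule that[of g h]) (use hm g0 g1 h0 h1 ae ent in \<open>auto simp: prob_density_def\<close>)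
qed

section \<open>Tensorisation\<close>

text \<open>The kernel carries the law with density f1 to the law with density f2. Testing against
  nonnegative functions avoids a joint measure and combines directly with Fubini when coordinates
  are added.\<close>

definition transports :: "'x measure \<Rightarrow> ('x \<Rightarrow> real) \<Rightarrow> ('x \<Rightarrow> real) \<Rightarrow> ('x \<Rightarrow> 'x measure) \<Rightarrow> bool" where
  "transports N f1 f2 p \<longleftrightarrow> p \<in> N \<rightarrow>\<^sub>M prob_algebra N \<and>
     (\<forall>G \<in> borel_measurable N. (\<integral>\<^sup>+x. ennreal (f1 x) * (\<integral>\<^sup>+y. G y \<partial>p x) \<partial>N) = (\<integral>\<^sup>+x. ennreal (f2 x) * G x \<partial>N))"

text \<open>The property passed up the induction over coordinates. All pairs of densities are
  quantified because the induction step applies the bound to the marginals of the given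
  ones.\<close>

definition entropy_cost_bound :: "real \<Rightarrow> 'x measure \<Rightarrow> ('x \<Rightarrow> 'x measure \<Rightarrow> ennreal) \<Rightarrow> bool" where
  "entropy_cost_bound t N C \<longleftrightarrow> (\<forall>f1 f2. prob_density N f1 \<longrightarrow> prob_density N f2 \<longrightarrow>
     (\<exists>p. transports N f1 f2 p \<and> (\<integral>\<^sup>+x. ennreal (f1 x) * C x (p x) \<partial>N)
        \<le> 1 / ennreal t * (\<integral>\<^sup>+x. entropy_fun (f1 x) \<partial>N)
         + 1 / ennreal (1 - t) * (\<integral>\<^sup>+x. entropy_fun (f2 x) \<partial>N)))"

text \<open>Conditionally on the pair \<open>(x, y)\<close> produced by the coupling of the first marginals, the second
  coordinates are coupled maximally. The kernel \<open>r (x, z)\<close> averages over \<open>y\<close>, which only lowers the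
  cost, by Jensen's inequality.\<close>

lemma entropy_cost_bound_pair:
  fixes N :: "'x measure" and \<mu> :: "'z measure" and t :: real
  assumes N: "prob_space N" and mu: "prob_space \<mu>" and t: "0 \<le> t" "t \<le> 1"
    and diag[measurable]: "Measurable.pred (\<mu> \<Otimes>\<^sub>M \<mu>) (\<lambda>(z, w). z \<noteq> w)"
    and C: "\<And>p. p \<in> N \<rightarrow>\<^sub>M prob_algebra N \<Longrightarrow> (\<lambda>x. C x (p x)) \<in> borel_measurable N"
    and bound: "entropy_cost_bound t N C"
  shows "entropy_cost_bound t (N \<Otimes>\<^sub>M \<mu>)
    (\<lambda>(x, z) r. C x (distr r N fst) + acost t (measure r {v \<in> space (N \<Otimes>\<^sub>M \<mu>). z \<noteq> snd v}))"
  unfolding entropy_cost_bound_def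
proof (intro allI impI)
  fix f1 f2 :: "'x \<times> 'z \<Rightarrow> real"
  assume f1: "prob_density (N \<Otimes>\<^sub>M \<mu>) f1" and f2: "prob_density (N \<Otimes>\<^sub>M \<mu>) f2"
  interpret N: prob_space N by fact
  interpret \<mu>: prob_space \<mu> by fact
  interpret pair_sigma_finite N \<mu> ..
  have [measurable]: "f1 \<in> borel_measurable (N \<Otimes>\<^sub>M \<mu>)" "f2 \<in> borel_measurable (N \<Otimes>\<^sub>M \<mu>)"
    using f1 f2 by (auto simp: prob_density_def)
  obtain g1 h1 where g1: "prob_density N g1"
    and h1m[measurable]: "(\<lambda>(x, z). h1 x z) \<in> borel_measurable (N \<Otimes>\<^sub>M \<mu>)"
    and h1: "\<And>x z. 0 \<le> (h1 x z :: real)" "\<And>x. x \<in> space N \<Longrightarrow> (\<integral>\<^sup>+z. h1 x z \<partial>\<mu>) = 1"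
    and f1_eq: "AE w in N \<Otimes>\<^sub>M \<mu>. f1 w = g1 (fst w) * h1 (fst w) (snd w)"
    and ent1: "(\<integral>\<^sup>+x. entropy_fun (g1 x) \<partial>N) + (\<integral>\<^sup>+x. ennreal (g1 x) * (\<integral>\<^sup>+z. entropy_fun (h1 x z) \<partial>\<mu>) \<partial>N)
      = (\<integral>\<^sup>+w. entropy_fun (f1 w) \<partial>(N \<Otimes>\<^sub>M \<mu>))"
    using density_disintegration[OF N mu f1] by blast
  obtain g2 h2 where g2: "prob_density N g2"
    and h2m[measurable]: "(\<lambda>(x, z). h2 x z) \<in> borel_measurable (N \<Otimes>\<^sub>M \<mu>)"
    and h2: "\<And>x z. 0 \<le> (h2 x z :: real)" "\<And>x. x \<in> space N \<Longrightarrow> (\<integral>\<^sup>+z. h2 x z \<partial>\<mu>) = 1"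
    and f2_eq: "AE w in N \<Otimes>\<^sub>M \<mu>. f2 w = g2 (fst w) * h2 (fst w) (snd w)"
    and ent2: "(\<integral>\<^sup>+x. entropy_fun (g2 x) \<partial>N) + (\<integral>\<^sup>+x. ennreal (g2 x) * (\<integral>\<^sup>+z. entropy_fun (h2 x z) \<partial>\<mu>) \<partial>N)
      = (\<integral>\<^sup>+w. entropy_fun (f2 w) \<partial>(N \<Otimes>\<^sub>M \<mu>))"
    using density_disintegration[OF N mu f2] by blast
  have [measurable]: "g1 \<in> borel_measurable N" "g2 \<in> borel_measurable N"
    and g0: "\<And>x. 0 \<le> g1 x" "\<And>x. 0 \<le> g2 x"
    using g1 g2 by (auto simp: prob_density_def)
  from bound g1 g2 obtain p where p: "transports N g1 g2 p"
    and p_le: "(\<integral>\<^sup>+x. ennreal (g1 x) * C x (p x) \<partial>N)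
        \<le> 1 / ennreal t * (\<integral>\<^sup>+x. entropy_fun (g1 x) \<partial>N) + 1 / ennreal (1 - t) * (\<integral>\<^sup>+x. entropy_fun (g2 x) \<partial>N)"
    unfolding entropy_cost_bound_def by blast
  have pm[measurable]: "p \<in> N \<rightarrow>\<^sub>M prob_algebra N"
    and p_tr: "\<And>G. G \<in> borel_measurable N \<Longrightarrow>
      (\<integral>\<^sup>+x. ennreal (g1 x) * (\<integral>\<^sup>+y. G y \<partial>p x) \<partial>N) = (\<integral>\<^sup>+x. ennreal (g2 x) * G x \<partial>N)"
    using p by (auto simp: transports_def)
  note [measurable] = measurable_prob_algebraD[OF pm]
  have p_space: "prob_space (p x)" "sets (p x) = sets N" "space (p x) = space N" if "x \<in> space N" for x
    using measurable_space[OF pm that] by (auto simp: space_prob_algebra dest: sets_eq_imp_space_eq)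
  obtain q where q: "(\<lambda>(w, z). q w z) \<in> (N \<Otimes>\<^sub>M N) \<Otimes>\<^sub>M \<mu> \<rightarrow>\<^sub>M prob_algebra \<mu>"
    and q_tr: "\<And>w (G :: 'z \<Rightarrow> ennreal). w \<in> space (N \<Otimes>\<^sub>M N) \<Longrightarrow> G \<in> borel_measurable \<mu> \<Longrightarrow>
      (\<integral>\<^sup>+z. ennreal (h1 (fst w) z) * (\<integral>\<^sup>+z'. G z' \<partial>q w z) \<partial>\<mu>) = (\<integral>\<^sup>+z. ennreal (h2 (snd w) z) * G z \<partial>\<mu>)"
    and q_le: "\<And>w z A. w \<in> space (N \<Otimes>\<^sub>M N) \<Longrightarrow> z \<in> space \<mu> \<Longrightarrow> h1 (fst w) z > 0 \<Longrightarrow> A \<in> sets \<mu> \<Longrightarrow> z \<notin> A \<Longrightarrow>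
      emeasure (q w z) A \<le> ennreal (max (1 - h2 (snd w) z / h1 (fst w) z) 0)"
  proof (rule maximal_coupling_kernel[OF mu, of "\<lambda>w. h1 (fst w)" "N \<Otimes>\<^sub>M N" "\<lambda>w. h2 (snd w)"])
    show "(\<lambda>(w, z). h1 (fst w) z) \<in> borel_measurable ((N \<Otimes>\<^sub>M N) \<Otimes>\<^sub>M \<mu>)"
      "(\<lambda>(w, z). h2 (snd w) z) \<in> borel_measurable ((N \<Otimes>\<^sub>M N) \<Otimes>\<^sub>M \<mu>)"
      by measurable
  qed (auto simp: h1 h2 space_pair_measure)
  note [measurable] = q measurable_prob_algebraD[OF q]
  have q_space: "prob_space (q (x, y) z)" "sets (q (x, y) z) = sets \<mu>" "space (q (x, y) z) = space \<mu>" 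
    if "x \<in> space N" "y \<in> space N" "z \<in> space \<mu>" for x y z
    using measurable_space[OF q, of "((x, y), z)"] that 
    by (auto simp: space_prob_algebra space_pair_measure dest: sets_eq_imp_space_eq)
  define r where "r v = p (fst v) \<bind> (\<lambda>y. distr (q (fst v, y) (snd v)) (N \<Otimes>\<^sub>M \<mu>) (Pair y))" for v
  have ker: "(\<lambda>(v, y). distr (q (fst v, y) (snd v)) (N \<Otimes>\<^sub>M \<mu>) (Pair y))
      \<in> (N \<Otimes>\<^sub>M \<mu>) \<Otimes>\<^sub>M N \<rightarrow>\<^sub>M prob_algebra (N \<Otimes>\<^sub>M \<mu>)"
  proof (rule measurable_prob_algebraI)
    show "(\<lambda>(v, y). distr (q (fst v, y) (snd v)) (N \<Otimes>\<^sub>M \<mu>) (Pair y))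
      \<in> (N \<Otimes>\<^sub>M \<mu>) \<Otimes>\<^sub>M N \<rightarrow>\<^sub>M subprob_algebra (N \<Otimes>\<^sub>M \<mu>)"
      unfolding split_beta' by (rule measurable_distr2[where M=\<mu>]) measurable
    fix v assume "v \<in> space ((N \<Otimes>\<^sub>M \<mu>) \<Otimes>\<^sub>M N)"
    then obtain x z y where v: "v = ((x, z), y)" "x \<in> space N" "y \<in> space N" "z \<in> space \<mu>"
      by (auto simp: space_pair_measure)
    interpret q: prob_space "q (x, y) z" by (rule q_space[OF v(2,3,4)])
    show "prob_space (case v of (v, y) \<Rightarrow> distr (q (fst v, y) (snd v)) (N \<Otimes>\<^sub>M \<mu>) (Pair y))"
      using v q_space[OF v(2,3,4)]
      by (auto intro!: q.prob_space_distr simp: measurable_cong_sets[OF q_space(2)[OF v(2,3,4)] refl])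
  qed
  have rm[measurable]: "r \<in> N \<Otimes>\<^sub>M \<mu> \<rightarrow>\<^sub>M prob_algebra (N \<Otimes>\<^sub>M \<mu>)"
    unfolding r_def by (rule measurable_bind_prob_space2[where N=N, OF _ ker]) measurable
  have ker_x: "(\<lambda>y. distr (q (x, y) z) (N \<Otimes>\<^sub>M \<mu>) (Pair y)) \<in> p x \<rightarrow>\<^sub>M subprob_algebra (N \<Otimes>\<^sub>M \<mu>)"
    if "x \<in> space N" "z \<in> space \<mu>" for x z
  proof -
    have "(\<lambda>y. ((x, z), y)) \<in> N \<rightarrow>\<^sub>M (N \<Otimes>\<^sub>M \<mu>) \<Otimes>\<^sub>M N" using that by measurable
    from measurable_compose[OF this measurable_prob_algebraD[OF ker]] show ?thesis 
      by (simp add: measurable_cong_sets[OF p_space(2)[OF that(1)] refl])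
  qed
  have r_int: "(\<integral>\<^sup>+v. G v \<partial>r (x, z)) = (\<integral>\<^sup>+y. \<integral>\<^sup>+w. G (y, w) \<partial>q (x, y) z \<partial>p x)"
    if x: "x \<in> space N" "z \<in> space \<mu>" and G[measurable]: "G \<in> borel_measurable (N \<Otimes>\<^sub>M \<mu>)" for x z and G :: "_ \<Rightarrow> ennreal"
  proof -
    have "(\<integral>\<^sup>+v. G v \<partial>r (x, z)) = (\<integral>\<^sup>+y. \<integral>\<^sup>+v. G v \<partial>distr (q (x, y) z) (N \<Otimes>\<^sub>M \<mu>) (Pair y) \<partial>p x)"
      unfolding r_def using nn_integral_bind[OF G ker_x[OF x]] by simp
    also have "\<dots> = (\<integral>\<^sup>+y. \<integral>\<^sup>+w. G (y, w) \<partial>q (x, y) z \<partial>p x)"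
      using x p_space q_space
      by (intro nn_integral_cong nn_integral_distr) 
         (auto simp: measurable_cong_sets[OF q_space(2) refl])
    finally show ?thesis .
  qed
  have r_fst: "distr (r (x, z)) N fst = p x" if x: "x \<in> space N" "z \<in> space \<mu>" for x z
  proof -
    have "distr (r (x, z)) N fst = p x \<bind> (\<lambda>y. distr (distr (q (x, y) z) (N \<Otimes>\<^sub>M \<mu>) (Pair y)) N fst)"
      unfolding r_def fst_conv snd_conv
      using p_space[OF x(1)] x by (intro distr_bind[OF ker_x[OF x]]) auto
    also have "\<dots> = p x \<bind> return N"
    proof (rule bind_cong)
      fix y assume "y \<in> space (p x)"
      then have y: "y \<in> space N" using p_space x by simp
      interpret q: prob_space "q (x, y) z" by (rule q_space[OF x(1) y x(2)])
      have "distr (distr (q (x, y) z) (N \<Otimes>\<^sub>M \<mu>) (Pair y)) N fst = distr (q (x, y) z) N (\<lambda>_. y)"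
        using y by (subst distr_distr) (auto simp: comp_def measurable_cong_sets[OF q_space(2)[OF x(1) y x(2)] refl])
      then show "distr (distr (q (x, y) z) (N \<Otimes>\<^sub>M \<mu>) (Pair y)) N fst = return N y"
        using y by simp
    qed simp
    also have "\<dots> = p x" using p_space[OF x(1)] by (intro bind_return'') auto
    finally show ?thesis .
  qed
  have f1_int: "(\<integral>\<^sup>+v. ennreal (f1 v) * G v \<partial>(N \<Otimes>\<^sub>M \<mu>)) = (\<integral>\<^sup>+x. ennreal (g1 x) * (\<integral>\<^sup>+z. ennreal (h1 x z) * G (x, z) \<partial>\<mu>) \<partial>N)"
    if [measurable]: "G \<in> borel_measurable (N \<Otimes>\<^sub>M \<mu>)" for G :: "'x \<times> 'z \<Rightarrow> ennreal"
  proof -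
    have "(\<integral>\<^sup>+v. ennreal (f1 v) * G v \<partial>(N \<Otimes>\<^sub>M \<mu>)) = (\<integral>\<^sup>+v. ennreal (g1 (fst v)) * (ennreal (h1 (fst v) (snd v)) * G v) \<partial>(N \<Otimes>\<^sub>M \<mu>))"
      using f1_eq by (intro nn_integral_cong_AE) (auto simp: ennreal_mult h1 g0 mult.assoc)
    also have "\<dots> = (\<integral>\<^sup>+x. \<integral>\<^sup>+z. ennreal (g1 x) * (ennreal (h1 x z) * G (x, z)) \<partial>\<mu> \<partial>N)"
      by (subst \<mu>.nn_integral_fst[symmetric]) auto
    also have "\<dots> = (\<integral>\<^sup>+x. ennreal (g1 x) * (\<integral>\<^sup>+z. ennreal (h1 x z) * G (x, z) \<partial>\<mu>) \<partial>N)"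
      by (intro nn_integral_cong nn_integral_cmult) auto
    finally show ?thesis .
  qed
  have f2_int: "(\<integral>\<^sup>+v. ennreal (f2 v) * G v \<partial>(N \<Otimes>\<^sub>M \<mu>)) = (\<integral>\<^sup>+x. ennreal (g2 x) * (\<integral>\<^sup>+z. ennreal (h2 x z) * G (x, z) \<partial>\<mu>) \<partial>N)"
    if [measurable]: "G \<in> borel_measurable (N \<Otimes>\<^sub>M \<mu>)" for G :: "'x \<times> 'z \<Rightarrow> ennreal"
  proof -
    have "(\<integral>\<^sup>+v. ennreal (f2 v) * G v \<partial>(N \<Otimes>\<^sub>M \<mu>)) = (\<integral>\<^sup>+v. ennreal (g2 (fst v)) * (ennreal (h2 (fst v) (snd v)) * G v) \<partial>(N \<Otimes>\<^sub>M \<mu>))"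
      using f2_eq by (intro nn_integral_cong_AE) (auto simp: ennreal_mult h2 g0 mult.assoc)
    also have "\<dots> = (\<integral>\<^sup>+x. \<integral>\<^sup>+z. ennreal (g2 x) * (ennreal (h2 x z) * G (x, z)) \<partial>\<mu> \<partial>N)"
      by (subst \<mu>.nn_integral_fst[symmetric]) auto
    also have "\<dots> = (\<integral>\<^sup>+x. ennreal (g2 x) * (\<integral>\<^sup>+z. ennreal (h2 x z) * G (x, z) \<partial>\<mu>) \<partial>N)"
      by (intro nn_integral_cong nn_integral_cmult) auto
    finally show ?thesis .
  qed
  have swap: "(\<integral>\<^sup>+z. \<integral>\<^sup>+y. F z y \<partial>p x \<partial>\<mu>) = (\<integral>\<^sup>+y. \<integral>\<^sup>+z. F z y \<partial>\<mu> \<partial>p x)"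
    if x: "x \<in> space N" and F: "(\<lambda>(z, y). F z y) \<in> borel_measurable (\<mu> \<Otimes>\<^sub>M N)" for x and F :: "'z \<Rightarrow> 'x \<Rightarrow> ennreal"
  proof -
    interpret p: prob_space "p x" by (rule p_space[OF x])
    interpret pp: pair_sigma_finite "p x" \<mu> ..
    have "sets (p x \<Otimes>\<^sub>M \<mu>) = sets (N \<Otimes>\<^sub>M \<mu>)" by (intro sets_pair_measure_cong p_space[OF x] refl)
    moreover have "(\<lambda>(y, z). F z y) \<in> borel_measurable (N \<Otimes>\<^sub>M \<mu>)"
      using measurable_compose[OF measurable_pair_swap' F] by (simp add: split_beta')
    ultimately have "(\<lambda>(y, z). F z y) \<in> borel_measurable (p x \<Otimes>\<^sub>M \<mu>)"
      by (simp cong: measurable_cong_sets)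
    from pp.Fubini'[OF this] show ?thesis by simp
  qed
  have "transports (N \<Otimes>\<^sub>M \<mu>) f1 f2 r"
    unfolding transports_def
  proof (intro conjI ballI rm)
    fix G :: "'x \<times> 'z \<Rightarrow> ennreal" assume G[measurable]: "G \<in> borel_measurable (N \<Otimes>\<^sub>M \<mu>)"
    note [measurable] = nn_integral_measurable_subprob_algebra2 measurable_prob_algebraD[OF rm]
    have "(\<integral>\<^sup>+v. ennreal (f1 v) * (\<integral>\<^sup>+v'. G v' \<partial>r v) \<partial>(N \<Otimes>\<^sub>M \<mu>))
       = (\<integral>\<^sup>+x. ennreal (g1 x) * (\<integral>\<^sup>+z. ennreal (h1 x z) * (\<integral>\<^sup>+v'. G v' \<partial>r (x, z)) \<partial>\<mu>) \<partial>N)"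
      by (rule f1_int) measurable
    also have "\<dots> = (\<integral>\<^sup>+x. ennreal (g1 x) * (\<integral>\<^sup>+y. (\<integral>\<^sup>+w. ennreal (h2 y w) * G (y, w) \<partial>\<mu>) \<partial>p x) \<partial>N)"
    proof (intro nn_integral_cong arg_cong2[where f="(*)"] refl)
      fix x assume x: "x \<in> space N"
      have "(\<integral>\<^sup>+z. ennreal (h1 x z) * (\<integral>\<^sup>+v'. G v' \<partial>r (x, z)) \<partial>\<mu>)
        = (\<integral>\<^sup>+z. \<integral>\<^sup>+y. ennreal (h1 x z) * (\<integral>\<^sup>+w. G (y, w) \<partial>q (x, y) z) \<partial>p x \<partial>\<mu>)"
      proof (intro nn_integral_cong)
        fix z assume z: "z \<in> space \<mu>"
        have "(\<lambda>y. \<integral>\<^sup>+w. G (y, w) \<partial>q (x, y) z) \<in> borel_measurable N"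
          using x z by measurable
        then have "(\<lambda>y. \<integral>\<^sup>+w. G (y, w) \<partial>q (x, y) z) \<in> borel_measurable (p x)"
          by (simp cong: measurable_cong_sets add: p_space(2)[OF x])
        then show "ennreal (h1 x z) * (\<integral>\<^sup>+v'. G v' \<partial>r (x, z)) = (\<integral>\<^sup>+y. ennreal (h1 x z) * (\<integral>\<^sup>+w. G (y, w) \<partial>q (x, y) z) \<partial>p x)"
          by (simp add: r_int[OF x z G] nn_integral_cmult)
      qed
      \<comment> \<open>Exchanging the integrals fixes the pair (x, y), for which q turns the
        conditional density at x into that at y; the marginal kernel p then acts on what
        remains.\<close>
      also have "\<dots> = (\<integral>\<^sup>+y. \<integral>\<^sup>+z. ennreal (h1 x z) * (\<integral>\<^sup>+w. G (y, w) \<partial>q (x, y) z) \<partial>\<mu> \<partial>p x)"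
        using x by (intro swap) measurable
      also have "\<dots> = (\<integral>\<^sup>+y. (\<integral>\<^sup>+w. ennreal (h2 y w) * G (y, w) \<partial>\<mu>) \<partial>p x)"
      proof (rule nn_integral_cong)
        fix y assume "y \<in> space (p x)"
        then have y: "y \<in> space N" using p_space x by simp
        then show "(\<integral>\<^sup>+z. ennreal (h1 x z) * (\<integral>\<^sup>+w. G (y, w) \<partial>q (x, y) z) \<partial>\<mu>) = (\<integral>\<^sup>+w. ennreal (h2 y w) * G (y, w) \<partial>\<mu>)"
          using q_tr[of "(x, y)" "\<lambda>w. G (y, w)"] x by (simp add: space_pair_measure)
      qed
      finally show "(\<integral>\<^sup>+z. ennreal (h1 x z) * (\<integral>\<^sup>+v'. G v' \<partial>r (x, z)) \<partial>\<mu>) = (\<integral>\<^sup>+y. (\<integral>\<^sup>+w. ennreal (h2 y w) * G (y, w) \<partial>\<mu>) \<partial>p x)" .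
    qed
    also have "\<dots> = (\<integral>\<^sup>+y. ennreal (g2 y) * (\<integral>\<^sup>+w. ennreal (h2 y w) * G (y, w) \<partial>\<mu>) \<partial>N)"
      by (rule p_tr) measurable
    also have "\<dots> = (\<integral>\<^sup>+v. ennreal (f2 v) * G v \<partial>(N \<Otimes>\<^sub>M \<mu>))"
      by (rule f2_int[symmetric]) fact
    finally show "(\<integral>\<^sup>+v. ennreal (f1 v) * (\<integral>\<^sup>+v'. G v' \<partial>r v) \<partial>(N \<Otimes>\<^sub>M \<mu>)) = (\<integral>\<^sup>+v. ennreal (f2 v) * G v \<partial>(N \<Otimes>\<^sub>M \<mu>))" .
  qed
  moreover have "(\<integral>\<^sup>+v. ennreal (f1 v) * (case v of (x, z) \<Rightarrow> \<lambda>r. C x (distr r N fst) + acost t (measure r {v \<in> space (N \<Otimes>\<^sub>M \<mu>). z \<noteq> snd v})) (r v) \<partial>(N \<Otimes>\<^sub>M \<mu>))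
    \<le> 1 / ennreal t * (\<integral>\<^sup>+v. entropy_fun (f1 v) \<partial>(N \<Otimes>\<^sub>M \<mu>)) + 1 / ennreal (1 - t) * (\<integral>\<^sup>+v. entropy_fun (f2 v) \<partial>(N \<Otimes>\<^sub>M \<mu>))"
  proof -
    define a b where "a = 1 / ennreal t" and "b = 1 / ennreal (1 - t)"
    define U where "U v = measure (r v) {u \<in> space (N \<Otimes>\<^sub>M \<mu>). snd v \<noteq> snd u}" for v
    define E1 where "E1 x = (\<integral>\<^sup>+z. entropy_fun (h1 x z) \<partial>\<mu>)" for x
    define E2 where "E2 y = (\<integral>\<^sup>+z. entropy_fun (h2 y z) \<partial>\<mu>)" for y
    have [measurable]: "E1 \<in> borel_measurable N" "E2 \<in> borel_measurable N"
      unfolding E1_def E2_def by measurable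
    have [measurable]: "(\<lambda>x. C x (p x)) \<in> borel_measurable N" by (rule C) fact
    have "{w \<in> space ((N \<Otimes>\<^sub>M \<mu>) \<Otimes>\<^sub>M (N \<Otimes>\<^sub>M \<mu>)). snd (fst w) \<noteq> snd (snd w)} \<in> sets ((N \<Otimes>\<^sub>M \<mu>) \<Otimes>\<^sub>M (N \<Otimes>\<^sub>M \<mu>))"
      by measurable
    also have "{w \<in> space ((N \<Otimes>\<^sub>M \<mu>) \<Otimes>\<^sub>M (N \<Otimes>\<^sub>M \<mu>)). snd (fst w) \<noteq> snd (snd w)}
      = (SIGMA v:space (N \<Otimes>\<^sub>M \<mu>). {u \<in> space (N \<Otimes>\<^sub>M \<mu>). snd v \<noteq> snd u})"
      by (auto simp: space_pair_measure)
    finally have [measurable]: "U \<in> borel_measurable (N \<Otimes>\<^sub>M \<mu>)"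
      unfolding U_def by (rule measure_measurable_prob_algebra2) measurable
    have neq[measurable]: "{w \<in> space \<mu>. z \<noteq> w} \<in> sets \<mu>" if "z \<in> space \<mu>" for z
      using that by measurable
    \<comment> \<open>The probability that r moves the second coordinate is the average over y of
      the same probability under \<open>q (x, y) z\<close>. Jensen takes the average out of
      \<open>acost\<close>, and the scalar inequality applies with a = h1 x z and b = h2 y
      z.\<close>
    have U_le: "ennreal (h1 x z) * acost t (U (x, z)) \<le> (\<integral>\<^sup>+y. a * entropy_fun (h1 x z) + b * entropy_fun (h2 y z) \<partial>p x)"
      if x: "x \<in> space N" and z: "z \<in> space \<mu>" for x z
    proof (cases "h1 x z = 0")
      case False
      then have pos: "0 < h1 x z" using h1(1)[of x z] by simp
      interpret p: prob_space "p x" by (rule p_space[OF x])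
      define u where "u y = measure (q (x, y) z) {w \<in> space \<mu>. z \<noteq> w}" for y
      have u01: "0 \<le> u y \<and> u y \<le> 1" if "y \<in> space N" for y
        using prob_space.prob_le_1[OF q_space(1)[OF x that z]] by (simp add: u_def)
      have "(\<lambda>y. q (x, y) z) \<in> N \<rightarrow>\<^sub>M prob_algebra \<mu>"
        using x z by measurable
      then have "(\<lambda>y. q (x, y) z) \<in> p x \<rightarrow>\<^sub>M prob_algebra \<mu>"
        by (simp add: measurable_cong_sets[OF p_space(2)[OF x] refl])
      note measurable_compose[OF this measurable_measure_prob_algebra[OF neq[OF z]]]
      then have um[measurable]: "u \<in> borel_measurable (p x)" by (simp add: u_def[abs_def])
      have [measurable]: "(\<lambda>y. h2 y z) \<in> borel_measurable (p x)"
        using z by (simp add: measurable_cong_sets[OF p_space(2)[OF x] refl])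
      have B: "{v \<in> space (N \<Otimes>\<^sub>M \<mu>). z \<noteq> snd v} \<in> sets (N \<Otimes>\<^sub>M \<mu>)" using z by measurable
      have "emeasure (r (x, z)) {v \<in> space (N \<Otimes>\<^sub>M \<mu>). z \<noteq> snd v}
        = (\<integral>\<^sup>+v. indicator {v \<in> space (N \<Otimes>\<^sub>M \<mu>). z \<noteq> snd v} v \<partial>r (x, z))"
        using measurable_space[OF rm, of "(x, z)"] B x z
        by (subst nn_integral_indicator) (auto simp: space_prob_algebra space_pair_measure)
      also have "\<dots> = (\<integral>\<^sup>+y. \<integral>\<^sup>+w. indicator {v \<in> space (N \<Otimes>\<^sub>M \<mu>). z \<noteq> snd v} (y, w) \<partial>q (x, y) z \<partial>p x)"
        using B by (intro r_int x z) simp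
      also have "\<dots> = (\<integral>\<^sup>+y. ennreal (u y) \<partial>p x)"
      proof (rule nn_integral_cong)
        fix y assume "y \<in> space (p x)"
        then have y: "y \<in> space N" using p_space x by simp
        interpret q: prob_space "q (x, y) z" by (rule q_space[OF x y z])
        have "(\<integral>\<^sup>+w. indicator {v \<in> space (N \<Otimes>\<^sub>M \<mu>). z \<noteq> snd v} (y, w) \<partial>q (x, y) z)
          = (\<integral>\<^sup>+w. indicator {w \<in> space \<mu>. z \<noteq> w} w \<partial>q (x, y) z)"
          using y q_space(3)[OF x y z] by (intro nn_integral_cong) (auto simp: space_pair_measure split: split_indicator)
        also have "\<dots> = ennreal (u y)"
          using neq[OF z] q_space(2)[OF x y z] by (simp add: u_def q.emeasure_eq_measure)
        finally show "(\<integral>\<^sup>+w. indicator {v \<in> space (N \<Otimes>\<^sub>M \<mu>). z \<noteq> snd v} (y, w) \<partial>q (x, y) z) = ennreal (u y)" .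
      qed
      finally have "U (x, z) = (\<integral>y. u y \<partial>p x)"
        using um u01 p_space(3)[OF x]
        by (subst integral_eq_nn_integral) (auto simp: U_def measure_def)
      then have "acost t (U (x, z)) \<le> (\<integral>\<^sup>+y. acost t (u y) \<partial>p x)"
        using um u01 p_space(3)[OF x] acost_jensen[OF t p_space(1)[OF x] um] by simp
      also have "\<dots> \<le> (\<integral>\<^sup>+y. acost t (max (1 - h2 y z / h1 x z) 0) \<partial>p x)"
      proof (rule nn_integral_mono)
        fix y assume "y \<in> space (p x)"
        then have y: "y \<in> space N" using p_space x by simp
        interpret q: prob_space "q (x, y) z" by (rule q_space[OF x y z])
        have "emeasure (q (x, y) z) {w \<in> space \<mu>. z \<noteq> w} \<le> ennreal (max (1 - h2 y z / h1 x z) 0)"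
          using q_le[of "(x, y)" z "{w \<in> space \<mu>. z \<noteq> w}"] x y z pos neq[OF z] by (simp add: space_pair_measure)
        then have "u y \<le> max (1 - h2 y z / h1 x z) 0"
          unfolding u_def q.emeasure_eq_measure by (subst (asm) ennreal_le_iff) auto
        then show "acost t (u y) \<le> acost t (max (1 - h2 y z / h1 x z) 0)"
          using u01[OF y] h2(1)[of y z] pos by (intro acost_mono t) auto
      qed
      finally have "ennreal (h1 x z) * acost t (U (x, z)) \<le> ennreal (h1 x z) * (\<integral>\<^sup>+y. acost t (max (1 - h2 y z / h1 x z) 0) \<partial>p x)"
        by (intro mult_left_mono) auto
      also have "\<dots> = (\<integral>\<^sup>+y. ennreal (h1 x z) * acost t (max (1 - h2 y z / h1 x z) 0) \<partial>p x)"
        by (intro nn_integral_cmult[symmetric]) measurable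
      also have "\<dots> \<le> (\<integral>\<^sup>+y. a * entropy_fun (h1 x z) + b * entropy_fun (h2 y z) \<partial>p x)"
        unfolding a_def b_def by (intro nn_integral_mono acost_ratio_le t h1 h2)
      finally show ?thesis .
    qed simp
    have h_le: "(\<integral>\<^sup>+z. ennreal (h1 x z) * acost t (U (x, z)) \<partial>\<mu>) \<le> a * E1 x + b * (\<integral>\<^sup>+y. E2 y \<partial>p x)"
      if x: "x \<in> space N" for x
    proof -
      interpret p: prob_space "p x" by (rule p_space[OF x])
      have [measurable]: "E2 \<in> borel_measurable (p x)"
        by (simp add: measurable_cong_sets[OF p_space(2)[OF x] refl])
      have "(\<integral>\<^sup>+z. ennreal (h1 x z) * acost t (U (x, z)) \<partial>\<mu>)
        \<le> (\<integral>\<^sup>+z. \<integral>\<^sup>+y. a * entropy_fun (h1 x z) + b * entropy_fun (h2 y z) \<partial>p x \<partial>\<mu>)"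
        by (intro nn_integral_mono U_le x)
      also have "\<dots> = (\<integral>\<^sup>+y. \<integral>\<^sup>+z. a * entropy_fun (h1 x z) + b * entropy_fun (h2 y z) \<partial>\<mu> \<partial>p x)"
        using x by (intro swap) measurable
      also have "\<dots> = (\<integral>\<^sup>+y. a * E1 x + b * E2 y \<partial>p x)"
      proof (rule nn_integral_cong)
        fix y assume "y \<in> space (p x)"
        then have [measurable]: "y \<in> space N" using p_space x by simp
        show "(\<integral>\<^sup>+z. a * entropy_fun (h1 x z) + b * entropy_fun (h2 y z) \<partial>\<mu>) = a * E1 x + b * E2 y"
          using x unfolding E1_def E2_def
          by (subst nn_integral_add) (auto intro!: arg_cong2[where f="(+)"] nn_integral_cmult)
      qed
      also have "\<dots> = a * E1 x + b * (\<integral>\<^sup>+y. E2 y \<partial>p x)"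
        by (subst nn_integral_add) (auto simp: nn_integral_cmult p.emeasure_space_1)
      finally show ?thesis .
    qed
    have "(\<integral>\<^sup>+v. ennreal (f1 v) * (case v of (x, z) \<Rightarrow> \<lambda>r. C x (distr r N fst) + acost t (measure r {v \<in> space (N \<Otimes>\<^sub>M \<mu>). z \<noteq> snd v})) (r v) \<partial>(N \<Otimes>\<^sub>M \<mu>))
      = (\<integral>\<^sup>+v. ennreal (f1 v) * (C (fst v) (p (fst v)) + acost t (U v)) \<partial>(N \<Otimes>\<^sub>M \<mu>))"
      by (intro nn_integral_cong) (auto simp: space_pair_measure r_fst U_def)
    also have "\<dots> = (\<integral>\<^sup>+x. ennreal (g1 x) * (\<integral>\<^sup>+z. ennreal (h1 x z) * (C x (p x) + acost t (U (x, z))) \<partial>\<mu>) \<partial>N)"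
      by (subst f1_int) auto
    also have "\<dots> = (\<integral>\<^sup>+x. ennreal (g1 x) * C x (p x) + ennreal (g1 x) * (\<integral>\<^sup>+z. ennreal (h1 x z) * acost t (U (x, z)) \<partial>\<mu>) \<partial>N)"
    proof (rule nn_integral_cong)
      fix x assume x[measurable]: "x \<in> space N"
      have "(\<integral>\<^sup>+z. ennreal (h1 x z) * (C x (p x) + acost t (U (x, z))) \<partial>\<mu>)
        = (\<integral>\<^sup>+z. ennreal (h1 x z) \<partial>\<mu>) * C x (p x) + (\<integral>\<^sup>+z. ennreal (h1 x z) * acost t (U (x, z)) \<partial>\<mu>)"
        by (simp add: distrib_left nn_integral_add nn_integral_multc)
      then show "ennreal (g1 x) * (\<integral>\<^sup>+z. ennreal (h1 x z) * (C x (p x) + acost t (U (x, z))) \<partial>\<mu>)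
        = ennreal (g1 x) * C x (p x) + ennreal (g1 x) * (\<integral>\<^sup>+z. ennreal (h1 x z) * acost t (U (x, z)) \<partial>\<mu>)"
        using h1(2)[OF x] by (simp add: distrib_left)
    qed
    also have "\<dots> \<le> (\<integral>\<^sup>+x. ennreal (g1 x) * C x (p x) + ennreal (g1 x) * (a * E1 x + b * (\<integral>\<^sup>+y. E2 y \<partial>p x)) \<partial>N)"
      by (intro nn_integral_mono add_left_mono mult_left_mono h_le) auto
    also have "\<dots> = (\<integral>\<^sup>+x. ennreal (g1 x) * C x (p x) \<partial>N) + (a * (\<integral>\<^sup>+x. ennreal (g1 x) * E1 x \<partial>N)
        + b * (\<integral>\<^sup>+x. ennreal (g1 x) * (\<integral>\<^sup>+y. E2 y \<partial>p x) \<partial>N))"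
      by (simp add: distrib_left nn_integral_add mult.left_commute[of "ennreal _"] nn_integral_cmult)
    \<comment> \<open>The transport property of p replaces an average over images of g1 by an
      average against g2, the weight that the chain rule for f2 asks for.\<close>
    also have "(\<integral>\<^sup>+x. ennreal (g1 x) * (\<integral>\<^sup>+y. E2 y \<partial>p x) \<partial>N) = (\<integral>\<^sup>+x. ennreal (g2 x) * E2 x \<partial>N)"
      by (rule p_tr) measurable
    also have "(\<integral>\<^sup>+x. ennreal (g1 x) * C x (p x) \<partial>N) + (a * (\<integral>\<^sup>+x. ennreal (g1 x) * E1 x \<partial>N) + b * (\<integral>\<^sup>+x. ennreal (g2 x) * E2 x \<partial>N))
      \<le> (a * (\<integral>\<^sup>+x. entropy_fun (g1 x) \<partial>N) + b * (\<integral>\<^sup>+x. entropy_fun (g2 x) \<partial>N))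
        + (a * (\<integral>\<^sup>+x. ennreal (g1 x) * E1 x \<partial>N) + b * (\<integral>\<^sup>+x. ennreal (g2 x) * E2 x \<partial>N))"
      using p_le unfolding a_def b_def by (intro add_right_mono)
    also have "\<dots> = a * (\<integral>\<^sup>+v. entropy_fun (f1 v) \<partial>(N \<Otimes>\<^sub>M \<mu>)) + b * (\<integral>\<^sup>+v. entropy_fun (f2 v) \<partial>(N \<Otimes>\<^sub>M \<mu>))"
      unfolding ent1[symmetric] ent2[symmetric] E1_def E2_def by (simp add: distrib_left ac_simps)
    finally show ?thesis unfolding a_def b_def .
  qed
  ultimately show "\<exists>p. transports (N \<Otimes>\<^sub>M \<mu>) f1 f2 p \<and>
     (\<integral>\<^sup>+v. ennreal (f1 v) * (case v of (x, z) \<Rightarrow> \<lambda>r. C x (distr r N fst) + acost t (measure r {v \<in> space (N \<Otimes>\<^sub>M \<mu>). z \<noteq> snd v})) (p v) \<partial>(N \<Otimes>\<^sub>M \<mu>))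
    \<le> 1 / ennreal t * (\<integral>\<^sup>+v. entropy_fun (f1 v) \<partial>(N \<Otimes>\<^sub>M \<mu>)) + 1 / ennreal (1 - t) * (\<integral>\<^sup>+v. entropy_fun (f2 v) \<partial>(N \<Otimes>\<^sub>M \<mu>))"
    by blast
qed

lemma entropy_cost_bound_mono:
  assumes "entropy_cost_bound t N C"
    and "\<And>x r. x \<in> space N \<Longrightarrow> r \<in> space (prob_algebra N) \<Longrightarrow> C' x r \<le> C x r"
  shows "entropy_cost_bound t N C'"
  unfolding entropy_cost_bound_def
proof (intro allI impI)
  fix f1 f2 assume "prob_density N f1" "prob_density N f2"
  then obtain p where p: "transports N f1 f2 p"
    and le: "(\<integral>\<^sup>+x. ennreal (f1 x) * C x (p x) \<partial>N)
        \<le> 1 / ennreal t * (\<integral>\<^sup>+x. entropy_fun (f1 x) \<partial>N) + 1 / ennreal (1 - t) * (\<integral>\<^sup>+x. entropy_fun (f2 x) \<partial>N)"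
    using assms(1) unfolding entropy_cost_bound_def by blast
  have "p x \<in> space (prob_algebra N)" if "x \<in> space N" for x
    using p that by (auto simp: transports_def dest: measurable_space)
  then have "(\<integral>\<^sup>+x. ennreal (f1 x) * C' x (p x) \<partial>N) \<le> (\<integral>\<^sup>+x. ennreal (f1 x) * C x (p x) \<partial>N)"
    by (intro nn_integral_mono mult_left_mono assms(2)) auto
  with p le show "\<exists>p. transports N f1 f2 p \<and> (\<integral>\<^sup>+x. ennreal (f1 x) * C' x (p x) \<partial>N)
        \<le> 1 / ennreal t * (\<integral>\<^sup>+x. entropy_fun (f1 x) \<partial>N) + 1 / ennreal (1 - t) * (\<integral>\<^sup>+x. entropy_fun (f2 x) \<partial>N)"
    by (meson order_trans)
qed

text \<open>Invariance under a measure preserving isomorphism, by conjugating the kernel. It serves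
  to identify the pair of a tuple and one further point with a tuple over one more index.\<close>

lemma entropy_cost_bound_iso:
  fixes N :: "'x measure" and N' :: "'y measure"
  assumes T[measurable]: "T \<in> N \<rightarrow>\<^sub>M N'" and S[measurable]: "S \<in> N' \<rightarrow>\<^sub>M N"
    and inv: "\<And>x. x \<in> space N \<Longrightarrow> S (T x) = x" "\<And>y. y \<in> space N' \<Longrightarrow> T (S y) = y"
    and distr: "distr N N' T = N'"
    and C: "\<And>p. p \<in> N \<rightarrow>\<^sub>M prob_algebra N \<Longrightarrow> (\<lambda>x. C x (p x)) \<in> borel_measurable N"
    and bound: "entropy_cost_bound t N C"
  shows "entropy_cost_bound t N' (\<lambda>y r. C (S y) (distr r N S))"
  unfolding entropy_cost_bound_def
proof (intro allI impI)
  fix f1 f2 :: "'y \<Rightarrow> real" assume f: "prob_density N' f1" "prob_density N' f2"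
  then have [measurable]: "f1 \<in> borel_measurable N'" "f2 \<in> borel_measurable N'" by (auto simp: prob_density_def)
  have N'_int: "(\<integral>\<^sup>+y. G y \<partial>N') = (\<integral>\<^sup>+x. G (T x) \<partial>N)" if [measurable]: "G \<in> borel_measurable N'" for G :: "_ \<Rightarrow> ennreal"
    by (subst distr[symmetric], subst nn_integral_distr) auto
  have "prob_density N (\<lambda>x. f1 (T x))" "prob_density N (\<lambda>x. f2 (T x))"
    using f by (auto simp: prob_density_def N'_int)
  then obtain p where p: "transports N (\<lambda>x. f1 (T x)) (\<lambda>x. f2 (T x)) p"
    and le: "(\<integral>\<^sup>+x. ennreal (f1 (T x)) * C x (p x) \<partial>N)
        \<le> 1 / ennreal t * (\<integral>\<^sup>+x. entropy_fun (f1 (T x)) \<partial>N) + 1 / ennreal (1 - t) * (\<integral>\<^sup>+x. entropy_fun (f2 (T x)) \<partial>N)"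
    using bound unfolding entropy_cost_bound_def by blast
  have pm[measurable]: "p \<in> N \<rightarrow>\<^sub>M prob_algebra N" using p by (simp add: transports_def)
  have p_sets: "sets (p x) = sets N" if "x \<in> space N" for x
    using measurable_space[OF pm that] by (simp add: space_prob_algebra)
  define p' where "p' y = distr (p (S y)) N' T" for y
  have p'm[measurable]: "p' \<in> N' \<rightarrow>\<^sub>M prob_algebra N'" unfolding p'_def by measurable
  have p'_int: "(\<integral>\<^sup>+v. G v \<partial>p' (T x)) = (\<integral>\<^sup>+v. G (T v) \<partial>p x)"
    if "x \<in> space N" "G \<in> borel_measurable N'" for x and G :: "'y \<Rightarrow> ennreal"
    unfolding p'_def using that p_sets[OF that(1)] 
    by (subst nn_integral_distr) (auto simp: inv measurable_cong_sets[OF p_sets[OF that(1)] refl])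
  have p'_S: "distr (p' (T x)) N S = p x" if "x \<in> space N" for x
  proof -
    have "distr (p' (T x)) N S = distr (p x) N (\<lambda>v. S (T v))"
      unfolding p'_def using that
      by (subst distr_distr) (auto simp: inv comp_def measurable_cong_sets[OF p_sets[OF that] refl])
    also have "\<dots> = distr (p x) N (\<lambda>v. v)"
      using sets_eq_imp_space_eq[OF p_sets[OF that]] by (intro distr_cong) (auto simp: inv)
    also have "\<dots> = p x" using p_sets[OF that] by (intro distr_id2) simp
    finally show ?thesis .
  qed
  have Cm: "(\<lambda>x. C x (p x)) \<in> borel_measurable N" by (rule C) fact
  have "transports N' f1 f2 p'" unfolding transports_def
  proof (intro conjI ballI)
    fix G :: "'y \<Rightarrow> ennreal" assume G[measurable]: "G \<in> borel_measurable N'"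
    note [measurable] = nn_integral_measurable_subprob_algebra2 measurable_prob_algebraD[OF p'm]
    have "(\<integral>\<^sup>+y. ennreal (f1 y) * (\<integral>\<^sup>+v. G v \<partial>p' y) \<partial>N') = (\<integral>\<^sup>+x. ennreal (f1 (T x)) * (\<integral>\<^sup>+v. G v \<partial>p' (T x)) \<partial>N)"
      by (rule N'_int) measurable
    also have "\<dots> = (\<integral>\<^sup>+x. ennreal (f1 (T x)) * (\<integral>\<^sup>+v. G (T v) \<partial>p x) \<partial>N)"
      by (intro nn_integral_cong) (simp add: p'_int)
    also have "\<dots> = (\<integral>\<^sup>+x. ennreal (f2 (T x)) * G (T x) \<partial>N)"
      using p unfolding transports_def by simp
    also have "\<dots> = (\<integral>\<^sup>+y. ennreal (f2 y) * G y \<partial>N')"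
      by (rule N'_int[symmetric]) measurable
    finally show "(\<integral>\<^sup>+y. ennreal (f1 y) * (\<integral>\<^sup>+v. G v \<partial>p' y) \<partial>N') = (\<integral>\<^sup>+y. ennreal (f2 y) * G y \<partial>N')" .
  qed measurable
  moreover have "(\<integral>\<^sup>+y. ennreal (f1 y) * C (S y) (distr (p' y) N S) \<partial>N')
     \<le> 1 / ennreal t * (\<integral>\<^sup>+y. entropy_fun (f1 y) \<partial>N') + 1 / ennreal (1 - t) * (\<integral>\<^sup>+y. entropy_fun (f2 y) \<partial>N')"
  proof -
    have "(\<integral>\<^sup>+y. ennreal (f1 y) * C (S y) (distr (p' y) N S) \<partial>N') = (\<integral>\<^sup>+y. ennreal (f1 y) * C (S y) (p (S y)) \<partial>N')"
    proof (rule nn_integral_cong)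
      fix y assume "y \<in> space N'"
      then show "ennreal (f1 y) * C (S y) (distr (p' y) N S) = ennreal (f1 y) * C (S y) (p (S y))"
        using p'_S[of "S y"] measurable_space[OF S] by (simp add: inv)
    qed
    also have "\<dots> = (\<integral>\<^sup>+x. ennreal (f1 (T x)) * C (S (T x)) (p (S (T x))) \<partial>N)"
      using measurable_compose[OF S Cm] by (intro N'_int) simp
    also have "\<dots> = (\<integral>\<^sup>+x. ennreal (f1 (T x)) * C x (p x) \<partial>N)"
      by (intro nn_integral_cong) (simp add: inv)
    finally show ?thesis using le by (simp add: N'_int)
  qed
  ultimately show "\<exists>p. transports N' f1 f2 p \<and> (\<integral>\<^sup>+y. ennreal (f1 y) * C (S y) (distr (p y) N S) \<partial>N')
     \<le> 1 / ennreal t * (\<integral>\<^sup>+y. entropy_fun (f1 y) \<partial>N') + 1 / ennreal (1 - t) * (\<integral>\<^sup>+y. entropy_fun (f2 y) \<partial>N')"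
    by blast
qed

text \<open>A weak transport counterpart of the Hamming distance: each coordinate is charged through
  the probability that it moves when x is sent to a point of law r.\<close>

definition hamming_cost :: "real \<Rightarrow> nat \<Rightarrow> (nat \<Rightarrow> 'a) \<Rightarrow> (nat \<Rightarrow> 'a) measure \<Rightarrow> ennreal" where
  "hamming_cost t n x r = (\<Sum>i<n. acost t (measure r {y \<in> space r. x i \<noteq> y i}))"

text \<open>The event of a move depends on x, so measurability rests on that of the diagonal. The
  map T lets one statement cover a tuple itself and the initial part of a longer one.\<close>

lemma hamming_cost_measurable:
  assumes diag: "Measurable.pred (\<mu> \<Otimes>\<^sub>M \<mu>) (\<lambda>(z, w). z \<noteq> w)"
    and p[measurable]: "p \<in> M \<rightarrow>\<^sub>M prob_algebra (\<Pi>\<^sub>M i\<in>{..<n}. \<mu>)"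
    and T[measurable]: "T \<in> M \<rightarrow>\<^sub>M (\<Pi>\<^sub>M i\<in>{..<n}. \<mu>)"
  shows "(\<lambda>x. hamming_cost t n (T x) (p x)) \<in> borel_measurable M"
proof -
  let ?P = "\<Pi>\<^sub>M i\<in>{..<n}. \<mu>"
  have "(\<lambda>x. measure (p x) {y \<in> space ?P. T x i \<noteq> y i}) \<in> borel_measurable M" if "i < n" for i
  proof (rule measure_measurable_prob_algebra2[OF _ p])
    have c: "(\<lambda>y. y i) \<in> ?P \<rightarrow>\<^sub>M \<mu>"
      using that by (intro measurable_component_singleton) simp
    have "(\<lambda>z. (T (fst z) i, snd z i)) \<in> M \<Otimes>\<^sub>M ?P \<rightarrow>\<^sub>M \<mu> \<Otimes>\<^sub>M \<mu>"
      by (intro measurable_Pair measurable_compose[OF _ c] measurable_compose[OF measurable_fst T] measurable_snd)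
    from measurable_compose[OF this diag]
    have "Measurable.pred (M \<Otimes>\<^sub>M ?P) (\<lambda>z. T (fst z) i \<noteq> snd z i)" by simp
    then have "{z \<in> space (M \<Otimes>\<^sub>M ?P). T (fst z) i \<noteq> snd z i} \<in> sets (M \<Otimes>\<^sub>M ?P)" by measurable
    also have "{z \<in> space (M \<Otimes>\<^sub>M ?P). T (fst z) i \<noteq> snd z i} = (SIGMA x:space M. {y \<in> space ?P. T x i \<noteq> y i})"
      by (auto simp: space_pair_measure)
    finally show "(SIGMA x:space M. {y \<in> space ?P. T x i \<noteq> y i}) \<in> sets (M \<Otimes>\<^sub>M ?P)" .
  qed
  then have "(\<lambda>x. \<Sum>i<n. acost t (measure (p x) {y \<in> space ?P. T x i \<noteq> y i})) \<in> borel_measurable M"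
    by measurable
  then show ?thesis
  proof (rule measurable_cong[THEN iffD2, rotated])
    fix x assume "x \<in> space M"
    then have "space (p x) = space ?P" 
      using measurable_space[OF p] by (auto simp: space_prob_algebra dest: sets_eq_imp_space_eq)
    then show "hamming_cost t n (T x) (p x) = (\<Sum>i<n. acost t (measure (p x) {y \<in> space ?P. T x i \<noteq> y i}))"
      by (simp add: hamming_cost_def)
  qed
qed

lemma entropy_cost_bound_PiM:
  fixes \<mu> :: "'a measure"
  assumes mu: "prob_space \<mu>" and t: "0 \<le> t" "t \<le> 1"
    and diag: "Measurable.pred (\<mu> \<Otimes>\<^sub>M \<mu>) (\<lambda>(z, w). z \<noteq> w)"
  shows "entropy_cost_bound t (\<Pi>\<^sub>M i\<in>{..<n}. \<mu>) (hamming_cost t n)"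
proof (induction n)
  \<comment> \<open>The empty product is a one-point probability space: both densities equal 1 there
    and the cost is an empty sum.\<close>
  case 0
  let ?N = "\<Pi>\<^sub>M i\<in>{..<0::nat}. \<mu>"
  show ?case unfolding entropy_cost_bound_def
  proof (intro allI impI exI conjI)
    fix f1 f2 :: "(nat \<Rightarrow> 'a) \<Rightarrow> real" assume f: "prob_density ?N f1" "prob_density ?N f2"
    have N: "(\<integral>\<^sup>+x. G x \<partial>?N) = G (\<lambda>_. undefined)" for G :: "_ \<Rightarrow> ennreal"
      by (simp add: PiM_empty nn_integral_count_space_finite)
    have "ennreal (f1 (\<lambda>_. undefined)) = 1" "ennreal (f2 (\<lambda>_. undefined)) = 1"
      using f unfolding prob_density_def N by auto
    then show "transports ?N f1 f2 (return ?N)"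
      unfolding transports_def N by (auto simp: nn_integral_return space_PiM)
    show "(\<integral>\<^sup>+x. ennreal (f1 x) * hamming_cost t 0 x (return ?N x) \<partial>?N)
      \<le> 1 / ennreal t * (\<integral>\<^sup>+y. entropy_fun (f1 y) \<partial>?N) + 1 / ennreal (1 - t) * (\<integral>\<^sup>+y. entropy_fun (f2 y) \<partial>?N)"
      by (simp add: hamming_cost_def)
  qed
next
  case (Suc n)
  interpret mu: prob_space \<mu> by fact
  let ?N = "\<Pi>\<^sub>M i\<in>{..<n}. \<mu>" and ?N' = "\<Pi>\<^sub>M i\<in>{..<Suc n}. \<mu>"
  interpret N: prob_space ?N by (intro prob_space_PiM mu)
  interpret NM: pair_sigma_finite ?N \<mu> ..
  let ?C = "\<lambda>(x, z) r. hamming_cost t n x (distr r ?N fst) + acost t (measure r {v \<in> space (?N \<Otimes>\<^sub>M \<mu>). z \<noteq> snd v})"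
  \<comment> \<open>Appending and splitting off the last coordinate; \<open>restrict\<close> brings
    the initial part back to functions that are \<open>undefined\<close> outside their index
    set.\<close>
  let ?T = "\<lambda>(x, z). x(n := z)" and ?S = "\<lambda>y :: nat \<Rightarrow> 'a. (restrict y {..<n}, y n)"
  have T[measurable]: "?T \<in> ?N \<Otimes>\<^sub>M \<mu> \<rightarrow>\<^sub>M ?N'"
    unfolding lessThan_Suc by (rule measurable_add_dim)
  have S[measurable]: "?S \<in> ?N' \<rightarrow>\<^sub>M ?N \<Otimes>\<^sub>M \<mu>"
    by (intro measurable_Pair measurable_restrict_subset measurable_component_singleton) auto
  have "entropy_cost_bound t (?N \<Otimes>\<^sub>M \<mu>) ?C"
    using hamming_cost_measurable[OF diag _ measurable_ident_sets[OF refl]]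
    by (intro entropy_cost_bound_pair N.prob_space_axioms mu t diag Suc) (simp add: id_def)
  then have "entropy_cost_bound t ?N' (\<lambda>y r. ?C (?S y) (distr r (?N \<Otimes>\<^sub>M \<mu>) ?S))"
  proof (rule entropy_cost_bound_iso[OF T S, rotated 4])
    show "?S (?T w) = w" if "w \<in> space (?N \<Otimes>\<^sub>M \<mu>)" for w
      using that by (auto simp: space_pair_measure space_PiM PiE_def extensional_def restrict_def fun_eq_iff)
    show "?T (?S y) = y" if "y \<in> space ?N'" for y
      using that by (auto simp: space_PiM PiE_def extensional_def restrict_def fun_eq_iff less_Suc_eq)
    have "distr (?N \<Otimes>\<^sub>M \<mu>) ?N' ?T = distr (distr (\<mu> \<Otimes>\<^sub>M ?N) (?N \<Otimes>\<^sub>M \<mu>) (\<lambda>(x, y). (y, x))) ?N' ?T"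
      by (rule arg_cong[where f="\<lambda>M. distr M ?N' ?T", OF NM.distr_pair_swap])
    also have "\<dots> = distr (\<mu> \<Otimes>\<^sub>M ?N) ?N' (\<lambda>(z, x). x(n := z))"
      by (subst distr_distr) (auto simp: comp_def split_beta')
    also have "\<dots> = ?N'"
      using distr_pair_PiM_eq_PiM[of "{..<n}" "\<lambda>_. \<mu>" n] mu by (simp add: lessThan_Suc)
    finally show "distr (?N \<Otimes>\<^sub>M \<mu>) ?N' ?T = ?N'" .
    fix p assume [measurable]: "p \<in> ?N \<Otimes>\<^sub>M \<mu> \<rightarrow>\<^sub>M prob_algebra (?N \<Otimes>\<^sub>M \<mu>)"
    note [measurable] = diag
    have [measurable]: "(\<lambda>w. hamming_cost t n (fst w) (distr (p w) ?N fst)) \<in> borel_measurable (?N \<Otimes>\<^sub>M \<mu>)"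
      by (rule hamming_cost_measurable[OF diag]) measurable
    have "{w \<in> space ((?N \<Otimes>\<^sub>M \<mu>) \<Otimes>\<^sub>M (?N \<Otimes>\<^sub>M \<mu>)). snd (fst w) \<noteq> snd (snd w)} \<in> sets ((?N \<Otimes>\<^sub>M \<mu>) \<Otimes>\<^sub>M (?N \<Otimes>\<^sub>M \<mu>))"
      by measurable
    also have "{w \<in> space ((?N \<Otimes>\<^sub>M \<mu>) \<Otimes>\<^sub>M (?N \<Otimes>\<^sub>M \<mu>)). snd (fst w) \<noteq> snd (snd w)}
      = (SIGMA v:space (?N \<Otimes>\<^sub>M \<mu>). {u \<in> space (?N \<Otimes>\<^sub>M \<mu>). snd v \<noteq> snd u})"
      by (auto simp: space_pair_measure)
    finally have [measurable]: "(\<lambda>w. measure (p w) {v \<in> space (?N \<Otimes>\<^sub>M \<mu>). snd w \<noteq> snd v}) \<in> borel_measurable (?N \<Otimes>\<^sub>M \<mu>)"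
      by (rule measure_measurable_prob_algebra2) measurable
    show "(\<lambda>w. ?C w (p w)) \<in> borel_measurable (?N \<Otimes>\<^sub>M \<mu>)"
      unfolding split_beta' by measurable
  qed
  \<comment> \<open>Under the image of r by \<open>?S\<close> the coordinates move with the same
    probabilities as under r, so the two costs agree; monotonicity serves only to change the form of
    the cost.\<close>
  then show ?case
  proof (rule entropy_cost_bound_mono)
    fix x r assume x: "x \<in> space ?N'" and r: "r \<in> space (prob_algebra ?N')"
    then have rs: "sets r = sets ?N'" by (simp add: space_prob_algebra)
    note rsp = sets_eq_imp_space_eq[OF rs]
    have Sr: "?S \<in> r \<rightarrow>\<^sub>M ?N \<Otimes>\<^sub>M \<mu>"
      using S by (simp only: measurable_cong_sets[OF rs refl])
    have neq: "Measurable.pred \<mu> (\<lambda>w. x i \<noteq> w)" if "i < Suc n" for i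
    proof -
      have "(\<lambda>w. (x i, w)) \<in> \<mu> \<rightarrow>\<^sub>M \<mu> \<Otimes>\<^sub>M \<mu>"
        using x that by (intro measurable_Pair1') (auto simp: space_PiM)
      from measurable_compose[OF this diag] show ?thesis by simp
    qed
    have last: "{v \<in> space (?N \<Otimes>\<^sub>M \<mu>). x n \<noteq> snd v} \<in> sets (?N \<Otimes>\<^sub>M \<mu>)"
      using measurable_compose[OF measurable_snd neq[of n]] by (intro predE) simp
    have comp: "{y \<in> space ?N. x i \<noteq> y i} \<in> sets ?N" if "i < n" for i
    proof (rule predE)
      have "(\<lambda>y. y i) \<in> ?N \<rightarrow>\<^sub>M \<mu>" using that by (intro measurable_component_singleton) simp
      then show "Measurable.pred ?N (\<lambda>y. x i \<noteq> y i)"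
        using that by (intro measurable_compose[OF _ neq]) auto
    qed
    have eq1: "distr (distr r (?N \<Otimes>\<^sub>M \<mu>) ?S) ?N fst = distr r ?N (\<lambda>y. restrict y {..<n})"
      by (subst distr_distr[OF measurable_fst Sr]) (simp add: comp_def)
    have rr: "(\<lambda>y. restrict y {..<n}) \<in> r \<rightarrow>\<^sub>M ?N"
      using measurable_compose[OF Sr measurable_fst] by simp
    have eq2: "measure (distr r ?N (\<lambda>y. restrict y {..<n})) {y \<in> space ?N. x i \<noteq> y i}
      = measure r {y \<in> space r. x i \<noteq> y i}" if "i < n" for i
      using that comp[OF that] measurable_space[OF rr]
      by (subst measure_distr[OF rr]) (auto intro!: arg_cong[where f="measure r"])
    have eq3: "measure (distr r (?N \<Otimes>\<^sub>M \<mu>) ?S) {v \<in> space (?N \<Otimes>\<^sub>M \<mu>). x n \<noteq> snd v} = measure r {y \<in> space r. x n \<noteq> y n}"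
      using last measurable_space[OF Sr]
      by (subst measure_distr[OF Sr]) (auto intro!: arg_cong[where f="measure r"])
    have "(\<Sum>i<n. acost t (measure (distr r ?N (\<lambda>y. restrict y {..<n}))
        {y \<in> space (distr r ?N (\<lambda>y. restrict y {..<n})). restrict x {..<n} i \<noteq> y i}))
      = (\<Sum>i<n. acost t (measure r {y \<in> space r. x i \<noteq> y i}))"
      using eq2 by (intro sum.cong) auto
    then show "hamming_cost t (Suc n) x r \<le> ?C (?S x) (distr r (?N \<Otimes>\<^sub>M \<mu>) ?S)"
      unfolding hamming_cost_def split_beta' fst_conv snd_conv eq1 eq3 by simp
  qed
qed

section \<open>Point measures and their enumerations\<close>

lemma sum_dirac_cong: "(\<And>i. i < n \<Longrightarrow> x i = y i) \<Longrightarrow> sum_dirac n x = sum_dirac n y"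
  by (rule measure_eqI) (auto simp: emeasure_sum_dirac intro!: sum.cong)

lemma sum_dirac_eq_distr:
  fixes x :: "nat \<Rightarrow> 'a::topological_space"
  shows "sum_dirac n x = distr (count_space {..<n}) borel x"
proof (rule measure_eqI)
  fix A assume "A \<in> sets (sum_dirac n x)"
  then have A: "A \<in> sets borel" by simp
  have "(\<Sum>i<n. indicator A (x i) :: ennreal) = of_nat (card {i\<in>{..<n}. x i \<in> A})"
    by (simp add: indicator_def sum.If_cases Int_def)
  also have "{i\<in>{..<n}. x i \<in> A} = x -` A \<inter> {..<n}" by auto
  finally show "emeasure (sum_dirac n x) A = emeasure (distr (count_space {..<n}) borel x) A"
    using A by (simp add: emeasure_sum_dirac emeasure_distr emeasure_count_space)
qed simp

lemma nn_integral_sum_dirac: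
  "f \<in> borel_measurable borel \<Longrightarrow> (\<integral>\<^sup>+z. f z \<partial>sum_dirac n x) = (\<Sum>i<n. f (x i))"
  by (simp add: sum_dirac_eq_distr nn_integral_distr nn_integral_count_space_finite)

lemma integral_sum_dirac:
  fixes f :: "'a::topological_space \<Rightarrow> real"
  shows "f \<in> borel_measurable borel \<Longrightarrow> (\<integral>z. f z \<partial>sum_dirac n x) = (\<Sum>i<n. f (x i))"
  by (simp add: sum_dirac_eq_distr integral_distr lebesgue_integral_count_space_finite)

lemma measure_sum_dirac:
  "A \<in> sets borel \<Longrightarrow> measure (sum_dirac n x) A = real (card {i\<in>{..<n}. x i \<in> A})"
  by (auto simp: sum_dirac_eq_distr measure_distr measure_count_space intro!: arg_cong[where f=card])

lemma finite_measure_sum_dirac: "finite_measure (sum_dirac n x)"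
  by (rule finite_measureI) (simp add: emeasure_sum_dirac)

lemma sum_dirac_permutes:
  assumes "\<sigma> permutes {..<n}" shows "sum_dirac n (x \<circ> \<sigma>) = sum_dirac n x"
proof (rule measure_eqI)
  fix A assume "A \<in> sets (sum_dirac n (x \<circ> \<sigma>))"
  then show "emeasure (sum_dirac n (x \<circ> \<sigma>)) A = emeasure (sum_dirac n x) A"
    using sum.permute[OF assms, of "\<lambda>i. indicator A (x i) :: ennreal"]
    by (simp add: emeasure_sum_dirac comp_def)
qed simp

text \<open>Equal multiplicities mean equal multisets of values, hence lists that are rearrangements
  of each other. The value type is arbitrary because this is used for points of the space and also
  for sets of indices.\<close>

lemma ex_permutes_if_card_eq:
  fixes x y :: "nat \<Rightarrow> 'b"
  assumes "\<And>b. card {i\<in>{..<n}. x i = b} = card {i\<in>{..<n}. y i = b}"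
  shows "\<exists>\<rho>. \<rho> permutes {..<n} \<and> (\<forall>i<n. y i = x (\<rho> i))"
proof -
  have cnt: "count (mset (map z [0..<n])) b = card {i\<in>{..<n}. z i = b}" for z :: "nat \<Rightarrow> 'b" and b
  proof -
    have "count (mset (map z [0..<n])) b = (\<Sum>i | i \<in># mset_set {0..<n} \<and> b = z i. count (mset_set {0..<n}) i)"
      by (simp add: count_image_mset')
    also have "\<dots> = (\<Sum>i\<in>{i\<in>{..<n}. z i = b}. 1)" by (intro sum.cong) auto
    finally show ?thesis by simp
  qed
  then have "mset (map y [0..<n]) = mset (map x [0..<n])"
    using assms by (intro multiset_eqI) (simp only: cnt)
  then obtain \<rho> where \<rho>: "\<rho> permutes {..<length (map x [0..<n])}" "permute_list \<rho> (map x [0..<n]) = map y [0..<n]"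
    by (rule mset_eq_permutation)
  have "y i = x (\<rho> i)" if "i < n" for i
  proof -
    have "y i = permute_list \<rho> (map x [0..<n]) ! i" using \<rho>(2) that by simp
    also have "\<dots> = map x [0..<n] ! \<rho> i" using \<rho>(1) that by (intro permute_list_nth) auto
    also have "\<dots> = x (\<rho> i)" using permutes_in_image[OF \<rho>(1), of i] that by simp
    finally show ?thesis .
  qed
  with \<rho>(1) show ?thesis by auto
qed

lemma ex_permutes_if_sum_dirac_eq:
  fixes x y :: "nat \<Rightarrow> 'a::t2_space"
  assumes "sum_dirac n x = sum_dirac n y"
  shows "\<exists>\<rho>. \<rho> permutes {..<n} \<and> (\<forall>i<n. y i = x (\<rho> i))"
proof (rule ex_permutes_if_card_eq)
  fix b
  have "measure (sum_dirac n x) {b} = measure (sum_dirac n y) {b}" using assms by simp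
  then show "card {i\<in>{..<n}. x i = b} = card {i\<in>{..<n}. y i = b}"
    by (simp add: measure_sum_dirac)
qed

section \<open>Measurability of evaluations and of the map from tuples to point measures\<close>

lemma space_counting_space [simp]: "space (counting_space n) = counting_measures n"
  by (simp add: counting_space_def)

lemma open_in_counting_space: "openin (weak_topology n) U \<Longrightarrow> U \<in> sets (counting_space n)"
  by (auto simp: counting_space_def sets_borel_of)

lemma continuous_integral_measurable:
  fixes f :: "'a::topological_space \<Rightarrow> real"
  assumes "continuous_on UNIV f" "bounded (range f)"
  shows "(\<lambda>\<xi>. \<integral>z. f z \<partial>\<xi>) \<in> borel_measurable (counting_space n)"
proof (rule borel_measurableI)
  fix U :: "real set" assume "open U"
  then have "openin (weak_topology n) {\<xi> \<in> counting_measures n. (\<integral>z. f z \<partial>\<xi>) \<in> U}"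
    unfolding weak_topology_def using assms by (intro topology_generated_by_Basis) blast
  then show "(\<lambda>\<xi>. \<integral>z. f z \<partial>\<xi>) -` U \<inter> space (counting_space n) \<in> sets (counting_space n)"
    by (auto dest!: open_in_counting_space simp: Int_def vimage_def conj_commute)
qed

text \<open>The weak topology only supplies integrals of bounded continuous functions. These
  approximate indicators of closed sets, and closed sets are an intersection-stable generator of the
  Borel sets.\<close>

lemma emeasure_measurable_counting_space:
  fixes A :: "'a::metric_space set"
  assumes "A \<in> sets borel"
  shows "(\<lambda>\<xi>. emeasure \<xi> A) \<in> borel_measurable (counting_space n)"
proof -
  have "Int_stable {F :: 'a set. closed F}" by (auto simp: Int_stable_def)
  moreover have "{F :: 'a set. closed F} \<subseteq> Pow UNIV" by simp
  moreover have "A \<in> sigma_sets UNIV {F. closed F}" using assms by (simp add: borel_eq_closed)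
  ultimately show ?thesis
  proof (induction A rule: sigma_sets_induct_disjoint)
    case (basic F)
    then have F: "closed F" by simp
    \<comment> \<open>These functions tend to the indicator of F. The empty set is separated because
      \<open>infdist\<close> to it is 0, which would give the constant 1.\<close>
    define f where "f k z = (if F = {} then 0 else max 0 (1 - real k * infdist z F))" for k z
    have f01: "0 \<le> f k z" "f k z \<le> 1" for k z by (auto simp: f_def infdist_nonneg)
    have fc: "continuous_on UNIV (f k)" for k
      unfolding f_def by (cases "F = {}") (auto intro!: continuous_intros)
    have fb: "bounded (range (f k))" for k
      using f01 by (intro boundedI[where B=1]) auto
    have lim: "(\<lambda>k. f k z) \<longlonglongrightarrow> indicator F z" for z
    proof (cases "z \<in> F")
      case True
      then have "F \<noteq> {}" by auto
      with True show ?thesis by (simp add: f_def)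
    next
      case False
      show ?thesis
      proof (cases "F = {}")
        case ne: False
        have pos: "infdist z F > 0" using False F ne by (simp add: infdist_pos_not_in_closed)
        then obtain K :: nat where K: "1 < real K * infdist z F" using reals_Archimedean3 by blast
        have "eventually (\<lambda>k. f k z = 0) sequentially"
          using eventually_ge_at_top[of K]
        proof eventually_elim
          case (elim k)
          then have "real K * infdist z F \<le> real k * infdist z F" using pos by (intro mult_right_mono) auto
          then show ?case using K by (simp add: f_def)
        qed
        then show ?thesis using False by (simp add: tendsto_eventually)
      qed (use False in \<open>simp add: f_def\<close>)
    qed
    have "(\<lambda>\<xi>. ennreal (measure \<xi> F)) \<in> borel_measurable (counting_space n)"
    proof (rule measurable_compose[OF _ measurable_ennreal], rule borel_measurable_LIMSEQ_real)
      show "(\<lambda>\<xi>. \<integral>z. f k z \<partial>\<xi>) \<in> borel_measurable (counting_space n)" for k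
        by (rule continuous_integral_measurable fc fb)+
      fix \<xi> :: "'a measure" assume "\<xi> \<in> space (counting_space n)"
      then obtain x where \<xi>: "\<xi> = sum_dirac n x" by (auto simp: counting_measures_def)
      have "(\<lambda>k. \<Sum>i<n. f k (x i)) \<longlonglongrightarrow> (\<Sum>i<n. indicator F (x i))"
        by (intro tendsto_sum lim)
      also have "(\<Sum>i<n. indicator F (x i)) = measure \<xi> F"
        using F by (simp add: \<xi> measure_sum_dirac indicator_def sum.If_cases Int_def)
      finally show "(\<lambda>k. \<integral>z. f k z \<partial>\<xi>) \<longlonglongrightarrow> measure \<xi> F"
        unfolding \<xi> using fc by (simp add: integral_sum_dirac borel_measurable_continuous_onI)
    qed
    then show ?case
    proof (rule measurable_cong[THEN iffD2, rotated])
      fix \<xi> :: "'a measure" assume "\<xi> \<in> space (counting_space n)"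
      then obtain x where \<xi>: "\<xi> = sum_dirac n x" by (auto simp: counting_measures_def)
      then show "emeasure \<xi> F = ennreal (measure \<xi> F)"
        by (simp add: finite_measure.emeasure_eq_measure[OF finite_measure_sum_dirac])
    qed
  next
    case empty
    then show ?case by simp
  next
    case (compl A)
    then have A: "A \<in> sets borel" by (simp add: borel_eq_closed)
    \<comment> \<open>Complements reduce to a subtraction because every member of the space has
      total mass n.\<close>
    have "(\<lambda>\<xi>. of_nat n - emeasure \<xi> A) \<in> borel_measurable (counting_space n)"
      using compl.IH by measurable
    then show ?case
    proof (rule measurable_cong[THEN iffD2, rotated])
      fix \<xi> :: "'a measure" assume "\<xi> \<in> space (counting_space n)"
      then obtain x where \<xi>: "\<xi> = sum_dirac n x" by (auto simp: counting_measures_def)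
      have "emeasure \<xi> (UNIV - A) = emeasure \<xi> UNIV - emeasure \<xi> A"
        using A finite_measure.emeasure_finite[OF finite_measure_sum_dirac]
        by (intro emeasure_Diff) (auto simp: \<xi>)
      then show "emeasure \<xi> (UNIV - A) = of_nat n - emeasure \<xi> A"
        by (simp add: \<xi> emeasure_sum_dirac)
    qed
  next
    case (union A)
    then have A: "range A \<subseteq> sets borel" by (auto simp: borel_eq_closed)
    have "(\<lambda>\<xi>. \<Sum>k. emeasure \<xi> (A k)) \<in> borel_measurable (counting_space n)"
      using union.IH by measurable
    then show ?case
    proof (rule measurable_cong[THEN iffD2, rotated])
      fix \<xi> :: "'a measure" assume "\<xi> \<in> space (counting_space n)"
      then show "emeasure \<xi> (\<Union> (range A)) = (\<Sum>k. emeasure \<xi> (A k))"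
        using A union.hyps by (intro suminf_emeasure[symmetric]) (auto simp: counting_measures_def)
    qed
  qed
qed

text \<open>Continuity of \<open>sum_dirac n\<close> for the product topology. On a generating set
  the integral of f becomes the finite sum of the f (x i), continuous in x; unions and intersections
  pass to preimages.\<close>

lemma open_vimage_sum_dirac:
  fixes U :: "'a::topological_space measure set"
  assumes "openin (weak_topology n) U"
  shows "open {x :: nat \<Rightarrow> 'a. sum_dirac n x \<in> U}"
  using assms unfolding weak_topology_def openin_topology_generated_by_iff
proof induction
  case Empty
  then show ?case by simp
next
  case (Int a b)
  then show ?case by (simp add: open_Collect_conj)
next
  case (UN K)
  have "{x. sum_dirac n x \<in> \<Union> K} = (\<Union>k\<in>K. {x. sum_dirac n x \<in> k})" by auto
  with UN show ?case by auto
next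
  case (Basis s)
  then obtain f :: "'a \<Rightarrow> real" and V where
    s: "s = {\<xi> \<in> counting_measures n. (\<integral>x. f x \<partial>\<xi>) \<in> V}" and f: "continuous_on UNIV f" and V: "open V"
    by auto
  have "{x. sum_dirac n x \<in> s} = (\<lambda>x. \<Sum>i<n. f (x i)) -` V"
    using f by (auto simp: s counting_measures_def integral_sum_dirac borel_measurable_continuous_onI)
  moreover have "continuous_on UNIV (\<lambda>x :: nat \<Rightarrow> 'a. \<Sum>i<n. f (x i))"
    by (intro continuous_on_sum continuous_on_compose2[OF f] continuous_on_product_coordinates) auto
  ultimately show ?case using V by (simp add: continuous_on_open_vimage)
qed

text \<open>Continuity lives on all functions from \<open>nat\<close>, while the points of the
  product over \<open>{..<n}\<close> are undefined beyond n. The map E joins the two, and second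
  countability identifies the product sigma-algebra with the Borel one.\<close>

lemma sum_dirac_measurable:
  fixes \<mu> :: "'a::second_countable_topology measure"
  assumes \<mu>: "sets \<mu> = sets borel"
  shows "sum_dirac n \<in> (\<Pi>\<^sub>M i\<in>{..<n}. \<mu>) \<rightarrow>\<^sub>M counting_space n"
proof -
  let ?P = "\<Pi>\<^sub>M i\<in>{..<n}. \<mu>"
  define E :: "(nat \<Rightarrow> 'a) \<Rightarrow> nat \<Rightarrow> 'a" where "E x i = (if i < n then x i else undefined)" for x i
  have "E \<in> ?P \<rightarrow>\<^sub>M (\<Pi>\<^sub>M i\<in>UNIV. borel)"
  proof (rule measurable_PiM_single')
    show "(\<lambda>x. E x i) \<in> ?P \<rightarrow>\<^sub>M borel" for i
      using measurable_component_singleton[of i "{..<n}" "\<lambda>_. \<mu>"] 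
      by (cases "i < n") (auto simp: E_def measurable_cong_sets[OF refl \<mu>])
  qed auto
  then have E: "E \<in> ?P \<rightarrow>\<^sub>M borel"
    by (simp add: measurable_cong_sets[OF refl sets_PiM_equal_borel])
  have "sum_dirac n \<in> borel \<rightarrow>\<^sub>M (counting_space n :: 'a measure measure)"
    unfolding counting_space_def borel_of_def
  proof (rule measurable_measure_of)
    fix U :: "'a measure set" assume "U \<in> {U. openin (weak_topology n) U}"
    then show "sum_dirac n -` U \<inter> space borel \<in> sets borel"
      using open_vimage_sum_dirac[of n U] by (simp add: vimage_def)
  next
    show "{U :: 'a measure set. openin (weak_topology n) U} \<subseteq> Pow (topspace (weak_topology n))"
      using openin_subset by blast
  qed (auto simp: counting_measures_def)
  from measurable_compose[OF E this] have "(\<lambda>x. sum_dirac n (E x)) \<in> ?P \<rightarrow>\<^sub>M counting_space n" .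
  moreover have "sum_dirac n (E x) = sum_dirac n x" for x :: "nat \<Rightarrow> 'a"
    by (rule sum_dirac_cong) (simp add: E_def)
  ultimately show ?thesis by simp
qed

section \<open>Uniformly random enumerations of the atoms\<close>

definition some_list :: "nat \<Rightarrow> 'a::topological_space measure \<Rightarrow> nat \<Rightarrow> 'a" where
  "some_list n \<xi> = (SOME x. x \<in> extensional {..<n} \<and> sum_dirac n x = \<xi>)"

text \<open>Restricting any representing tuple gives an extensional one, and extensionality makes
  the chosen list a point of the product space.\<close>

lemma some_list:
  assumes "\<xi> \<in> counting_measures n"
  shows "some_list n \<xi> \<in> extensional {..<n}" "sum_dirac n (some_list n \<xi>) = \<xi>"
proof -
  obtain x where "\<xi> = sum_dirac n x" using assms by (auto simp: counting_measures_def)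
  then have "restrict x {..<n} \<in> extensional {..<n} \<and> sum_dirac n (restrict x {..<n}) = \<xi>"
    by (auto intro!: sum_dirac_cong)
  from someI[of "\<lambda>x. x \<in> extensional {..<n} \<and> sum_dirac n x = \<xi>", OF this]
  show "some_list n \<xi> \<in> extensional {..<n}" "sum_dirac n (some_list n \<xi>) = \<xi>"
    by (auto simp: some_list_def)
qed

lemma comp_permutes_extensional:
  assumes "\<sigma> permutes {..<n}" "x \<in> extensional {..<n}" shows "x \<circ> \<sigma> \<in> extensional {..<n}"
  using assms by (auto simp: extensional_def permutes_not_in)

text \<open>The law of a uniformly random enumeration of the atoms of \<open>\<xi>\<close>, i.e. the conditional law, given
  \<open>sum_dirac n x = \<xi>\<close>, of any exchangeable \<open>x\<close>.\<close>

definition arrangement :: "'a::topological_space measure \<Rightarrow> nat \<Rightarrow> 'a measure \<Rightarrow> (nat \<Rightarrow> 'a) measure" where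
  "arrangement \<mu> n \<xi> = distr (uniform_count_measure {\<sigma>. \<sigma> permutes {..<n}}) (\<Pi>\<^sub>M i\<in>{..<n}. \<mu>) (\<lambda>\<sigma>. some_list n \<xi> \<circ> \<sigma>)"

lemma space_PiM_borel:
  fixes \<mu> :: "'a::topological_space measure"
  assumes "sets \<mu> = sets borel"
  shows "space (\<Pi>\<^sub>M i\<in>{..<n}. \<mu>) = extensional {..<n::nat}"
  using sets_eq_imp_space_eq[OF assms] by (simp add: space_PiM PiE_def)

lemma some_list_measurable_uniform:
  fixes \<mu> :: "'a::topological_space measure"
  assumes \<mu>: "sets \<mu> = sets borel" and \<xi>: "\<xi> \<in> counting_measures n"
  shows "(\<lambda>\<sigma>. some_list n \<xi> \<circ> \<sigma>) \<in> uniform_count_measure {\<sigma>. \<sigma> permutes {..<n}} \<rightarrow>\<^sub>M (\<Pi>\<^sub>M i\<in>{..<n}. \<mu>)"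
  using comp_permutes_extensional some_list(1)[OF \<xi>]
  by (auto simp: measurable_def space_PiM_borel[OF \<mu>] space_uniform_count_measure sets_uniform_count_measure)

lemma nn_integral_arrangement:
  fixes \<mu> :: "'a::topological_space measure"
  assumes \<mu>: "sets \<mu> = sets borel" and \<xi>: "\<xi> \<in> counting_measures n"
    and G: "G \<in> borel_measurable (\<Pi>\<^sub>M i\<in>{..<n}. \<mu>)"
  shows "(\<integral>\<^sup>+x. G x \<partial>arrangement \<mu> n \<xi>) = ennreal (1 / fact n) * (\<Sum>\<sigma> | \<sigma> permutes {..<n}. G (some_list n \<xi> \<circ> \<sigma>))"
  unfolding arrangement_def
  using G by (subst nn_integral_distr[OF some_list_measurable_uniform[OF \<mu> \<xi>]])
    (simp_all add: uniform_count_measure_def nn_integral_point_measure_finite finite_permutations card_permutations sum_distrib_left)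

lemma sets_arrangement [simp]: "sets (arrangement \<mu> n \<xi>) = sets (\<Pi>\<^sub>M i\<in>{..<n}. \<mu>)"
  by (simp add: arrangement_def)

lemma arrangement_AE:
  fixes \<mu> :: "'a::topological_space measure"
  assumes \<mu>: "sets \<mu> = sets borel" and \<xi>: "\<xi> \<in> counting_measures n"
    and P: "Measurable.pred (\<Pi>\<^sub>M i\<in>{..<n}. \<mu>) P"
    and *: "\<And>x. x \<in> extensional {..<n} \<Longrightarrow> sum_dirac n x = \<xi> \<Longrightarrow> P x"
  shows "AE x in arrangement \<mu> n \<xi>. P x"
  unfolding arrangement_def
proof (subst AE_distr_iff[OF some_list_measurable_uniform[OF \<mu> \<xi>]])
  show "{x \<in> space (\<Pi>\<^sub>M i\<in>{..<n}. \<mu>). P x} \<in> sets (\<Pi>\<^sub>M i\<in>{..<n}. \<mu>)" using P by simp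
  show "AE \<sigma> in uniform_count_measure {\<sigma>. \<sigma> permutes {..<n}}. P (some_list n \<xi> \<circ> \<sigma>)"
    using some_list[OF \<xi>]
    by (intro AE_I2 *) (auto simp: space_uniform_count_measure comp_permutes_extensional sum_dirac_permutes)
qed

text \<open>The chosen enumeration is x composed with some permutation \<rho>, and a sum over the
  whole symmetric group is invariant under composition with \<rho>; so the choice
  disappears.\<close>

lemma nn_integral_arrangement_sum_dirac:
  fixes \<mu> :: "'a::t2_space measure"
  assumes \<mu>: "sets \<mu> = sets borel" and x: "x \<in> extensional {..<n}"
    and G: "G \<in> borel_measurable (\<Pi>\<^sub>M i\<in>{..<n}. \<mu>)"
  shows "(\<integral>\<^sup>+y. G y \<partial>arrangement \<mu> n (sum_dirac n x)) = ennreal (1 / fact n) * (\<Sum>\<sigma> | \<sigma> permutes {..<n}. G (x \<circ> \<sigma>))"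
proof -
  have S: "sum_dirac n x \<in> counting_measures n" by (auto simp: counting_measures_def)
  obtain \<rho> where \<rho>: "\<rho> permutes {..<n}" and eq: "\<forall>i<n. some_list n (sum_dirac n x) i = x (\<rho> i)"
    using ex_permutes_if_sum_dirac_eq[of n x "some_list n (sum_dirac n x)"] some_list(2)[OF S] by auto
  have "some_list n (sum_dirac n x) = x \<circ> \<rho>"
    using some_list(1)[OF S] comp_permutes_extensional[OF \<rho> x] eq
    by (intro extensionalityI[of _ "{..<n}"]) auto
  then show ?thesis
    using setum_permutations_compose_left[OF \<rho>, of "\<lambda>\<sigma>. G (x \<circ> \<sigma>)"]
    by (simp add: nn_integral_arrangement[OF \<mu> S G] comp_assoc)
qed

lemma distr_PiM_permutes:
  fixes \<mu> :: "'a measure"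
  assumes mu: "prob_space \<mu>" and \<sigma>: "\<sigma> permutes {..<n}"
  shows "distr (\<Pi>\<^sub>M i\<in>{..<n}. \<mu>) (\<Pi>\<^sub>M i\<in>{..<n}. \<mu>) (\<lambda>x. x \<circ> \<sigma>) = (\<Pi>\<^sub>M i\<in>{..<n}. \<mu>)"
proof -
  have "distr (\<Pi>\<^sub>M i\<in>{..<n}. \<mu>) (\<Pi>\<^sub>M i\<in>{..<n}. \<mu>) (\<lambda>x. x \<circ> \<sigma>)
     = distr (\<Pi>\<^sub>M i\<in>{..<n}. \<mu>) (\<Pi>\<^sub>M i\<in>{..<n}. \<mu>) (\<lambda>x. \<lambda>i\<in>{..<n}. x (\<sigma> i))"
    using comp_permutes_extensional[OF \<sigma>]
    by (intro distr_cong refl) (auto simp: space_PiM PiE_def intro!: extensionalityI[of _ "{..<n}"])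
  also have "\<dots> = (\<Pi>\<^sub>M i\<in>{..<n}. \<mu>)"
    using permutes_inj_on[OF \<sigma>] permutes_in_image[OF \<sigma>] mu
    by (intro distr_PiM_reindex[where M="\<lambda>_. \<mu>" and K="{..<n}" and f=\<sigma>]) auto
  finally show ?thesis .
qed

lemma comp_permutes_measurable:
  assumes \<sigma>: "\<sigma> permutes {..<n}"
  shows "(\<lambda>x. x \<circ> \<sigma>) \<in> (\<Pi>\<^sub>M i\<in>{..<n}. \<mu>) \<rightarrow>\<^sub>M (\<Pi>\<^sub>M i\<in>{..<n}. \<mu>)"
proof (rule measurable_PiM_single')
  show "(\<lambda>x. (x \<circ> \<sigma>) i) \<in> (\<Pi>\<^sub>M i\<in>{..<n}. \<mu>) \<rightarrow>\<^sub>M \<mu>" if "i \<in> {..<n}" for i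
    using that permutes_in_image[OF \<sigma>] by (simp add: measurable_component_singleton)
  show "(\<lambda>x. x \<circ> \<sigma>) \<in> space (\<Pi>\<^sub>M i\<in>{..<n}. \<mu>) \<rightarrow> ({..<n} \<rightarrow>\<^sub>E space \<mu>)"
    using permutes_in_image[OF \<sigma>] comp_permutes_extensional[OF \<sigma>] by (auto simp: space_PiM PiE_def Pi_def)
qed

text \<open>This is the sense in which \<open>arrangement\<close> is a conditional law given the
  point measure. The weight depends on x only through its point measure and the product measure is
  invariant under permutations, so each of the n! terms has the same integral.\<close>

lemma nn_integral_PiM_arrangement:
  fixes \<mu> :: "'a::{second_countable_topology, t2_space} measure" and F :: "'a measure \<Rightarrow> ennreal"
  assumes mu: "prob_space \<mu>" and \<mu>: "sets \<mu> = sets borel"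
    and F: "F \<in> borel_measurable (counting_space n)"
    and G: "G \<in> borel_measurable (\<Pi>\<^sub>M i\<in>{..<n}. \<mu>)"
  shows "(\<integral>\<^sup>+x. F (sum_dirac n x) * (\<integral>\<^sup>+y. G y \<partial>arrangement \<mu> n (sum_dirac n x)) \<partial>(\<Pi>\<^sub>M i\<in>{..<n}. \<mu>))
    = (\<integral>\<^sup>+x. F (sum_dirac n x) * G x \<partial>(\<Pi>\<^sub>M i\<in>{..<n}. \<mu>))"
proof -
  let ?P = "\<Pi>\<^sub>M i\<in>{..<n}. \<mu>"
  have FS: "(\<lambda>x. F (sum_dirac n x)) \<in> borel_measurable ?P"
    by (rule measurable_compose[OF sum_dirac_measurable[OF \<mu>] F])
  have H: "(\<lambda>x. F (sum_dirac n x) * G x) \<in> borel_measurable ?P"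
    using FS G by (rule borel_measurable_times_ennreal)
  have perm: "(\<integral>\<^sup>+x. F (sum_dirac n x) * G (x \<circ> \<sigma>) \<partial>?P) = (\<integral>\<^sup>+x. F (sum_dirac n x) * G x \<partial>?P)"
    if \<sigma>: "\<sigma> permutes {..<n}" for \<sigma>
  proof -
    have "(\<integral>\<^sup>+x. F (sum_dirac n x) * G x \<partial>?P) = (\<integral>\<^sup>+x. F (sum_dirac n x) * G x \<partial>distr ?P ?P (\<lambda>x. x \<circ> \<sigma>))"
      by (simp only: distr_PiM_permutes[OF mu \<sigma>])
    also have "\<dots> = (\<integral>\<^sup>+x. F (sum_dirac n (x \<circ> \<sigma>)) * G (x \<circ> \<sigma>) \<partial>?P)"
      using H by (intro nn_integral_distr[OF comp_permutes_measurable[OF \<sigma>]]) simp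
    finally show ?thesis by (simp add: sum_dirac_permutes[OF \<sigma>])
  qed
  have meas: "(\<lambda>x. F (sum_dirac n x) * G (x \<circ> \<sigma>)) \<in> borel_measurable ?P" if "\<sigma> permutes {..<n}" for \<sigma>
    by (rule borel_measurable_times_ennreal[OF FS measurable_compose[OF comp_permutes_measurable[OF that] G]])
  have "(\<integral>\<^sup>+x. F (sum_dirac n x) * (\<integral>\<^sup>+y. G y \<partial>arrangement \<mu> n (sum_dirac n x)) \<partial>?P)
    = (\<integral>\<^sup>+x. ennreal (1 / fact n) * (\<Sum>\<sigma> | \<sigma> permutes {..<n}. F (sum_dirac n x) * G (x \<circ> \<sigma>)) \<partial>?P)"
    by (intro nn_integral_cong)
      (simp add: space_PiM_borel[OF \<mu>] nn_integral_arrangement_sum_dirac[OF \<mu> _ G] sum_distrib_left mult.left_commute)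
  also have "\<dots> = ennreal (1 / fact n) * (\<Sum>\<sigma> | \<sigma> permutes {..<n}. \<integral>\<^sup>+x. F (sum_dirac n x) * G (x \<circ> \<sigma>) \<partial>?P)"
    using meas by (subst nn_integral_cmult, force, subst nn_integral_sum) auto
  also have "\<dots> = ennreal (1 / fact n) * (fact n * (\<integral>\<^sup>+x. F (sum_dirac n x) * G x \<partial>?P))"
    using perm by (simp add: card_permutations)
  also have "\<dots> = (ennreal (1 / fact n) * ennreal (fact n)) * (\<integral>\<^sup>+x. F (sum_dirac n x) * G x \<partial>?P)"
    using ennreal_of_nat_eq_real_of_nat[of "fact n"] by (simp add: mult.assoc)
  also have "ennreal (1 / fact n) * ennreal (fact n) = 1"
    by (subst ennreal_mult[symmetric]) auto
  finally show ?thesis by simp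
qed

lemma card_arrangements_measurable:
  fixes A :: "nat \<Rightarrow> 'a::metric_space set"
  assumes A: "\<And>i. i < n \<Longrightarrow> A i \<in> sets borel"
  shows "(\<lambda>\<xi>. of_nat (card {\<sigma>. \<sigma> permutes {..<n} \<and> (\<forall>i<n. some_list n \<xi> (\<sigma> i) \<in> A i)}) :: ennreal)
    \<in> borel_measurable (counting_space n)"
proof -
  text \<open>The cardinality depends only on how many atoms of \<open>\<xi>\<close> lie in each cell \<open>D B\<close> of the partition
    generated by the sets \<open>A i\<close>.\<close>
  define N where "N \<xi> = card {\<sigma>. \<sigma> permutes {..<n} \<and> (\<forall>i<n. some_list n \<xi> (\<sigma> i) \<in> A i)}" for \<xi>
  define ty where "ty \<xi> j = {i\<in>{..<n}. some_list n \<xi> j \<in> A i}" for \<xi> j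
  define c where "c \<xi> = (\<lambda>B\<in>Pow {..<n}. card {j\<in>{..<n}. ty \<xi> j = B})" for \<xi>
  define D where "D B = {z. \<forall>i<n. z \<in> A i \<longleftrightarrow> i \<in> B}" for B
  define V where "V = (Pow {..<n} \<rightarrow>\<^sub>E {..n})"
  \<comment> \<open>N is read off from the counts by evaluating it at some point measure that has
    them; \<open>N_c\<close> makes the value independent of which one.\<close>
  define g where "g v = N (SOME \<xi>. \<xi> \<in> counting_measures n \<and> c \<xi> = v)" for v
  have V: "finite V" unfolding V_def by (intro finite_PiE) auto
  have cV: "c \<xi> \<in> V" for \<xi>
  proof -
    have "card {j\<in>{..<n}. ty \<xi> j = B} \<le> n" for B
      using card_mono[of "{..<n}" "{j\<in>{..<n}. ty \<xi> j = B}"] by auto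
    then show ?thesis by (auto simp: c_def V_def)
  qed
  have D: "D B \<in> sets borel" for B
  proof -
    have "D B = (\<Inter>i\<in>{..<n}. if i \<in> B then A i else - A i)" by (auto simp: D_def split: if_splits)
    moreover have "(\<Inter>i\<in>{..<n}. if i \<in> B then A i else - A i) \<in> sets borel"
    proof (cases "n = 0")
      case False
      with A show ?thesis by (intro sets.finite_INT) (auto intro: borel_comp)
    qed simp
    ultimately show ?thesis by simp
  qed
  have D_count: "emeasure \<xi> (D B) = of_nat (card {j\<in>{..<n}. ty \<xi> j = B})"
    if \<xi>: "\<xi> \<in> counting_measures n" and B: "B \<subseteq> {..<n}" for \<xi> B
  proof -
    have "emeasure \<xi> (D B) = (\<Sum>j<n. indicator (D B) (some_list n \<xi> j))"
      using emeasure_sum_dirac[OF D, of n "some_list n \<xi>" B] some_list(2)[OF \<xi>] by simp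
    also have "\<dots> = of_nat (card {j\<in>{..<n}. some_list n \<xi> j \<in> D B})"
      by (simp add: indicator_def sum.If_cases Int_def)
    also have "{j\<in>{..<n}. some_list n \<xi> j \<in> D B} = {j\<in>{..<n}. ty \<xi> j = B}"
      using B by (auto simp: D_def ty_def)
    finally show ?thesis .
  qed
  \<comment> \<open>The set V of possible counts is finite, so only preimages of single vectors
    matter, and each is given by finitely many conditions on the masses of cells.\<close>
  have c_meas: "c \<in> counting_space n \<rightarrow>\<^sub>M count_space V"
    unfolding measurable_count_space_eq2[OF V]
  proof (intro conjI ballI)
    fix v assume v: "v \<in> V"
    have "c -` {v} \<inter> space (counting_space n)
      = {\<xi> \<in> space (counting_space n). \<forall>B\<in>Pow {..<n}. emeasure \<xi> (D B) = of_nat (v B)}"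
      using v D_count unfolding c_def V_def
      by (auto simp: fun_eq_iff restrict_def PiE_def extensional_def)
    also have "\<dots> \<in> sets (counting_space n)"
    proof (intro sets.sets_Collect_finite_All)
      fix B assume "B \<in> Pow {..<n}"
      have "(\<lambda>\<xi>. emeasure \<xi> (D B)) -` {of_nat (v B)} \<inter> space (counting_space n) \<in> sets (counting_space n)"
        by (rule measurable_sets[OF emeasure_measurable_counting_space[OF D]]) simp
      then show "{\<xi> \<in> space (counting_space n). emeasure \<xi> (D B) = of_nat (v B)} \<in> sets (counting_space n)"
        by (simp add: vimage_def Int_def conj_commute)
    qed simp
    finally show "c -` {v} \<inter> space (counting_space n) \<in> sets (counting_space n)" .
  qed (use cV in auto)
  have N_c: "N \<xi> = N \<eta>" if "c \<xi> = c \<eta>" for \<xi> \<eta>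
  proof -
    have "card {j\<in>{..<n}. ty \<xi> j = B} = card {j\<in>{..<n}. ty \<eta> j = B}" for B
    proof (cases "B \<subseteq> {..<n}")
      case True
      then show ?thesis using fun_cong[OF that, of B] by (simp add: c_def)
    next
      case False
      then have "{j\<in>{..<n}. ty \<xi> j = B} = {}" "{j\<in>{..<n}. ty \<eta> j = B} = {}" by (auto simp: ty_def)
      then show ?thesis by (simp only:)
    qed
    \<comment> \<open>With equal counts the two enumerations are matched by a permutation that
      preserves the cells, even if the atoms themselves differ; composing with it re-indexes the sum
      over all \<sigma>.\<close>
    from ex_permutes_if_card_eq[OF this]
    obtain \<rho> where \<rho>: "\<rho> permutes {..<n}" and eq: "\<forall>j<n. ty \<eta> j = ty \<xi> (\<rho> j)" by blast
    have iff: "some_list n \<eta> j \<in> A i \<longleftrightarrow> some_list n \<xi> (\<rho> j) \<in> A i" if "i < n" "j < n" for i j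
      using eq that by (auto simp: ty_def set_eq_iff)
    have sum_eq: "N \<xi> = (\<Sum>\<sigma> | \<sigma> permutes {..<n}. of_bool (\<forall>i<n. some_list n \<xi> (\<sigma> i) \<in> A i))" for \<xi>
      by (simp add: N_def finite_permutations of_bool_def sum.If_cases Int_def)
    have "N \<eta> = (\<Sum>\<sigma> | \<sigma> permutes {..<n}. of_bool (\<forall>i<n. some_list n \<xi> ((\<rho> \<circ> \<sigma>) i) \<in> A i))"
      unfolding sum_eq
    proof (intro sum.cong refl arg_cong[where f=of_bool] all_cong)
      fix \<sigma> i assume "\<sigma> \<in> {\<sigma>. \<sigma> permutes {..<n}}" and i: "i < n"
      then have "\<sigma> i < n" using permutes_in_image[of \<sigma> "{..<n}" i] by simp
      then show "some_list n \<eta> (\<sigma> i) \<in> A i \<longleftrightarrow> some_list n \<xi> ((\<rho> \<circ> \<sigma>) i) \<in> A i"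
        using iff[OF i] by simp
    qed
    also have "\<dots> = N \<xi>"
      unfolding sum_eq
      by (rule setum_permutations_compose_left[OF \<rho>, symmetric, of "\<lambda>\<sigma>. of_bool (\<forall>i<n. some_list n \<xi> (\<sigma> i) \<in> A i)"])
    finally show ?thesis by simp
  qed
  have "(\<lambda>\<xi>. of_nat (g (c \<xi>)) :: ennreal) \<in> borel_measurable (counting_space n)"
    by (rule measurable_compose[OF c_meas]) simp
  then show ?thesis
  proof (rule measurable_cong[THEN iffD2, rotated])
    fix \<xi> :: "'a measure" assume "\<xi> \<in> space (counting_space n)"
    then have "\<xi> \<in> counting_measures n \<and> c \<xi> = c \<xi>" by simp
    from someI[of "\<lambda>\<eta>. \<eta> \<in> counting_measures n \<and> c \<eta> = c \<xi>", OF this] have "g (c \<xi>) = N \<xi>"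
      unfolding g_def by (intro N_c) auto
    then show "of_nat (card {\<sigma>. \<sigma> permutes {..<n} \<and> (\<forall>i<n. some_list n \<xi> (\<sigma> i) \<in> A i)}) = (of_nat (g (c \<xi>)) :: ennreal)"
      by (simp add: N_def)
  qed
qed

lemma prob_space_arrangement:
  fixes \<mu> :: "'a::topological_space measure"
  assumes \<mu>: "sets \<mu> = sets borel" and \<xi>: "\<xi> \<in> counting_measures n"
  shows "prob_space (arrangement \<mu> n \<xi>)"
  unfolding arrangement_def
  by (intro prob_space.prob_space_distr some_list_measurable_uniform \<mu> \<xi> prob_space_uniform_count_measure)
    (auto simp: finite_permutations intro: permutes_id)

text \<open>Boxes form an intersection-stable generator of the product sigma-algebra, and the
  probability of a box is 1/n! times the number of permutations that put every atom into its
  prescribed set.\<close>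

lemma arrangement_measurable:
  fixes \<mu> :: "'a::metric_space measure"
  assumes \<mu>: "sets \<mu> = sets borel"
  shows "arrangement \<mu> n \<in> counting_space n \<rightarrow>\<^sub>M prob_algebra (\<Pi>\<^sub>M i\<in>{..<n}. \<mu>)"
proof (rule measurable_prob_algebra_generated[OF sets_PiM Int_stable_prod_algebra prod_algebra_sets_into_space])
  fix X assume "X \<in> prod_algebra {..<n} (\<lambda>_. \<mu>)"
  then obtain A where X: "X = Pi\<^sub>E {..<n} A" and A: "\<And>i. i < n \<Longrightarrow> A i \<in> sets borel"
    by (auto simp: prod_algebra_eq_finite \<mu>)
  have Xs: "X \<in> sets (\<Pi>\<^sub>M i\<in>{..<n}. \<mu>)"
    unfolding X using A by (intro sets_PiM_I_finite) (auto simp: \<mu>)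
  have "(\<lambda>\<xi>. ennreal (1 / fact n) * of_nat (card {\<sigma>. \<sigma> permutes {..<n} \<and> (\<forall>i<n. some_list n \<xi> (\<sigma> i) \<in> A i)}))
    \<in> borel_measurable (counting_space n)"
    using A by (intro borel_measurable_times_ennreal card_arrangements_measurable) auto
  then show "(\<lambda>\<xi>. emeasure (arrangement \<mu> n \<xi>) X) \<in> borel_measurable (counting_space n)"
  proof (rule measurable_cong[THEN iffD2, rotated])
    fix \<xi> :: "'a measure" assume "\<xi> \<in> space (counting_space n)"
    then have \<xi>: "\<xi> \<in> counting_measures n" by simp
    have "emeasure (arrangement \<mu> n \<xi>) X = (\<integral>\<^sup>+x. indicator X x \<partial>arrangement \<mu> n \<xi>)"
      using Xs by simp
    also have "\<dots> = ennreal (1 / fact n) * (\<Sum>\<sigma> | \<sigma> permutes {..<n}. indicator X (some_list n \<xi> \<circ> \<sigma>))"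
      using Xs by (intro nn_integral_arrangement \<mu> \<xi>) simp
    also have "(\<Sum>\<sigma> | \<sigma> permutes {..<n}. indicator X (some_list n \<xi> \<circ> \<sigma>) :: ennreal)
      = (\<Sum>\<sigma> | \<sigma> permutes {..<n}. of_bool (\<forall>i<n. some_list n \<xi> (\<sigma> i) \<in> A i))"
      using comp_permutes_extensional[OF _ some_list(1)[OF \<xi>]]
      by (intro sum.cong refl) (auto simp: X PiE_def Pi_def indicator_def)
    also have "\<dots> = of_nat (card {\<sigma>. \<sigma> permutes {..<n} \<and> (\<forall>i<n. some_list n \<xi> (\<sigma> i) \<in> A i)})"
      by (simp add: finite_permutations of_bool_def sum.If_cases Int_def)
    finally show "emeasure (arrangement \<mu> n \<xi>) X =
      ennreal (1 / fact n) * of_nat (card {\<sigma>. \<sigma> permutes {..<n} \<and> (\<forall>i<n. some_list n \<xi> (\<sigma> i) \<in> A i)})" .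
  qed
qed (use prob_space_arrangement[OF \<mu>] in auto)

section \<open>Lifting to n-tuples\<close>

text \<open>As f integrates to 1, the linear terms of \<open>entropy_fun\<close> cancel. The
  positive part p and the negative part m of the entropy stay apart in the identity I + m = p, and m
  may be subtracted since it is at most 1.\<close>

lemma rel_entropy_eq:
  assumes P: "prob_space P" and Q: "prob_space Q" and sets: "sets P = sets Q" and ac: "absolutely_continuous Q P"
  obtains f where "prob_density Q f" "density Q f = P"
    "rel_entropy P Q = enn2ereal (\<integral>\<^sup>+x. entropy_fun (f x) \<partial>Q)"
proof -
  interpret P: prob_space P by fact
  interpret Q: prob_space Q by fact
  define f where "f x = enn2real (RN_deriv Q P x)" for x
  have f[measurable]: "f \<in> borel_measurable Q" unfolding f_def by measurable
  have f0: "0 \<le> f x" for x by (simp add: f_def)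
  have "AE x in Q. RN_deriv Q P x \<noteq> \<infinity>"
    by (rule Q.RN_deriv_finite[OF P.sigma_finite_measure_axioms ac sets])
  then have "AE x in Q. RN_deriv Q P x = ennreal (f x)"
    by eventually_elim (simp add: f_def less_top)
  then have "density Q (RN_deriv Q P) = density Q (\<lambda>x. ennreal (f x))"
    by (intro density_cong) auto
  then have dens: "density Q f = P" using Q.density_RN_deriv[OF ac sets] by simp
  have int1: "(\<integral>\<^sup>+x. f x \<partial>Q) = 1"
    using P.emeasure_space_1 sets_eq_imp_space_eq[OF sets] 
      emeasure_density[of "\<lambda>x. ennreal (f x)" Q "space Q"] by (simp add: dens cong: nn_integral_cong)
  define I where "I = (\<integral>\<^sup>+x. entropy_fun (f x) \<partial>Q)"
  define p where "p = (\<integral>\<^sup>+x. ennreal (f x) * ennreal (ln (f x)) \<partial>Q)"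
  define m where "m = (\<integral>\<^sup>+x. ennreal (f x) * ennreal (- ln (f x)) \<partial>Q)"
  have pP: "(\<integral>\<^sup>+x. ennreal (ln (f x)) \<partial>P) = p"
    unfolding p_def dens[symmetric] by (subst nn_integral_density) auto
  have mP: "(\<integral>\<^sup>+x. ennreal (- ln (f x)) \<partial>P) = m"
    unfolding m_def dens[symmetric] by (subst nn_integral_density) auto
  have pt: "ennreal (entropy_fun (f x)) + ennreal (f x) * ennreal (- ln (f x)) + ennreal (f x)
    = ennreal (f x) * ennreal (ln (f x)) + 1" for x
  proof -
    define a b where "a = f x * max (ln (f x)) 0" and "b = f x * max (- ln (f x)) 0"
    have ab: "0 \<le> a" "0 \<le> b" using f0 by (auto simp: a_def b_def)
    have "entropy_fun (f x) + b + f x = a + 1"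
      by (simp add: entropy_fun_def a_def b_def max_def)
    then have "ennreal (entropy_fun (f x)) + ennreal b + ennreal (f x) = ennreal a + 1"
      using ab f0[of x] entropy_fun_nonneg[OF f0[of x]] by (simp flip: ennreal_plus ennreal_1)
    moreover have "ennreal (f x) * ennreal (- ln (f x)) = ennreal b" "ennreal (f x) * ennreal (ln (f x)) = ennreal a"
      using f0[of x] by (auto simp: a_def b_def ennreal_mult)
    ultimately show ?thesis by simp
  qed
  have "I + m + 1 = (\<integral>\<^sup>+x. ennreal (entropy_fun (f x)) + ennreal (f x) * ennreal (- ln (f x)) + ennreal (f x) \<partial>Q)"
    by (simp add: nn_integral_add I_def m_def int1)
  also have "\<dots> = p + 1"
    unfolding pt by (simp add: nn_integral_add p_def Q.emeasure_space_1)
  finally have Imp: "I + m = p" by (simp add: ennreal_add_left_cancel add.commute[of _ 1])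
  have "m \<le> (\<integral>\<^sup>+x. 1 \<partial>Q)" unfolding m_def
  proof (rule nn_integral_mono)
    fix x
    \<comment> \<open>Nonnegativity of \<open>entropy_fun\<close> reads - y ln y \<le> 1 -
      y.\<close>
    have "f x * - ln (f x) \<le> 1"
      using entropy_fun_nonneg[OF f0[of x]] f0[of x] by (simp add: entropy_fun_def)
    then show "ennreal (f x) * ennreal (- ln (f x)) \<le> 1"
      using f0[of x] by (simp flip: ennreal_mult'' ennreal_mult' add: ennreal_le_1)
  qed
  then have "m < \<top>" using Q.emeasure_space_1 by (auto simp: less_top[symmetric] top_unique)
  then have "enn2ereal p - enn2ereal m = enn2ereal I"
    unfolding Imp[symmetric] plus_ennreal.rep_eq by (cases m; cases I) (auto simp: top_ennreal.rep_eq)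
  then have "rel_entropy P Q = enn2ereal I"
    using ac pP mP unfolding rel_entropy_def f_def by simp
  with f f0 int1 dens show thesis
    by (intro that[of f]) (auto simp: prob_density_def I_def)
qed

text \<open>The point measure is carried by a finite set, on which an arbitrary f agrees with a
  measurable g. This evaluates the outer integral of the cost without discussing how its integrand
  depends on the point.\<close>

lemma nn_integral_sum_dirac_t2:
  fixes x :: "nat \<Rightarrow> 'a::t2_space" and f :: "'a \<Rightarrow> ennreal"
  shows "(\<integral>\<^sup>+z. f z \<partial>sum_dirac n x) = (\<Sum>i<n. f (x i))"
proof -
  let ?F = "x ` {..<n}"
  define g where "g z = (\<Sum>b\<in>?F. f b * indicator {b} z)" for z
  have g: "g z = f z" if "z \<in> ?F" for z
    using that by (simp add: g_def indicator_def if_distrib sum.delta cong: if_cong)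
  have [measurable]: "g \<in> borel_measurable borel"
    unfolding g_def by measurable
  have "AE z in sum_dirac n x. z \<in> ?F"
  proof (rule AE_I[of _ _ "- ?F"])
    have "- ?F \<in> sets borel" by (intro borel_comp borel_closed finite_imp_closed) simp
    then show "- ?F \<in> sets (sum_dirac n x)" "emeasure (sum_dirac n x) (- ?F) = 0"
      by (auto simp: emeasure_sum_dirac indicator_def)
  qed auto
  then have "(\<integral>\<^sup>+z. f z \<partial>sum_dirac n x) = (\<integral>\<^sup>+z. g z \<partial>sum_dirac n x)"
    by (intro nn_integral_cong_AE) (auto simp: g)
  also have "\<dots> = (\<Sum>i<n. f (x i))"
    by (subst nn_integral_sum_dirac) (auto simp: g)
  finally show ?thesis .
qed

section \<open>Comparison of the cost of point measures with that of tuples\<close>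

lemma acost_mean:
  assumes t: "0 \<le> t" "t \<le> 1" and I: "finite I" "I \<noteq> {}" and v: "\<And>i. i \<in> I \<Longrightarrow> 0 \<le> v i \<and> v i \<le> 1"
  shows "acost t ((\<Sum>i\<in>I. v i) / card I) \<le> ennreal (1 / card I) * (\<Sum>i\<in>I. acost t (v i))"
proof -
  have "acost t (\<integral>i. v i \<partial>uniform_count_measure I) \<le> (\<integral>\<^sup>+i. acost t (v i) \<partial>uniform_count_measure I)"
    using I v by (intro acost_jensen t prob_space_uniform_count_measure)
      (auto simp: uniform_count_measure_def space_point_measure)
  then show ?thesis
    using I(1) by (simp add: uniform_count_measure_def lebesgue_integral_point_measure_finite
        nn_integral_point_measure_finite sum_distrib_left sum_divide_distrib)
qed

text \<open>Every i in I with y i = z keeps an atom at z, so the loss at z is at most the number of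
  indices of I that move. Atoms arriving at z from elsewhere only reduce the loss, hence an
  inequality.\<close>

lemma atom_deficit_le:
  fixes x y :: "nat \<Rightarrow> 'a::t2_space"
  assumes "z \<in> x ` {..<n}"
  defines "I \<equiv> {i\<in>{..<n}. x i = z}"
  shows "max (1 - measure (sum_dirac n y) {z} / measure (sum_dirac n x) {z}) 0
    \<le> (\<Sum>i\<in>I. of_bool (x i \<noteq> y i)) / card I"
proof -
  have I: "finite I" "I \<noteq> {}" using assms by (auto simp: I_def)
  then have c: "0 < real (card I)" by (simp add: card_gt_0_iff)
  have "(\<Sum>i\<in>I. of_bool (x i \<noteq> y i) :: real) = real (card I) - card {i\<in>I. y i = z}"
  proof -
    have "(\<Sum>i\<in>I. of_bool (x i \<noteq> y i) :: real) = (\<Sum>i\<in>I. 1 - of_bool (y i = z))"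
      by (intro sum.cong) (auto simp: I_def)
    then show ?thesis using I by (simp add: sum_subtractf of_bool_def sum.If_cases Int_def)
  qed
  moreover have "card {i\<in>I. y i = z} \<le> card {i\<in>{..<n}. y i = z}"
    by (intro card_mono) (auto simp: I_def)
  ultimately have "real (card I) - card {i\<in>{..<n}. y i = z} \<le> (\<Sum>i\<in>I. of_bool (x i \<noteq> y i))"
    by simp
  then have "(real (card I) - card {i\<in>{..<n}. y i = z}) / card I \<le> (\<Sum>i\<in>I. of_bool (x i \<noteq> y i)) / card I"
    using c by (intro divide_right_mono) auto
  moreover have "(real (card I) - card {i\<in>{..<n}. y i = z}) / card I
     = 1 - measure (sum_dirac n y) {z} / measure (sum_dirac n x) {z}"
    using c assms(1) by (auto simp: measure_sum_dirac I_def diff_divide_distrib)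
  ultimately show ?thesis by (simp add: sum_nonneg)
qed

text \<open>The deficit at x j is bounded by a mean over the indices that share this point. In the
  sum over j every index is therefore counted once for each index sharing its point, each time
  weighted by the inverse of that number, so its total weight is 1.\<close>

lemma sum_atoms_acost_le_hamming_cost:
  fixes \<mu> :: "'a::{second_countable_topology, t2_space} measure" and x :: "nat \<Rightarrow> 'a"
  assumes t: "0 \<le> t" "t \<le> 1" and \<mu>: "sets \<mu> = sets borel" and r: "r \<in> space (prob_algebra (\<Pi>\<^sub>M i\<in>{..<n}. \<mu>))"
    and meas: "\<And>z. (\<lambda>y. measure (sum_dirac n y) {z}) \<in> borel_measurable (\<Pi>\<^sub>M i\<in>{..<n}. \<mu>)"
  shows "(\<Sum>j<n. acost t (\<integral>y. max (1 - measure (sum_dirac n y) {x j} / measure (sum_dirac n x) {x j}) 0 \<partial>r))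
    \<le> hamming_cost t n x r"
proof -
  interpret prob_space r using r by (simp add: space_prob_algebra)
  have rs: "sets r = sets (\<Pi>\<^sub>M i\<in>{..<n}. \<mu>)" using r by (simp add: space_prob_algebra)
  define I where "I z = {i\<in>{..<n}. x i = z}" for z
  define v where "v i = measure r {y \<in> space r. x i \<noteq> y i}" for i
  have I: "finite (I (x j))" "I (x j) \<noteq> {}" if "j < n" for j using that by (auto simp: I_def)
  have neq: "{y \<in> space r. x i \<noteq> y i} \<in> sets r" if "i < n" for i
  proof -
    have "(\<lambda>y. y i) \<in> r \<rightarrow>\<^sub>M borel"
      using measurable_component_singleton[of i "{..<n}" "\<lambda>_. \<mu>"] that
      by (simp add: measurable_cong_sets[OF rs refl] measurable_cong_sets[OF refl \<mu>])
    then have "(\<lambda>y. y i) -` (- {x i}) \<inter> space r \<in> sets r" by (rule measurable_sets) auto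
    also have "(\<lambda>y. y i) -` (- {x i}) \<inter> space r = {y \<in> space r. x i \<noteq> y i}" by auto
    finally show ?thesis .
  qed
  have v01: "0 \<le> v i \<and> v i \<le> 1" for i by (simp add: v_def)
  have "acost t (\<integral>y. max (1 - measure (sum_dirac n y) {x j} / measure (sum_dirac n x) {x j}) 0 \<partial>r)
    \<le> ennreal (1 / card (I (x j))) * (\<Sum>i\<in>I (x j). acost t (v i))" if j: "j < n" for j
  proof -
    define d where "d y = max (1 - measure (sum_dirac n y) {x j} / measure (sum_dirac n x) {x j}) 0" for y
    define s where "s y = (\<Sum>i\<in>I (x j). indicator {y \<in> space r. x i \<noteq> y i} y) / real (card (I (x j)))" for y
    have d01: "0 \<le> d y" "d y \<le> 1" for y by (auto simp: d_def)
    have [measurable]: "d \<in> borel_measurable r"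
      using meas[of "x j"] unfolding d_def by (simp add: measurable_cong_sets[OF rs refl])
    have d_int: "integrable r d" using d01 by (intro integrable_const_bound[where B=1]) auto
    have ind: "integrable r (\<lambda>y. indicat_real {y \<in> space r. x i \<noteq> y i} y)" if "i \<in> I (x j)" for i
      by (intro integrable_real_indicator neq) (use that in \<open>auto simp: I_def emeasure_finite less_top[symmetric]\<close>)
    have s_int: "integrable r s" unfolding s_def using ind by (intro integrable_divide_zero Bochner_Integration.integrable_sum) auto
    have "d y \<le> s y" if "y \<in> space r" for y
    proof -
      have "(\<Sum>i\<in>I (x j). indicator {y \<in> space r. x i \<noteq> y i} y) = (\<Sum>i\<in>I (x j). of_bool (x i \<noteq> y i) :: real)"
        using that by (intro sum.cong) (auto simp: indicator_def)
      then show ?thesis unfolding d_def s_def I_def using atom_deficit_le[of "x j" x n y] j by auto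
    qed
    then have "(\<integral>y. d y \<partial>r) \<le> (\<integral>y. s y \<partial>r)"
      using d_int s_int by (intro integral_mono) auto
    also have "\<dots> = (\<Sum>i\<in>I (x j). v i) / card (I (x j))"
    proof -
      have "(\<integral>y. indicat_real {y \<in> space r. x i \<noteq> y i} y \<partial>r) = v i" if "i \<in> I (x j)" for i
        by (simp add: v_def Int_absorb2)
      then have "(\<Sum>i\<in>I (x j). \<integral>y. indicat_real {y \<in> space r. x i \<noteq> y i} y \<partial>r) = (\<Sum>i\<in>I (x j). v i)"
        by (intro sum.cong) auto
      moreover have "(\<integral>y. (\<Sum>i\<in>I (x j). indicat_real {y \<in> space r. x i \<noteq> y i} y) \<partial>r)
        = (\<Sum>i\<in>I (x j). \<integral>y. indicat_real {y \<in> space r. x i \<noteq> y i} y \<partial>r)"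
        by (rule Bochner_Integration.integral_sum) (rule ind)
      ultimately show ?thesis by (simp only: s_def integral_divide_zero)
    qed
    finally have le: "(\<integral>y. d y \<partial>r) \<le> (\<Sum>i\<in>I (x j). v i) / card (I (x j))" .
    have "(\<Sum>i\<in>I (x j). v i) \<le> (\<Sum>i\<in>I (x j). 1)" using v01 by (intro sum_mono) auto
    then have "(\<Sum>i\<in>I (x j). v i) / card (I (x j)) \<le> 1"
      using I[OF j] by (simp add: divide_le_eq card_gt_0_iff)
    moreover have "0 \<le> (\<integral>y. d y \<partial>r)" using d01 by (intro integral_nonneg_AE) auto
    ultimately have "acost t (\<integral>y. d y \<partial>r) \<le> acost t ((\<Sum>i\<in>I (x j). v i) / card (I (x j)))"
      using le by (intro acost_mono t)
    also have "\<dots> \<le> ennreal (1 / card (I (x j))) * (\<Sum>i\<in>I (x j). acost t (v i))"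
      using I[OF j] v01 by (intro acost_mean t) auto
    finally show ?thesis unfolding d_def .
  qed
  then have "(\<Sum>j<n. acost t (\<integral>y. max (1 - measure (sum_dirac n y) {x j} / measure (sum_dirac n x) {x j}) 0 \<partial>r))
    \<le> (\<Sum>j<n. ennreal (1 / card (I (x j))) * (\<Sum>i\<in>I (x j). acost t (v i)))"
    by (intro sum_mono) auto
  also have "\<dots> = (\<Sum>j<n. \<Sum>i<n. if x i = x j then ennreal (1 / card (I (x j))) * acost t (v i) else 0)"
    by (simp add: I_def sum_distrib_left sum.inter_filter flip: sum.inter_filter)
  also have "\<dots> = (\<Sum>i<n. \<Sum>j<n. if x i = x j then ennreal (1 / card (I (x j))) * acost t (v i) else 0)"
    by (rule sum.swap)
  also have "\<dots> = (\<Sum>i<n. acost t (v i))"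
  proof (intro sum.cong refl)
    fix i assume i: "i \<in> {..<n}"
    have "(\<Sum>j<n. if x i = x j then ennreal (1 / card (I (x j))) * acost t (v i) else 0)
      = (\<Sum>j\<in>I (x i). ennreal (1 / card (I (x i))) * acost t (v i))"
      unfolding I_def by (subst sum.inter_filter) (auto intro!: sum.cong)
    also have "\<dots> = ennreal (card (I (x i))) * ennreal (1 / card (I (x i))) * acost t (v i)"
      by (simp add: ennreal_of_nat_eq_real_of_nat mult.assoc)
    also have "ennreal (card (I (x i))) * ennreal (1 / card (I (x i))) = 1"
      using I[of i] i by (subst ennreal_mult[symmetric]) auto
    finally show "(\<Sum>j<n. if x i = x j then ennreal (1 / card (I (x j))) * acost t (v i) else 0) = acost t (v i)"
      by simp
  qed
  finally show ?thesis by (simp add: hamming_cost_def v_def)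
qed

text \<open>Reduces membership in \<open>coupling_kernels\<close> to one equation for the mixture
  \<open>P \<bind> p\<close>; the first marginal is automatic.\<close>

lemma distr_kernel_joint:
  assumes p: "p \<in> M \<rightarrow>\<^sub>M prob_algebra M" and P: "P \<in> space (prob_algebra M)"
  shows "distr (kernel_joint M P p) M fst = P" "distr (kernel_joint M P p) M snd = P \<bind> p"
proof -
  interpret prob_space P using P by (simp add: space_prob_algebra)
  have sets: "sets P = sets M" using P by (simp add: space_prob_algebra)
  note sp = sets_eq_imp_space_eq[OF sets]
  have pk: "sets (p \<xi>) = sets M" "prob_space (p \<xi>)" if "\<xi> \<in> space M" for \<xi>
    using measurable_space[OF p that] by (auto simp: space_prob_algebra)
  have "(\<lambda>\<xi>. distr (p \<xi>) (M \<Otimes>\<^sub>M M) (Pair \<xi>)) \<in> M \<rightarrow>\<^sub>M subprob_algebra (M \<Otimes>\<^sub>M M)"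
    using measurable_prob_algebraD[OF p] by (intro measurable_distr2[where M=M]) auto
  then have k: "(\<lambda>\<xi>. distr (p \<xi>) (M \<Otimes>\<^sub>M M) (Pair \<xi>)) \<in> P \<rightarrow>\<^sub>M subprob_algebra (M \<Otimes>\<^sub>M M)"
    by (simp add: measurable_cong_sets[OF sets refl])
  have pair: "Pair \<xi> \<in> p \<xi> \<rightarrow>\<^sub>M M \<Otimes>\<^sub>M M" if "\<xi> \<in> space M" for \<xi>
    using that by (simp add: measurable_cong_sets[OF pk(1)[OF that] refl])
  have "distr (kernel_joint M P p) M fst = P \<bind> (\<lambda>\<xi>. distr (distr (p \<xi>) (M \<Otimes>\<^sub>M M) (Pair \<xi>)) M fst)"
    unfolding kernel_joint_def by (rule distr_bind[OF k not_empty measurable_fst])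
  also have "\<dots> = P \<bind> return M"
  proof (rule bind_cong)
    fix \<xi> assume "\<xi> \<in> space P"
    then have \<xi>: "\<xi> \<in> space M" by (simp add: sp)
    interpret p: prob_space "p \<xi>" by (rule pk[OF \<xi>])
    show "distr (distr (p \<xi>) (M \<Otimes>\<^sub>M M) (Pair \<xi>)) M fst = return M \<xi>"
      using \<xi> by (subst distr_distr[OF measurable_fst pair[OF \<xi>]]) (simp add: comp_def)
  qed simp
  also have "\<dots> = P" by (rule bind_return''[OF sets])
  finally show "distr (kernel_joint M P p) M fst = P" .
  have "distr (kernel_joint M P p) M snd = P \<bind> (\<lambda>\<xi>. distr (distr (p \<xi>) (M \<Otimes>\<^sub>M M) (Pair \<xi>)) M snd)"
    unfolding kernel_joint_def by (rule distr_bind[OF k not_empty measurable_snd])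
  also have "\<dots> = P \<bind> p"
  proof (rule bind_cong)
    fix \<xi> assume "\<xi> \<in> space P"
    then have \<xi>: "\<xi> \<in> space M" by (simp add: sp)
    show "distr (distr (p \<xi>) (M \<Otimes>\<^sub>M M) (Pair \<xi>)) M snd = p \<xi>"
      using pk(1)[OF \<xi>] by (subst distr_distr[OF measurable_snd pair[OF \<xi>]]) (simp add: comp_def distr_id2)
  qed simp
  finally show "distr (kernel_joint M P p) M snd = P \<bind> p" .
qed

text \<open>In a Hausdorff space the complement of the diagonal is open, and by second countability
  the Borel sets of the square form the product sigma-algebra.\<close>

lemma pred_neq_pair:
  fixes \<mu> :: "'a::{second_countable_topology, t2_space} measure"
  assumes \<mu>: "sets \<mu> = sets borel"
  shows "Measurable.pred (\<mu> \<Otimes>\<^sub>M \<mu>) (\<lambda>(z, w). z \<noteq> w)"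
proof -
  have "open {z :: 'a \<times> 'a. fst z \<noteq> snd z}" by (intro open_Collect_neq continuous_intros)
  then have "{z :: 'a \<times> 'a. fst z \<noteq> snd z} \<in> sets (borel \<Otimes>\<^sub>M borel)"
    unfolding borel_prod by (rule borel_open)
  then have "Measurable.pred (borel \<Otimes>\<^sub>M borel) (\<lambda>z :: 'a \<times> 'a. fst z \<noteq> snd z)"
    by (simp add: pred_def space_pair_measure)
  then show ?thesis
    unfolding split_beta' by (simp add: measurable_cong_sets[OF sets_pair_measure_cong[OF \<mu> \<mu>] refl])
qed

lemma measure_atom_measurable:
  fixes z :: "'a::metric_space"
  shows "(\<lambda>\<xi>. measure \<xi> {z}) \<in> borel_measurable (counting_space n)"
  unfolding measure_def by (intro borel_measurable_enn2real emeasure_measurable_counting_space) simp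

section \<open>The coupling of tuples pushed forward to point measures\<close>

locale lifted_coupling = prob_space \<mu> for \<mu> :: "'a::polish_space measure" +
  fixes n :: nat and t :: real and p :: "(nat \<Rightarrow> 'a) \<Rightarrow> (nat \<Rightarrow> 'a) measure"
  assumes borel: "sets \<mu> = sets borel" and t: "0 \<le> t" "t \<le> 1"
    and p: "p \<in> (\<Pi>\<^sub>M i\<in>{..<n}. \<mu>) \<rightarrow>\<^sub>M prob_algebra (\<Pi>\<^sub>M i\<in>{..<n}. \<mu>)"
begin

abbreviation "PM \<equiv> \<Pi>\<^sub>M i\<in>{..<n}. \<mu>"
abbreviation "CS \<equiv> counting_space n :: 'a measure measure"

definition lifted :: "'a measure \<Rightarrow> 'a measure measure" where
  "lifted \<xi> = distr (arrangement \<mu> n \<xi> \<bind> p) CS (sum_dirac n)"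

lemma sum_dirac_kernel [measurable]: "sum_dirac n \<in> PM \<rightarrow>\<^sub>M CS"
  by (rule sum_dirac_measurable[OF borel])

lemma arrangement_kernel: "arrangement \<mu> n \<in> CS \<rightarrow>\<^sub>M prob_algebra PM"
  by (rule arrangement_measurable[OF borel])

lemma lifted_measurable: "lifted \<in> CS \<rightarrow>\<^sub>M prob_algebra CS"
  unfolding lifted_def
  by (rule measurable_compose[OF measurable_bind_prob_space[OF arrangement_kernel p] measurable_distr_prob_space[OF sum_dirac_kernel]])

lemma p_sets: "x \<in> space PM \<Longrightarrow> sets (p x) = sets PM"
  using measurable_space[OF p, of x] by (simp add: space_prob_algebra)

lemma nn_integral_lifted:
  assumes \<xi>: "\<xi> \<in> space CS" and G: "G \<in> borel_measurable CS"
  shows "(\<integral>\<^sup>+\<eta>. G \<eta> \<partial>lifted \<xi>) = (\<integral>\<^sup>+x. \<integral>\<^sup>+y. G (sum_dirac n y) \<partial>p x \<partial>arrangement \<mu> n \<xi>)"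
proof -
  have GS: "(\<lambda>y. G (sum_dirac n y)) \<in> borel_measurable PM" by (rule measurable_compose[OF sum_dirac_kernel G])
  have pa: "p \<in> arrangement \<mu> n \<xi> \<rightarrow>\<^sub>M subprob_algebra PM"
    using measurable_prob_algebraD[OF p] by (simp add: measurable_cong_sets[OF sets_arrangement refl])
  have "space (arrangement \<mu> n \<xi>) \<noteq> {}"
    using prob_space.not_empty[OF prob_space_arrangement[OF borel]] \<xi> by simp
  from sets_bind[OF subprob_measurableD(2)[OF pa] this]
  have bs: "sets (arrangement \<mu> n \<xi> \<bind> p) = sets PM" by simp
  have "(\<integral>\<^sup>+\<eta>. G \<eta> \<partial>lifted \<xi>) = (\<integral>\<^sup>+y. G (sum_dirac n y) \<partial>(arrangement \<mu> n \<xi> \<bind> p))"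
    unfolding lifted_def using sum_dirac_kernel G by (intro nn_integral_distr) (simp_all add: measurable_cong_sets[OF bs refl])
  also have "\<dots> = (\<integral>\<^sup>+x. \<integral>\<^sup>+y. G (sum_dirac n y) \<partial>p x \<partial>arrangement \<mu> n \<xi>)"
    by (rule nn_integral_bind[OF GS pa])
  finally show ?thesis .
qed

text \<open>At a site z the deficit under \<open>lifted \<xi>\<close> is the average of
  \<open>w z x\<close> over enumerations x of \<xi>, and Jensen moves this average outside. For a
  fixed enumeration the comparison with \<open>hamming_cost\<close> applies.\<close>

lemma cost_lifted_le:
  assumes \<xi>: "\<xi> \<in> space CS"
  shows "cost t \<xi> (lifted \<xi>) \<le> (\<integral>\<^sup>+x. hamming_cost t n x (p x) \<partial>arrangement \<mu> n \<xi>)"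
proof -
  define d where "d z \<eta> = max (1 - measure \<eta> {z} / measure \<xi> {z}) 0" for z and \<eta> :: "'a measure"
  define w where "w z x = (\<integral>y. d z (sum_dirac n y) \<partial>p x)" for z x
  have d01: "0 \<le> d z \<eta>" "d z \<eta> \<le> 1" for z \<eta> by (auto simp: d_def)
  have dm: "d z \<in> borel_measurable CS" for z
    unfolding d_def using measure_atom_measurable[of z n] by measurable
  have dS: "(\<lambda>y. d z (sum_dirac n y)) \<in> borel_measurable PM" for z
    by (rule measurable_compose[OF sum_dirac_kernel dm])
  have wm: "w z \<in> borel_measurable PM" for z
    unfolding w_def
    by (rule measurable_compose[OF measurable_prob_algebraD[OF p] integral_measurable_subprob_algebra[OF dS]])
  interpret A: prob_space "arrangement \<mu> n \<xi>" using \<xi> by (intro prob_space_arrangement borel) simp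
  have As: "sets (arrangement \<mu> n \<xi>) = sets PM" by simp
  have Asp: "space (arrangement \<mu> n \<xi>) = space PM" using sets_eq_imp_space_eq[OF As] .
  have w_nn: "(\<integral>\<^sup>+y. d z (sum_dirac n y) \<partial>p x) = ennreal (w z x)" and w01: "0 \<le> w z x \<and> w z x \<le> 1"
    if x: "x \<in> space PM" for x z
  proof -
    interpret px: prob_space "p x" using measurable_space[OF p x] by (simp add: space_prob_algebra)
    have int: "integrable (p x) (\<lambda>y. d z (sum_dirac n y))"
      using d01 dS by (intro px.integrable_const_bound[where B=1]) (auto simp: measurable_cong_sets[OF p_sets[OF x] refl])
    then show "(\<integral>\<^sup>+y. d z (sum_dirac n y) \<partial>p x) = ennreal (w z x)"
      unfolding w_def using d01 by (intro nn_integral_eq_integral) auto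
    show "0 \<le> w z x \<and> w z x \<le> 1"
      unfolding w_def using d01 int by (auto intro!: px.integral_le_const)
  qed
  have u_le: "acost t (\<integral>\<eta>. d z \<eta> \<partial>lifted \<xi>) \<le> (\<integral>\<^sup>+x. acost t (w z x) \<partial>arrangement \<mu> n \<xi>)" for z
  proof -
    have Ls: "sets (lifted \<xi>) = sets CS" by (simp add: lifted_def)
    have "(\<integral>\<eta>. d z \<eta> \<partial>lifted \<xi>) = enn2real (\<integral>\<^sup>+\<eta>. d z \<eta> \<partial>lifted \<xi>)"
      using d01 dm by (intro integral_eq_nn_integral) (auto simp: measurable_cong_sets[OF Ls refl])
    also have "(\<integral>\<^sup>+\<eta>. d z \<eta> \<partial>lifted \<xi>) = (\<integral>\<^sup>+x. ennreal (w z x) \<partial>arrangement \<mu> n \<xi>)"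
      using dm by (subst nn_integral_lifted[OF \<xi>]) (auto intro!: nn_integral_cong w_nn simp: Asp)
    also have "enn2real \<dots> = (\<integral>x. w z x \<partial>arrangement \<mu> n \<xi>)"
      using w01 wm by (intro integral_eq_nn_integral[symmetric]) (auto simp: Asp measurable_cong_sets[OF As refl])
    finally show ?thesis
      using acost_jensen[OF t A.prob_space_axioms, of "w z"] w01 wm
      by (simp add: Asp measurable_cong_sets[OF As refl])
  qed
  obtain x0 where x0: "sum_dirac n x0 = \<xi>" using \<xi> by (auto simp: counting_measures_def)
  have wm': "(\<lambda>x. acost t (w z x)) \<in> borel_measurable (arrangement \<mu> n \<xi>)" for z
    using measurable_compose[OF wm acost_measurable] by (simp add: measurable_cong_sets[OF As refl])
  have "cost t \<xi> (lifted \<xi>) = (\<integral>\<^sup>+z. acost t (\<integral>\<eta>. d z \<eta> \<partial>lifted \<xi>) \<partial>sum_dirac n x0)"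
    by (simp add: cost_def acost_def d_def x0)
  also have "\<dots> \<le> (\<integral>\<^sup>+z. (\<integral>\<^sup>+x. acost t (w z x) \<partial>arrangement \<mu> n \<xi>) \<partial>sum_dirac n x0)"
    by (intro nn_integral_mono u_le)
  also have "\<dots> = (\<integral>\<^sup>+x. (\<Sum>i<n. acost t (w (x0 i) x)) \<partial>arrangement \<mu> n \<xi>)"
    using wm' by (simp add: nn_integral_sum_dirac_t2 nn_integral_sum)
  also have "\<dots> \<le> (\<integral>\<^sup>+x. hamming_cost t n x (p x) \<partial>arrangement \<mu> n \<xi>)"
  proof (rule nn_integral_mono_AE, rule arrangement_AE[OF borel])
    have 1: "(\<lambda>x. \<Sum>i<n. acost t (w (x0 i) x)) \<in> borel_measurable PM"
      by (intro borel_measurable_sum measurable_compose[OF wm acost_measurable])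
    have 2: "(\<lambda>x. hamming_cost t n x (p x)) \<in> borel_measurable PM"
      using hamming_cost_measurable[OF pred_neq_pair[OF borel] p measurable_ident_sets[OF refl]] by (simp add: id_def)
    show "Measurable.pred PM (\<lambda>x. (\<Sum>i<n. acost t (w (x0 i) x)) \<le> hamming_cost t n x (p x))"
      unfolding pred_def using 1 2 by (rule borel_measurable_le)
    fix x :: "nat \<Rightarrow> 'a" assume x: "x \<in> extensional {..<n}" "sum_dirac n x = \<xi>"
    have xs: "x \<in> space PM" using x(1) by (simp add: space_PiM_borel[OF borel])
    \<comment> \<open>Both tuples enumerate \<xi>, so the two sums are the same integral against
      \<xi>.\<close>
    have "(\<Sum>i<n. acost t (w (x0 i) x)) = (\<Sum>i<n. acost t (w (x i) x))"
      using nn_integral_sum_dirac_t2[where f="\<lambda>z. acost t (w z x)" and n=n and x=x0]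
        nn_integral_sum_dirac_t2[where f="\<lambda>z. acost t (w z x)" and n=n and x=x] x(2) x0 by simp
    also have "\<dots> \<le> hamming_cost t n x (p x)"
      unfolding w_def d_def x(2)[symmetric]
      using measurable_space[OF p xs] measurable_compose[OF sum_dirac_kernel measure_atom_measurable]
      by (intro sum_atoms_acost_le_hamming_cost[OF t borel]) auto
    finally show "(\<Sum>i<n. acost t (w (x0 i) x)) \<le> hamming_cost t n x (p x)" .
  qed (use \<xi> in simp)
  finally show ?thesis .
qed

end

text \<open>Phrased with densities so that the whole estimate stays in \<open>ennreal\<close>.
  Composing the densities with \<open>sum_dirac n\<close> preserves the integrals of
  \<open>entropy_fun\<close>, since the reference process is the image of the product
  measure.\<close>

lemma transport_cost_binomial_process_le:
  fixes \<mu> :: "'a::polish_space measure" and n :: nat and t :: real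
  assumes mu: "prob_space \<mu>" and borel: "sets \<mu> = sets borel" and t: "0 \<le> t" "t \<le> 1"
    and P1: "P1 \<in> space (prob_algebra (counting_space n))" and P2: "P2 \<in> space (prob_algebra (counting_space n))"
    and f1: "prob_density (binomial_process \<mu> n) f1" "density (binomial_process \<mu> n) f1 = P1"
    and f2: "prob_density (binomial_process \<mu> n) f2" "density (binomial_process \<mu> n) f2 = P2"
  shows "transport_cost (counting_space n) (cost t) P2 P1
    \<le> 1 / ennreal t * (\<integral>\<^sup>+\<xi>. entropy_fun (f1 \<xi>) \<partial>binomial_process \<mu> n)
      + 1 / ennreal (1 - t) * (\<integral>\<^sup>+\<xi>. entropy_fun (f2 \<xi>) \<partial>binomial_process \<mu> n)"
proof -
  let ?P = "\<Pi>\<^sub>M i\<in>{..<n}. \<mu>" and ?C = "counting_space n :: 'a measure measure"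
  let ?B = "binomial_process \<mu> n" and ?S = "sum_dirac n :: (nat \<Rightarrow> 'a) \<Rightarrow> 'a measure"
  have S: "?S \<in> ?P \<rightarrow>\<^sub>M ?C" by (rule sum_dirac_measurable[OF borel])
  have Bs: "sets ?B = sets ?C" by (simp add: binomial_process_def)
  have B_int: "(\<integral>\<^sup>+\<xi>. G \<xi> \<partial>?B) = (\<integral>\<^sup>+x. G (?S x) \<partial>?P)" if "G \<in> borel_measurable ?C" for G :: "_ \<Rightarrow> ennreal"
    unfolding binomial_process_def using S that by (intro nn_integral_distr) auto
  have fm: "f1 \<in> borel_measurable ?C" "f2 \<in> borel_measurable ?C"
    using f1(1) f2(1) by (auto simp: prob_density_def measurable_cong_sets[OF Bs refl])
  note [measurable] = S fm
  define F1 F2 where "F1 x = f1 (?S x)" and "F2 x = f2 (?S x)" for x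
  have [measurable]: "F1 \<in> borel_measurable ?P" "F2 \<in> borel_measurable ?P"
    unfolding F1_def F2_def by measurable
  have dens: "prob_density ?P F1" "prob_density ?P F2"
    using f1(1) f2(1) by (auto simp: prob_density_def F1_def F2_def B_int)
  have P1_int: "(\<integral>\<^sup>+\<xi>. G \<xi> \<partial>P1) = (\<integral>\<^sup>+x. ennreal (F1 x) * G (?S x) \<partial>?P)" if G[measurable]: "G \<in> borel_measurable ?C" for G :: "_ \<Rightarrow> ennreal"
  proof -
    have "(\<integral>\<^sup>+\<xi>. G \<xi> \<partial>P1) = (\<integral>\<^sup>+\<xi>. ennreal (f1 \<xi>) * G \<xi> \<partial>?B)"
      unfolding f1(2)[symmetric] using fm G
      by (intro nn_integral_density) (simp_all add: measurable_cong_sets[OF Bs refl])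
    also have "\<dots> = (\<integral>\<^sup>+x. ennreal (F1 x) * G (?S x) \<partial>?P)"
      unfolding F1_def by (rule B_int) measurable
    finally show ?thesis .
  qed
  have P2_int: "(\<integral>\<^sup>+\<xi>. G \<xi> \<partial>P2) = (\<integral>\<^sup>+x. ennreal (F2 x) * G (?S x) \<partial>?P)" if G[measurable]: "G \<in> borel_measurable ?C" for G :: "_ \<Rightarrow> ennreal"
  proof -
    have "(\<integral>\<^sup>+\<xi>. G \<xi> \<partial>P2) = (\<integral>\<^sup>+\<xi>. ennreal (f2 \<xi>) * G \<xi> \<partial>?B)"
      unfolding f2(2)[symmetric] using fm G
      by (intro nn_integral_density) (simp_all add: measurable_cong_sets[OF Bs refl])
    also have "\<dots> = (\<integral>\<^sup>+x. ennreal (F2 x) * G (?S x) \<partial>?P)"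
      unfolding F2_def by (rule B_int) measurable
    finally show ?thesis .
  qed
  have "entropy_cost_bound t ?P (hamming_cost t n)"
    by (rule entropy_cost_bound_PiM[OF mu t pred_neq_pair[OF borel]])
  then obtain p where tr: "transports ?P F1 F2 p"
    and p_le: "(\<integral>\<^sup>+x. ennreal (F1 x) * hamming_cost t n x (p x) \<partial>?P)
        \<le> 1 / ennreal t * (\<integral>\<^sup>+x. entropy_fun (F1 x) \<partial>?P) + 1 / ennreal (1 - t) * (\<integral>\<^sup>+x. entropy_fun (F2 x) \<partial>?P)"
    using dens unfolding entropy_cost_bound_def by blast
  have pm: "p \<in> ?P \<rightarrow>\<^sub>M prob_algebra ?P" using tr by (simp add: transports_def)
  interpret lifted_coupling \<mu> n t p
    using mu borel t pm by (simp add: lifted_coupling_def lifted_coupling_axioms_def)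
  \<comment> \<open>A uniform enumeration of a point measure of law P1 has density F1, because F1 is
    a function of the point measure alone.\<close>
  have P1_arr: "(\<integral>\<^sup>+\<xi>. \<integral>\<^sup>+x. H x \<partial>arrangement \<mu> n \<xi> \<partial>P1) = (\<integral>\<^sup>+x. ennreal (F1 x) * H x \<partial>?P)"
    if H: "H \<in> borel_measurable ?P" for H :: "_ \<Rightarrow> ennreal"
  proof -
    have "(\<lambda>\<xi>. \<integral>\<^sup>+x. H x \<partial>arrangement \<mu> n \<xi>) \<in> borel_measurable ?C"
      by (rule measurable_compose[OF measurable_prob_algebraD[OF arrangement_kernel] nn_integral_measurable_subprob_algebra[OF H]])
    then have "(\<integral>\<^sup>+\<xi>. \<integral>\<^sup>+x. H x \<partial>arrangement \<mu> n \<xi> \<partial>P1)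
      = (\<integral>\<^sup>+x. ennreal (F1 x) * (\<integral>\<^sup>+y. H y \<partial>arrangement \<mu> n (?S x)) \<partial>?P)"
      by (rule P1_int)
    also have "\<dots> = (\<integral>\<^sup>+x. ennreal (F1 x) * H x \<partial>?P)"
      unfolding F1_def using H by (intro nn_integral_PiM_arrangement mu borel) measurable
    finally show ?thesis .
  qed
  have P1s: "sets P1 = sets ?C" and P2s: "sets P2 = sets ?C"
    using P1 P2 by (auto simp: space_prob_algebra)
  have P1p: "space P1 = space ?C" by (rule sets_eq_imp_space_eq[OF P1s])
  \<comment> \<open>Enumerating uniformly under P1 gives density F1, p carries it to density F2, and
    the image of that law under \<open>sum_dirac n\<close> is P2.\<close>
  have "P1 \<bind> lifted = P2"
  proof (rule measure_eqI)
    have lm: "lifted \<in> P1 \<rightarrow>\<^sub>M subprob_algebra ?C"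
      using measurable_prob_algebraD[OF lifted_measurable] by (simp add: measurable_cong_sets[OF P1s refl])
    have ne: "space P1 \<noteq> {}" using P1 by (intro prob_space.not_empty) (simp add: space_prob_algebra)
    have bs: "sets (P1 \<bind> lifted) = sets ?C"
      using sets_bind[OF subprob_measurableD(2)[OF lm] ne] by simp
    then show "sets (P1 \<bind> lifted) = sets P2" using P2s by simp
    fix A assume "A \<in> sets (P1 \<bind> lifted)"
    then have A: "A \<in> sets ?C" using bs by simp
    define H where "H x = (\<integral>\<^sup>+y. indicator A (?S y) \<partial>p x)" for x :: "nat \<Rightarrow> 'a"
    have im: "(indicator A :: _ \<Rightarrow> ennreal) \<in> borel_measurable ?C" using A by simp
    have iS: "(\<lambda>y. indicator A (?S y) :: ennreal) \<in> borel_measurable ?P"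
      by (rule measurable_compose[OF S im])
    have H: "H \<in> borel_measurable ?P"
      unfolding H_def
      by (rule measurable_compose[OF measurable_prob_algebraD[OF pm] nn_integral_measurable_subprob_algebra[OF iS]])
    have "emeasure (P1 \<bind> lifted) A = (\<integral>\<^sup>+\<xi>. emeasure (lifted \<xi>) A \<partial>P1)"
      by (rule emeasure_bind[OF ne lm A])
    also have "\<dots> = (\<integral>\<^sup>+\<xi>. \<integral>\<^sup>+x. H x \<partial>arrangement \<mu> n \<xi> \<partial>P1)"
    proof (rule nn_integral_cong)
      fix \<xi> assume "\<xi> \<in> space P1"
      then have \<xi>: "\<xi> \<in> space ?C" by (simp add: P1p)
      have "sets (lifted \<xi>) = sets ?C" by (simp add: lifted_def)
      then have "emeasure (lifted \<xi>) A = (\<integral>\<^sup>+\<eta>. indicator A \<eta> \<partial>lifted \<xi>)" using A by simp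
      then show "emeasure (lifted \<xi>) A = (\<integral>\<^sup>+x. H x \<partial>arrangement \<mu> n \<xi>)"
        unfolding nn_integral_lifted[OF \<xi> im] H_def .
    qed
    also have "\<dots> = (\<integral>\<^sup>+x. ennreal (F1 x) * H x \<partial>?P)" by (rule P1_arr[OF H])
    also have "\<dots> = (\<integral>\<^sup>+x. ennreal (F2 x) * indicator A (?S x) \<partial>?P)"
      using tr iS unfolding transports_def H_def by blast
    also have "\<dots> = (\<integral>\<^sup>+\<xi>. indicator A \<xi> \<partial>P2)" by (rule P2_int[OF im, symmetric])
    also have "\<dots> = emeasure P2 A" using A P2s by simp
    finally show "emeasure (P1 \<bind> lifted) A = emeasure P2 A" .
  qed
  then have "lifted \<in> coupling_kernels ?C P1 P2"
    using lifted_measurable distr_kernel_joint[OF lifted_measurable P1] by (simp add: coupling_kernels_def)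
  then have "transport_cost ?C (cost t) P2 P1 \<le> (\<integral>\<^sup>+\<xi>. cost t \<xi> (lifted \<xi>) \<partial>P1)"
    unfolding transport_cost_def by (rule INF_lower)
  also have "\<dots> \<le> (\<integral>\<^sup>+\<xi>. \<integral>\<^sup>+x. hamming_cost t n x (p x) \<partial>arrangement \<mu> n \<xi> \<partial>P1)"
    using cost_lifted_le P1p by (intro nn_integral_mono) simp
  also have "\<dots> = (\<integral>\<^sup>+x. ennreal (F1 x) * hamming_cost t n x (p x) \<partial>?P)"
    using hamming_cost_measurable[OF pred_neq_pair[OF borel] pm measurable_ident_sets[OF refl]]
    by (intro P1_arr) (simp add: id_def)
  also note p_le
  finally show ?thesis
    using fm by (simp add: B_int F1_def F2_def)
qed

section \<open>The inequality in extended real numbers\<close>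

theorem corollary3p4:
  fixes \<mu> :: "'a::polish_space measure" and n :: nat and t :: real
    and P\<^sub>1 P\<^sub>2 :: "'a measure measure"
  assumes "\<mu> \<in> space (prob_algebra borel)"
    and "0 \<le> t" and "t \<le> 1"
    and "P\<^sub>1 \<in> space (prob_algebra (counting_space n))"
    and "P\<^sub>2 \<in> space (prob_algebra (counting_space n))"
  shows "enn2ereal (transport_cost (counting_space n) (cost t) P\<^sub>2 P\<^sub>1)
    \<le> 1 / ereal t * rel_entropy P\<^sub>1 (binomial_process \<mu> n)
      + 1 / ereal (1 - t) * rel_entropy P\<^sub>2 (binomial_process \<mu> n)"
proof -
  let ?B = "binomial_process \<mu> n"
  have mu: "prob_space \<mu>" "sets \<mu> = sets borel" using assms(1) by (auto simp: space_prob_algebra)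
  have P: "prob_space P\<^sub>1" "prob_space P\<^sub>2" "sets P\<^sub>1 = sets ?B" "sets P\<^sub>2 = sets ?B"
    using assms(4,5) by (auto simp: space_prob_algebra binomial_process_def)
  have B: "prob_space ?B"
    unfolding binomial_process_def
    by (intro prob_space.prob_space_distr prob_space_PiM sum_dirac_measurable mu)
  \<comment> \<open>This includes s = 0, where both sides are infinite, so the endpoint conventions
    of \<open>ereal\<close> and \<open>ennreal\<close> match.\<close>
  have inv: "1 / ereal s = enn2ereal (1 / ennreal s)" if "0 \<le> s" for s
    using that by (simp add: divide_ennreal_def divide_ereal_def inverse_ennreal.rep_eq)
  \<comment> \<open>Strict positivity ensures that a coefficient never annihilates the infinite
    entropy of a law that is not absolutely continuous.\<close>
  have pos: "0 < 1 / ereal s" if "0 \<le> s" for s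
    using that by (cases "s = 0") (auto simp: divide_ereal_def)
  have top: "c * \<infinity> = \<infinity>" if "0 < c" for c :: ereal
    using that by (cases c) auto
  consider "\<not> absolutely_continuous ?B P\<^sub>1" | "\<not> absolutely_continuous ?B P\<^sub>2"
    | "absolutely_continuous ?B P\<^sub>1" "absolutely_continuous ?B P\<^sub>2" by blast
  then show ?thesis
  proof cases
    case 1
    then have "1 / ereal t * rel_entropy P\<^sub>1 ?B = \<infinity>"
      unfolding rel_entropy_def using top pos assms(2) by simp
    then show ?thesis by simp
  next
    case 2
    then have "1 / ereal (1 - t) * rel_entropy P\<^sub>2 ?B = \<infinity>"
      unfolding rel_entropy_def using top pos assms(3) by simp
    then show ?thesis by simp
  next
    case 3
    obtain f1 where f1: "prob_density ?B f1" "density ?B f1 = P\<^sub>1"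
      "rel_entropy P\<^sub>1 ?B = enn2ereal (\<integral>\<^sup>+\<xi>. entropy_fun (f1 \<xi>) \<partial>?B)"
      by (rule rel_entropy_eq[OF P(1) B P(3) 3(1)])
    obtain f2 where f2: "prob_density ?B f2" "density ?B f2 = P\<^sub>2"
      "rel_entropy P\<^sub>2 ?B = enn2ereal (\<integral>\<^sup>+\<xi>. entropy_fun (f2 \<xi>) \<partial>?B)"
      by (rule rel_entropy_eq[OF P(2) B P(4) 3(2)])
    have "transport_cost (counting_space n) (cost t) P\<^sub>2 P\<^sub>1
      \<le> 1 / ennreal t * (\<integral>\<^sup>+\<xi>. entropy_fun (f1 \<xi>) \<partial>?B) + 1 / ennreal (1 - t) * (\<integral>\<^sup>+\<xi>. entropy_fun (f2 \<xi>) \<partial>?B)"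
      by (rule transport_cost_binomial_process_le[OF mu assms(2-5) f1(1,2) f2(1,2)])
    then show ?thesis
      using assms(2,3) by (simp only: less_eq_ennreal.rep_eq plus_ennreal.rep_eq times_ennreal.rep_eq f1(3) f2(3) inv diff_ge_0_iff_ge)
  qed
qed

end
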